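(* Let $a>0$ and $-1<b\le 0$. If $a\le \alpha_*(1+b)$, then $F_{a,b}$ is a Bernstein function and $$F_{a,b}(x)=\kappa_b+\int_0^\infty (1-e^{-xt})\,\rho_{a,b}(t)\,dt,\qquad x>0,$$ where $\rho_{a,b}$, given explicitly by $\rho_{a,b}(t)=a e^{a-at}D_{a,-b}(at)$, is a continuous, nonnegative, integrable density on $[0,\infty)$. Its total mass is $$\int_0^\infty \rho_{a,b}(t)\,dt=e^a-\kappa_b .$$ If $b<0$, then, with $\tau=a/\alpha_*-b\in(-b,1]$, $$\rho_{a,b}(t)\ge \frac{-ab}{9}\left(1-\frac{8b}{\tau}\right)e^{a-at}>0,\qquad t\ge 0 .$$ Moreover, $\alpha_*$ is the largest constant $C$ for which the implication $$0<a\le C(1+b)\ \Longrightarrow\ F_{a,b}\text{ is a Bernstein function}$$ holds for every $-1<b\le 0$.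
   Context: A function $g\in C^\infty(0,\infty)$ is completely monotone if $(-1)^n g^{(n)}\ge 0$ on $(0,\infty)$ for every integer $n\ge 0$. A nonnegative smooth function $f$ on $(0,\infty)$ is a Bernstein function if $f'$ is completely monotone. For $a>0$, $b\in\mathbb{R}$, $x>0$: $F_{a,b}(x)=\left(1+\frac{a}{x}\right)^{x+b}$. Set $\kappa_b=0$ for $-1<b<0$ and $\kappa_0=1$. For $\alpha>0$, $y>0$: $h_\alpha(y)=\left(1+\frac1y\right)^{\alpha y}$, and $\alpha_*=\sup\{\alpha>0: h_\alpha\text{ is a Bernstein function}\}$ (a finite positive number). For $a>0$, $0\le c<1$, $a+c<3$, put $$w_{a,c}(s)=\frac1\pi\left(\frac{s}{1-s}\right)^{as+c}\sin\bigl(\pi(as+c)\bigr)\quad(0<s<1),$$ $$q_1=\frac a2+c,\qquad q_2=\frac a3+\frac c2+\frac12\left(\frac a2+c\right)^2,$$ $$D_{a,c}(t)=q_1+(q_1-q_2)t+e^{-a}\int_0^1 w_{a,c}(s)\bigl[e^{(1-s)t}-1-(1-s)t\bigr]\,ds .$$ *)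

theory Defs
  imports "HOL-Analysis.Analysis"
begin

text \<open>
  Only the values at positive reals matter below: since the open half-line is open, the iterated
  derivatives of a total function at points \<open>x > 0\<close> do not depend on its values at \<open>x \<le> 0\<close>.
\<close>

definition smooth_on_pos :: "(real \<Rightarrow> real) \<Rightarrow> bool" where
  "smooth_on_pos f \<longleftrightarrow> (\<forall>n. (deriv ^^ n) f differentiable_on {0<..})"

definition completely_monotone :: "(real \<Rightarrow> real) \<Rightarrow> bool" where
  "completely_monotone g \<longleftrightarrow>
     smooth_on_pos g \<and> (\<forall>n. \<forall>x>0. (-1) ^ n * (deriv ^^ n) g x \<ge> 0)"

definition bernstein_function :: "(real \<Rightarrow> real) \<Rightarrow> bool" where
  "bernstein_function f \<longleftrightarrow>
     smooth_on_pos f \<and> (\<forall>x>0. f x \<ge> 0) \<and> completely_monotone (deriv f)"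

definition F :: "real \<Rightarrow> real \<Rightarrow> real \<Rightarrow> real" where
  "F a b x = (1 + a / x) powr (x + b)"

text \<open>Used for \<open>-1 < b \<le> 0\<close> only.\<close>

definition kappa :: "real \<Rightarrow> real" where
  "kappa b = (if b = 0 then 1 else 0)"

definition h :: "real \<Rightarrow> real \<Rightarrow> real" where
  "h \<alpha> y = (1 + 1 / y) powr (\<alpha> * y)"

definition alpha_star :: real where
  "alpha_star = Sup {\<alpha>. \<alpha> > 0 \<and> bernstein_function (h \<alpha>)}"

definition w :: "real \<Rightarrow> real \<Rightarrow> real \<Rightarrow> real" where
  "w a c s = 1 / pi * (s / (1 - s)) powr (a * s + c) * sin (pi * (a * s + c))"

definition q1 :: "real \<Rightarrow> real \<Rightarrow> real" where
  "q1 a c = a / 2 + c"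

definition q2 :: "real \<Rightarrow> real \<Rightarrow> real" where
  "q2 a c = a / 3 + c / 2 + 1 / 2 * (a / 2 + c)\<^sup>2"

text \<open>
  The functions \<open>D a c\<close> and \<open>w a c\<close> are meant for \<open>a > 0\<close>, \<open>0 \<le> c < 1\<close>, \<open>a + c < 3\<close>; the last
  condition makes the integral converge at \<open>s = 1\<close>, where the bracket vanishes to second order.
\<close>

definition D_integrand :: "real \<Rightarrow> real \<Rightarrow> real \<Rightarrow> real \<Rightarrow> real" where
  "D_integrand a c t s = w a c s * (exp ((1 - s) * t) - 1 - (1 - s) * t)"

definition D :: "real \<Rightarrow> real \<Rightarrow> real \<Rightarrow> real" where
  "D a c t = q1 a c + (q1 a c - q2 a c) * t
     + exp (- a) * (LINT s:{0<..<1}|lborel. D_integrand a c t s)"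

definition rho :: "real \<Rightarrow> real \<Rightarrow> real \<Rightarrow> real" where
  "rho a b t = a * exp (a - a * t) * D a (- b) (a * t)"

end

theory Submission
  imports Defs "HOL-Complex_Analysis.Complex_Analysis" "HOL-Probability.Distributions"
begin

text \<open>
  Put \<open>y = x / a\<close> and \<open>c = - b\<close>, so that \<open>F a b x = (1 + 1 / y) powr (a * y - c)\<close>. In the variable
  \<open>z = 1 / (1 + y)\<close> this function is \<open>exp a\<close> times \<open>exp (- (\<Sum>n\<ge>1. (a / (n + 1) + c) * z ^ n / n))\<close>. The
  Taylor coefficients \<open>nu a c n\<close> of the second factor are defined for all \<open>a\<close> and \<open>c\<close>, and since \<open>z ^ (n + 1)\<close> is
  the Laplace transform of \<open>t ^ n / fact n * exp (- t)\<close>, the entire function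
  \<open>dens a c t = - (\<Sum>n. nu a c (n + 1) * t ^ n / fact n)\<close> gives, for every \<open>y > 0\<close>,
  \<open>exp (- a) * (1 + 1 / y) powr (a * y - c) = 1 - \<integral> exp (- y * t) * exp (- t) * dens a c t dt\<close>
  (\<open>lap_ker\<close>). Every claim becomes a claim about \<open>dens\<close>.

  First, \<open>D a c = dens a c\<close> when \<open>a + c < 3\<close> (\<open>D_eq_dens\<close>). Expanding the exponential in the
  definition of \<open>D\<close>, this says that the moments \<open>\<integral> w a c s * (1 - s) ^ n ds\<close>, \<open>n \<ge> 2\<close>, are
  \<open>- exp a * nu a c (n + 1)\<close> (\<open>w_moment\<close>): up to sign \<open>pi * w\<close> is the imaginary part of the boundary
  values of the function on the cut \<open>[-1, 0]\<close> of the \<open>y\<close>-plane. The coordinate \<open>\<zeta> = ln (1 - z)\<close>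
  turns the cut plane into a strip, where a primitive replaces contour integration.

  Second, \<open>dens a c \<ge> 0\<close> makes \<open>F a b\<close> a Bernstein function, by differentiation under the integral;
  conversely, if \<open>h \<alpha>\<close> is Bernstein then \<open>dens \<alpha> 0 \<ge> 0\<close>, by the inversion \<open>lap_inversion\<close>. Since the class of completely monotone
  functions is closed under products, \<open>dens a c \<ge> 0\<close> implies
  \<open>dens (p * a) (p * c) \<ge> p * dens a c\<close> for \<open>0 < p \<le> 1\<close> (\<open>dens_power\<close>). Hence the exponents
  \<open>\<alpha>\<close> with \<open>h \<alpha>\<close> Bernstein form an interval; \<open>dens\<close> is continuous in \<open>\<alpha>\<close>, so the
  interval contains its supremum \<open>alpha_star\<close>. Two evaluations, \<open>dens (9/4) 0 \<ge> 0\<close> and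
  \<open>dens (58/25) 0 5 < 0\<close>, give \<open>9/4 \<le> alpha_star \<le> 58/25\<close>.

  Third, for \<open>b < 0\<close> let \<open>\<tau> = a / alpha_star + c\<close> and \<open>\<lambda> = c / \<tau>\<close>. Then \<open>F a b\<close> is, up to a
  constant factor, the \<open>\<tau>\<close>-th power of the member with parameters
  \<open>(alpha_star * (1 - \<lambda>), \<lambda>)\<close> of the segment from \<open>(alpha_star, 0)\<close> to \<open>(0, 1)\<close>. Along
  this segment \<open>dens\<close> exceeds the chord \<open>(1 - \<lambda>) * dens alpha_star 0 + \<lambda>\<close> except for an error of at
  most \<open>8/9 * \<lambda> * (1 - \<lambda>)\<close> (\<open>dens_interpolation\<close>): the Taylor coefficients of the difference
  are nonnegative from the fourth one on, and the first three are small. So \<open>dens\<close> is at least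
  \<open>\<lambda> * (1 + 8 * \<lambda>) / 9\<close> there, and \<open>dens_power\<close> with \<open>p = \<tau>\<close> yields the lower bound.
\<close>

section \<open>The Taylor expansion in 1 / (1 + y)\<close>

text \<open>
  With \<open>z = 1 / (1 + y)\<close> one has
  \<open>exp (- a) * (1 + 1 / y) powr (a * y - c) = exp (- (\<Sum>n\<ge>1. cf a c n * z ^ n / n))\<close>; the Taylor
  coefficients \<open>nu a c n\<close> of this function of \<open>z\<close> satisfy the recursion that \<open>f' = - k' * f\<close>
  imposes on the coefficients of \<open>f = exp (- k)\<close>.
\<close>

definition cf :: "real \<Rightarrow> real \<Rightarrow> nat \<Rightarrow> real" where
  "cf a c n = a / real (n + 1) + c"

fun nu :: "real \<Rightarrow> real \<Rightarrow> nat \<Rightarrow> real" where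
  "nu a c 0 = 1"
| "nu a c (Suc n) = - (\<Sum>k\<le>n. cf a c (Suc n - k) * nu a c k) / real (Suc n)"

lemma nu_bound_aux:
  assumes "\<And>n. n \<ge> 1 \<Longrightarrow> \<bar>cf a c n\<bar> \<le> M"
  shows "real (Suc n) * \<bar>nu a c (Suc n)\<bar> \<le> M * (\<Sum>k\<le>n. \<bar>nu a c k\<bar>)"
proof -
  have "real (Suc n) * \<bar>nu a c (Suc n)\<bar> = \<bar>\<Sum>k\<le>n. cf a c (Suc n - k) * nu a c k\<bar>"
    by (simp add: abs_mult abs_divide del: of_nat_Suc)
  also have "\<dots> \<le> (\<Sum>k\<le>n. \<bar>cf a c (Suc n - k) * nu a c k\<bar>)" by (rule sum_abs)
  also have "\<dots> \<le> (\<Sum>k\<le>n. M * \<bar>nu a c k\<bar>)"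
    by (intro sum_mono) (auto simp: abs_mult intro!: mult_right_mono assms)
  finally show ?thesis by (simp add: sum_distrib_left)
qed

lemma cf_bound: "\<bar>cf a c n\<bar> \<le> \<bar>a\<bar> + \<bar>c\<bar>"
proof -
  have "\<bar>a\<bar> / (1 + real n) \<le> \<bar>a\<bar>"
    using divide_left_mono[of 1 "1 + real n" "\<bar>a\<bar>"] by simp
  then have "\<bar>a / real (n + 1)\<bar> \<le> \<bar>a\<bar>" by (simp add: abs_divide add.commute)
  then show ?thesis unfolding cf_def
    using abs_triangle_ineq[of "a / real (n+1)" c] by linarith
qed

lemma nu_le_power:
  assumes "\<bar>a\<bar> + \<bar>c\<bar> \<le> M"
  shows "\<bar>nu a c n\<bar> \<le> (M + 1) ^ n"
proof (induction n rule: less_induct)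
  case (less n)
  have M: "M \<ge> 0" using assms by linarith
  have cb: "\<bar>cf a c n\<bar> \<le> M" for n using cf_bound[of a c n] assms by linarith
  show ?case
  proof (cases n)
    case (Suc m)
    have "(\<Sum>k\<le>m. (M+1)^k) * M = (M+1)^Suc m - 1"
      using power_diff_1_eq[of "M+1" "Suc m"] by (simp add: mult.commute lessThan_Suc_atMost)
    have "1 * \<bar>nu a c (Suc m)\<bar> \<le> real (Suc m) * \<bar>nu a c (Suc m)\<bar>"
      by (intro mult_right_mono) auto
    also have "\<dots> \<le> M * (\<Sum>k\<le>m. \<bar>nu a c k\<bar>)" by (rule nu_bound_aux[OF cb])
    also have "\<dots> \<le> M * (\<Sum>k\<le>m. (M+1)^k)"
      using Suc less M by (intro mult_left_mono sum_mono) auto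
    also have "\<dots> = (M+1)^Suc m - 1"
      using \<open>(\<Sum>k\<le>m. (M+1)^k) * M = (M+1)^Suc m - 1\<close> by (simp add: mult.commute)
    finally show ?thesis using Suc by simp
  qed simp
qed

text \<open>
  Radius of convergence at least 1, read off from the recursion: once \<open>n\<close> exceeds
  \<open>M / (\<rho> - 1)\<close>, dividing by \<open>n\<close> absorbs the factor from the geometric sum of the earlier bounds.
\<close>

lemma nu_growth:
  assumes "\<rho> > 1"
  shows "\<exists>C>0. \<forall>n. \<bar>nu a c n\<bar> \<le> C * \<rho> ^ n"
proof -
  define M where "M = \<bar>a\<bar> + \<bar>c\<bar>"
  obtain N :: nat where N: "M / (\<rho> - 1) \<le> real N" using real_arch_simple by blast
  define C where "C = (M + 1) ^ N"
  have M: "M \<ge> 0" by (simp add: M_def)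
  have C: "C > 0" using M by (simp add: C_def add_pos_nonneg)
  have cb: "\<bar>cf a c n\<bar> \<le> M" for n using cf_bound[of a c n] by (simp add: M_def)
  have "\<bar>nu a c n\<bar> \<le> C * \<rho> ^ n" for n
  proof (induction n rule: less_induct)
    case (less n)
    show ?case
    proof (cases "n \<le> N")
      case True
      have "\<bar>nu a c n\<bar> \<le> (M + 1) ^ n" by (rule nu_le_power) (simp add: M_def)
      also have "\<dots> \<le> (M + 1) ^ N" using True M by (intro power_increasing) auto
      also have "\<dots> \<le> C * \<rho> ^ n"
        using mult_left_mono[of 1 "\<rho>^n" C] C assms by (simp add: C_def)
      finally show ?thesis .
    next
      case False
      then obtain m where m: "n = Suc m" by (cases n) auto
      have s: "(\<Sum>k\<le>m. \<rho>^k) * (\<rho> - 1) = \<rho>^n - 1"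
        using power_diff_1_eq[of \<rho> "Suc m"] m by (simp add: mult.commute lessThan_Suc_atMost)
      have "real n * \<bar>nu a c n\<bar> \<le> M * (\<Sum>k\<le>m. \<bar>nu a c k\<bar>)"
        unfolding m by (rule nu_bound_aux[OF cb])
      also have "\<dots> \<le> M * (\<Sum>k\<le>m. C * \<rho> ^ k)"
        using m M less by (intro mult_left_mono sum_mono) auto
      also have "\<dots> = (M / (\<rho> - 1)) * C * ((\<Sum>k\<le>m. \<rho>^k) * (\<rho> - 1))"
        using assms by (simp add: sum_distrib_left[symmetric])
      also have "\<dots> = (M / (\<rho> - 1)) * C * (\<rho>^n - 1)" by (simp only: s)
      also have "\<dots> \<le> real n * C * (\<rho>^n)"
        using False N C M assms by (intro mult_mono) auto
      finally have "real n * \<bar>nu a c n\<bar> \<le> real n * (C * \<rho> ^ n)" by (simp add: mult.assoc)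
      moreover have "real n > 0" using m by simp
      ultimately show ?thesis by (rule mult_left_le_imp_le)
    qed
  qed
  then show ?thesis using C by blast
qed

definition nu_fps :: "real \<Rightarrow> real \<Rightarrow> complex fps" where
  "nu_fps a c = Abs_fps (\<lambda>n. of_real (nu a c n))"

definition exponent_fps :: "real \<Rightarrow> real \<Rightarrow> complex fps" where
  "exponent_fps a c = Abs_fps (\<lambda>n. if n = 0 then 0 else of_real (cf a c n / real n))"

lemma nu_summable:
  assumes "\<bar>r\<bar> < 1"
  shows "summable (\<lambda>n. nu a c n * r ^ n)"
proof -
  obtain \<rho> where \<rho>: "1 < \<rho>" "\<rho> * \<bar>r\<bar> < 1"
  proof (cases "r = 0")
    case False
    define \<rho> where "\<rho> = (1 + 1/\<bar>r\<bar>)/2"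
    have "1 < 1 / \<bar>r\<bar>" using assms False by simp
    then have "1 < \<rho>" "\<rho> < 1 / \<bar>r\<bar>" by (auto simp: \<rho>_def)
    with False show ?thesis by (intro that[of \<rho>]) (auto simp: field_simps)
  qed (use that[of 2] in auto)
  obtain C where C: "C > 0" "\<And>n. \<bar>nu a c n\<bar> \<le> C * \<rho> ^ n" using nu_growth[OF \<rho>(1)] by blast
  show ?thesis
  proof (rule summable_comparison_test')
    show "summable (\<lambda>n. C * (\<rho> * \<bar>r\<bar>) ^ n)"
      using \<rho> by (intro summable_mult summable_geometric) auto
    show "norm (nu a c n * r ^ n) \<le> C * (\<rho> * \<bar>r\<bar>) ^ n" for n
      using mult_right_mono[OF C(2)[of n], of "\<bar>r\<bar>^n"]
      by (simp add: abs_mult power_abs power_mult_distrib mult.assoc)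
  qed
qed

lemma nu_fps_radius: "fps_conv_radius (nu_fps a c) \<ge> 1"
  unfolding fps_conv_radius_def
proof (rule conv_radius_geI_ex')
  fix r :: real assume "0 < r" "ereal r < 1"
  then have "summable (\<lambda>n. nu a c n * r ^ n)" by (intro nu_summable) auto
  then have "summable (\<lambda>n. of_real (nu a c n * r ^ n) :: complex)" by (simp only: summable_of_real)
  then show "summable (\<lambda>n. fps_nth (nu_fps a c) n * of_real r ^ n)" by (simp add: nu_fps_def)
qed

lemma exponent_fps_radius: "fps_conv_radius (exponent_fps a c) \<ge> 1"
  unfolding fps_conv_radius_def
proof (rule conv_radius_geI_ex')
  fix r :: real assume r: "0 < r" "ereal r < 1"
  show "summable (\<lambda>n. fps_nth (exponent_fps a c) n * of_real r ^ n)"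
  proof (rule summable_comparison_test')
    show "summable (\<lambda>n. (\<bar>a\<bar>+\<bar>c\<bar>) * r ^ n)"
      using r by (intro summable_mult summable_geometric) auto
    fix n assume "n \<ge> (1::nat)"
    have "\<bar>cf a c n / real n\<bar> \<le> \<bar>cf a c n\<bar> / 1"
      unfolding abs_divide using \<open>n \<ge> 1\<close> by (intro divide_left_mono) auto
    then have "\<bar>cf a c n / real n\<bar> * r ^ n \<le> (\<bar>a\<bar>+\<bar>c\<bar>) * r ^ n"
      using cf_bound[of a c n] r by (intro mult_right_mono) auto
    then show "norm (fps_nth (exponent_fps a c) n * of_real r ^ n) \<le> (\<bar>a\<bar>+\<bar>c\<bar>) * r ^ n"
      using r \<open>n \<ge> 1\<close> by (simp add: exponent_fps_def norm_mult norm_power norm_divide abs_divide)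
  qed
qed

lemma deriv_exponent_fps_nth: "fps_nth (fps_deriv (exponent_fps a c)) m = of_real (cf a c (Suc m))"
proof -
  have "fps_nth (fps_deriv (exponent_fps a c)) m = of_real (real (Suc m) * (cf a c (Suc m) / real (Suc m)))"
    by (simp add: exponent_fps_def del: of_nat_Suc)
  then show ?thesis by (simp del: of_nat_Suc)
qed

lemma nu_fps_deriv: "fps_deriv (nu_fps a c) = - fps_deriv (exponent_fps a c) * nu_fps a c"
proof (rule fps_ext)
  fix n
  have "fps_nth (fps_deriv (exponent_fps a c) * nu_fps a c) n
      = (\<Sum>k\<le>n. fps_nth (nu_fps a c) k * fps_nth (fps_deriv (exponent_fps a c)) (n - k))"
    by (subst mult.commute) (simp add: fps_mult_nth atLeast0AtMost)
  also have "\<dots> = (\<Sum>k\<le>n. of_real (cf a c (Suc n - k) * nu a c k))"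
    by (intro sum.cong)
       (simp_all only: nu_fps_def deriv_exponent_fps_nth Suc_diff_le fps_nth_Abs_fps of_real_mult mult.commute atMost_iff)
  also have "\<dots> = of_real (- (real (Suc n) * nu a c (Suc n)))"
    by (simp del: of_nat_Suc)
  also have "\<dots> = - (of_nat (Suc n) * fps_nth (nu_fps a c) (Suc n))"
    by (simp add: nu_fps_def del: of_nat_Suc nu.simps)
  finally show "fps_nth (fps_deriv (nu_fps a c)) n = fps_nth (- fps_deriv (exponent_fps a c) * nu_fps a c) n"
    by (simp del: nu.simps of_nat_Suc)
qed

text \<open>
  The quotient of the two sides has derivative 0 on the unit disc, by the recursion.
\<close>

lemma eval_nu_fps:
  assumes "norm z < 1"
  shows "eval_fps (nu_fps a c) z = exp (- eval_fps (exponent_fps a c) z)"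
proof -
  define h where "h = (\<lambda>z. eval_fps (nu_fps a c) z * exp (eval_fps (exponent_fps a c) z))"
  have "(h has_field_derivative 0) (at z within ball 0 1)" if "z \<in> ball 0 1" for z
  proof -
    have z: "ereal (norm z) < fps_conv_radius (nu_fps a c)"
      "ereal (norm z) < fps_conv_radius (exponent_fps a c)"
      using that nu_fps_radius[of a c] exponent_fps_radius[of a c]
      by (auto intro: less_le_trans[of _ "1::ereal"])
    have d: "eval_fps (fps_deriv (nu_fps a c)) z
      = - eval_fps (fps_deriv (exponent_fps a c)) z * eval_fps (nu_fps a c) z"
    proof -
      have z': "ereal (norm z) < fps_conv_radius (fps_deriv (exponent_fps a c))"
        using z(2) fps_conv_radius_deriv[of "exponent_fps a c"] by (rule less_le_trans)
      have "ereal (norm z) < fps_conv_radius (fps_deriv (exponent_fps a c) * nu_fps a c)"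
        using fps_conv_radius_mult[of "fps_deriv (exponent_fps a c)" "nu_fps a c"] z z'
        by (auto simp: min_def split: if_splits intro: less_le_trans)
      then show ?thesis using z z' by (simp add: nu_fps_deriv eval_fps_mult eval_fps_minus)
    qed
    show ?thesis unfolding h_def
      by (rule derivative_eq_intros has_field_derivative_eval_fps z refl)+ (simp add: d)
  qed
  then obtain k where k: "\<And>z. z \<in> ball 0 1 \<Longrightarrow> h z = k"
    using has_field_derivative_zero_constant[of "ball 0 1" h] by auto
  have "h 0 = 1" by (simp add: h_def eval_fps_at_0 nu_fps_def exponent_fps_def)
  moreover have "h 0 = k" by (rule k) simp
  ultimately have "h z = 1" using k[of z] assms by simp
  then show ?thesis by (simp add: h_def exp_minus field_simps)
qed

text \<open>
  Summing the logarithmic series with \<open>1 / (n * (n + 1)) = 1 / n - 1 / (n + 1)\<close>.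
\<close>

lemma eval_exponent_fps:
  assumes "norm z < 1" "z \<noteq> 0"
  shows "eval_fps (exponent_fps a c) z
    = of_real a * (1 + (1 - z) / z * Ln (1 - z)) - of_real c * Ln (1 - z)"
proof -
  have s0: "(\<lambda>n. - (z ^ n) / of_nat n) sums Ln (1 - z)"
    using Ln_series'[of "-z"] assms by simp
  then have s1: "(\<lambda>n. (z ^ n) / of_nat n) sums - Ln (1 - z)"
    using sums_minus[OF s0] by simp
  have "(\<lambda>n. z ^ Suc n / of_nat (Suc n)) sums - Ln (1 - z)"
    using s1 by (subst sums_Suc_iff) simp
  then have "(\<lambda>n. z ^ Suc n / of_nat (Suc n) / z) sums (- Ln (1 - z) / z)"
    by (rule sums_divide)
  then have s2: "(\<lambda>n. z ^ n / of_nat (Suc n)) sums (- Ln (1 - z) / z)"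
  proof -
    have "(\<lambda>n. z ^ n / of_nat (Suc n)) = (\<lambda>n. z ^ Suc n / of_nat (Suc n) / z)"
      using assms(2) by (auto simp: fun_eq_iff)
    then show "(\<lambda>n. z ^ Suc n / of_nat (Suc n) / z) sums (- Ln (1 - z) / z) \<Longrightarrow> ?thesis" by simp
  qed
  have s3: "(\<lambda>n. z ^ n / of_nat (Suc n) - (if n = 0 then 1 else 0)) sums (- Ln (1 - z) / z - 1)"
    by (intro sums_diff s2 sums_single[of 0 "\<lambda>_. 1"])
  have "(\<lambda>n. (of_real a * (z ^ n / of_nat n) - of_real a * (z ^ n / of_nat (Suc n) - (if n = 0 then 1 else 0)))
      + of_real c * (z ^ n / of_nat n)) sums
     ((of_real a * (- Ln (1 - z)) - of_real a * (- Ln (1 - z) / z - 1)) + of_real c * (- Ln (1 - z)))"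
    by (intro sums_add sums_diff sums_mult s1 s3)
  moreover have "(\<lambda>n. (of_real a * (z ^ n / of_nat n) - of_real a * (z ^ n / of_nat (Suc n) - (if n = 0 then 1 else 0)))
      + of_real c * (z ^ n / of_nat n)) = (\<lambda>n. fps_nth (exponent_fps a c) n * z ^ n)"
  proof
    fix n show "(of_real a * (z ^ n / of_nat n) - of_real a * (z ^ n / of_nat (Suc n) - (if n = 0 then 1 else 0)))
      + of_real c * (z ^ n / of_nat n) = fps_nth (exponent_fps a c) n * z ^ n"
    proof (cases "n = 0")
      case False
      have 1: "(1 + of_nat n :: complex) \<noteq> 0" using of_nat_neq_0[of n] by (metis of_nat_Suc)
      have 2: "(of_nat n :: complex) \<noteq> 0" using False by simp
      have "fps_nth (exponent_fps a c) n = (of_real a / (1 + of_nat n) + of_real c) / of_nat n"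
        using False by (simp add: exponent_fps_def cf_def add.commute)
      moreover have "A * (w / m) - A * (w / (1 + m) - 0) + C * (w / m) = (A / (1 + m) + C) / m * w"
        if "m \<noteq> 0" "1 + m \<noteq> 0" for A C w m :: complex
      proof -
        have "w / m - w / (1 + m) = w / (m * (1 + m))"
          using that by (simp add: diff_frac_eq) (simp add: algebra_simps)
        then have "A * (w / m - w / (1 + m)) = A / (1 + m) / m * w" by simp
        then show ?thesis by (simp add: algebra_simps add_divide_distrib)
      qed
      ultimately show ?thesis using False 1 2 by simp
    qed (simp add: exponent_fps_def)
  qed
  ultimately have "eval_fps (exponent_fps a c) z
    = ((of_real a * (- Ln (1 - z)) - of_real a * (- Ln (1 - z) / z - 1)) + of_real c * (- Ln (1 - z)))"
    unfolding eval_fps_def by (simp add: sums_iff)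
  also have "\<dots> = of_real a * (1 + (1 - z) / z * Ln (1 - z)) - of_real c * Ln (1 - z)"
    using assms(2) by (simp add: diff_divide_distrib algebra_simps)
  finally show ?thesis .
qed

lemma nu_sums:
  fixes y :: real
  assumes "y > 0"
  shows "(\<lambda>n. nu a c n * (1 / (1 + y)) ^ n) sums (exp (- a) * (1 + 1 / y) powr (a * y - c))"
proof -
  define r where "r = 1 / (1 + y)"
  have r: "0 < r" "r < 1" "(1 - r) / r = y" "1 - r = y / (1 + y)" using assms by (auto simp: r_def field_simps)
  have "eval_fps (nu_fps a c) (of_real r) = exp (- eval_fps (exponent_fps a c) (of_real r))"
    using r by (intro eval_nu_fps) auto
  also have "eval_fps (exponent_fps a c) (of_real r)
     = of_real (a * (1 + (1 - r) / r * ln (1 - r)) - c * ln (1 - r))"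
  proof -
    have "Ln (1 - complex_of_real r) = of_real (ln (1 - r))"
      using r(2) Ln_of_real[of "1 - r"] by simp
    then show ?thesis using r(1,2) by (subst eval_exponent_fps) auto
  qed
  finally have e: "eval_fps (nu_fps a c) (of_real r)
     = of_real (exp (- (a * (1 + (1 - r) / r * ln (1 - r)) - c * ln (1 - r))))"
    by (simp flip: exp_of_real of_real_minus)
  have l: "ln (1 - r) = - ln (1 + 1 / y)"
  proof -
    have "ln (y / (1 + y)) = ln y - ln (1 + y)" using assms by (subst ln_div) auto
    moreover have "ln ((1 + y) / y) = ln (1 + y) - ln y" using assms by (subst ln_div) auto
    moreover have "(1 + y) / y = 1 + 1 / y" using assms by (simp add: field_simps)
    ultimately show ?thesis by (simp add: r(4))
  qed
  have "exp (- (a * (1 + (1 - r) / r * ln (1 - r)) - c * ln (1 - r)))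
      = exp (- a + (a * y - c) * ln (1 + 1 / y))"
    unfolding l r(3) by (simp add: algebra_simps)
  also have "\<dots> = exp (- a) * (1 + 1 / y) powr (a * y - c)"
  proof -
    have "1 + 1 / y > 0" using assms by (simp add: add_pos_pos)
    then show ?thesis by (simp add: powr_def exp_add[symmetric])
  qed
  finally have e2: "eval_fps (nu_fps a c) (of_real r) = of_real (exp (- a) * (1 + 1 / y) powr (a * y - c))"
    using e by simp
  have "(\<lambda>n. fps_nth (nu_fps a c) n * of_real r ^ n) sums eval_fps (nu_fps a c) (of_real r)"
    by (rule sums_eval_fps) (use r nu_fps_radius[of a c] in \<open>auto intro: less_le_trans[of _ "1::ereal"]\<close>)
  then have "(\<lambda>n. complex_of_real (nu a c n * r ^ n)) sums of_real (exp (- a) * (1 + 1 / y) powr (a * y - c))"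
    unfolding e2 by (simp add: nu_fps_def)
  then show ?thesis unfolding sums_of_real_iff r_def .
qed

section \<open>Moments of the weight w\<close>

text \<open>
  In the coordinate \<open>\<zeta> = ln (1 - z)\<close> we have \<open>1 + 1 / y = exp (- \<zeta>)\<close> and \<open>z = 1 - exp \<zeta>\<close>. The
  \<open>y\<close>-plane cut along \<open>[-1, 0]\<close> becomes \<open>\<bar>Im \<zeta>\<bar> < pi\<close>, the two sides of the cut become the lines
  \<open>Im \<zeta> = +- pi\<close>, and \<open>y = \<infinity>\<close> becomes \<open>\<zeta> = 0\<close>. The function \<open>(1 + 1 / y) powr (a * y - c)\<close>
  becomes \<open>strip_fun\<close>, which is holomorphic even in the wider strip of half width \<open>2 * pi\<close>; its
  boundary values on the cut are thus values at interior points of that strip. The remainder \<open>strip_rem a c m\<close> arises from it by removing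
  the Taylor polynomial in \<open>z\<close> of degree less than \<open>m\<close> and dividing by \<open>z ^ m\<close>.
\<close>

abbreviation strip :: "complex set" where
  "strip \<equiv> {\<zeta>. \<bar>Im \<zeta>\<bar> < 2 * pi}"

definition exp_quot :: "complex \<Rightarrow> complex" where
  "exp_quot \<zeta> = (if \<zeta> = 0 then 1 else (exp \<zeta> - 1) / \<zeta>)"

definition strip_fun :: "real \<Rightarrow> real \<Rightarrow> complex \<Rightarrow> complex" where
  "strip_fun a c \<zeta> = exp (of_real a * (exp \<zeta> / exp_quot \<zeta>) + of_real c * \<zeta>)"

definition strip_rem :: "real \<Rightarrow> real \<Rightarrow> nat \<Rightarrow> complex \<Rightarrow> complex" where
  "strip_rem a c m \<zeta> = (if \<zeta> = 0 then of_real (exp a * nu a c m)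
     else (strip_fun a c \<zeta> - (\<Sum>k<m. of_real (exp a * nu a c k) * (1 - exp \<zeta>) ^ k)) / (1 - exp \<zeta>) ^ m)"

lemma open_strip: "open strip" and convex_strip: "convex strip"
proof -
  have eq: "strip = {\<zeta>. Im \<zeta> < 2*pi} \<inter> {\<zeta>. Im \<zeta> > - (2*pi)}" by auto
  show "open strip" unfolding eq
    by (intro open_Int open_halfspace_Im_lt open_halfspace_Im_gt)
  show "convex strip" unfolding eq
    by (intro convex_Int convex_halfspace_Im_lt convex_halfspace_Im_gt)
qed

lemma exp_eq_1_strip:
  assumes "\<zeta> \<in> strip" "exp \<zeta> = 1"
  shows "\<zeta> = 0"
proof -
  from assms(2) obtain n :: int where n: "Re \<zeta> = 0" "Im \<zeta> = of_int (2 * n) * pi"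
    unfolding exp_eq_1 by auto
  have "\<bar>of_int n :: real\<bar> * (2 * pi) < 1 * (2 * pi)" using assms(1) n by (simp add: abs_mult)
  then have "\<bar>of_int n :: real\<bar> < 1" using pi_gt_zero by (simp add: mult_less_cancel_right)
  then have "n = 0" by linarith
  with n show ?thesis by (simp add: complex_eq_iff)
qed

lemma exp_quot_nonzero: "\<zeta> \<in> strip \<Longrightarrow> exp_quot \<zeta> \<noteq> 0"
  using exp_eq_1_strip by (auto simp: exp_quot_def)

lemma exp_quot_holomorphic: "exp_quot holomorphic_on A"
proof -
  have "(\<lambda>z. if z = 0 then deriv exp 0 else (exp z - exp 0) / (z - 0)) holomorphic_on (UNIV :: complex set)"
    by (rule pole_lemma) (auto intro: holomorphic_intros)
  then have "exp_quot holomorphic_on UNIV"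
    by (rule holomorphic_transform) (auto simp: exp_quot_def DERIV_imp_deriv[OF DERIV_exp])
  then show ?thesis by (rule holomorphic_on_subset) auto
qed

lemma strip_fun_holomorphic: "strip_fun a c holomorphic_on strip"
  unfolding strip_fun_def
  by (intro holomorphic_intros exp_quot_holomorphic exp_quot_nonzero)

lemma strip_fun_near_0:
  assumes "norm (1 - exp \<zeta>) < 1" "\<bar>Im \<zeta>\<bar> < pi" "\<zeta> \<noteq> 0"
  shows "strip_fun a c \<zeta> = of_real (exp a) * eval_fps (nu_fps a c) (1 - exp \<zeta>)"
proof -
  have nz: "exp \<zeta> \<noteq> 1" using exp_eq_1_strip[of \<zeta>] assms by (auto simp: less_le_trans)
  have ln: "Ln (exp \<zeta>) = \<zeta>" using assms by (intro Ln_exp) auto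
  have "of_real (exp a) * eval_fps (nu_fps a c) (1 - exp \<zeta>)
      = exp (of_real a - (of_real a * (1 + exp \<zeta> / (1 - exp \<zeta>) * \<zeta>) - of_real c * \<zeta>))"
    using assms nz ln
    by (subst eval_nu_fps) (auto simp: eval_exponent_fps exp_of_real[symmetric] exp_add[symmetric] algebra_simps)
  also have "exp \<zeta> / (1 - exp \<zeta>) * \<zeta> = - (exp \<zeta> / exp_quot \<zeta>)"
    using assms nz by (simp add: exp_quot_def divide_simps) (simp add: algebra_simps)
  finally show ?thesis by (simp add: strip_fun_def algebra_simps)
qed

text \<open>
  The factor \<open>1 - exp \<zeta>\<close> vanishes only at 0 inside the strip. There the singularity is
  removable because the quotient is the shifted power series evaluated at \<open>1 - exp \<zeta>\<close>.
\<close>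

lemma strip_rem_holomorphic: "strip_rem a c m holomorphic_on strip"
proof (rule no_isolated_singularity'[of "{0}"])
  have "(\<lambda>\<zeta>. (strip_fun a c \<zeta> - (\<Sum>k<m. of_real (exp a * nu a c k) * (1 - exp \<zeta>) ^ k)) / (1 - exp \<zeta>) ^ m)
     holomorphic_on (strip - {0})"
    by (intro holomorphic_intros holomorphic_on_subset[OF strip_fun_holomorphic])
       (use exp_eq_1_strip in fastforce)+
  then show "strip_rem a c m holomorphic_on strip - {0}"
    by (rule holomorphic_transform) (auto simp: strip_rem_def)
  fix z :: complex assume "z \<in> {0}"
  then have z: "z = 0" by simp
  define S where "S = fps_shift m (nu_fps a c)"
  have rad: "fps_conv_radius S \<ge> 1" using nu_fps_radius[of a c] by (simp add: S_def)
  have cut: "eval_fps (fps_cutoff m (nu_fps a c)) w = (\<Sum>k<m. of_real (nu a c k) * w ^ k)" for w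
  proof -
    have "eval_fps (fps_cutoff m (nu_fps a c)) w = (\<Sum>k<m. fps_nth (fps_cutoff m (nu_fps a c)) k * w ^ k)"
      unfolding eval_fps_def by (intro suminf_finite) auto
    then show ?thesis by (simp add: nu_fps_def)
  qed
  have ev: "eval_fps (nu_fps a c) w = w ^ m * eval_fps S w + (\<Sum>k<m. of_real (nu a c k) * w ^ k)"
    if "norm w < 1" for w
  proof -
    have r: "ereal (norm w) < fps_conv_radius S" using that rad by (auto intro: less_le_trans[of _ "1::ereal"])
    have c: "ereal (norm w) < fps_conv_radius (fps_cutoff m (nu_fps a c))"
    proof -
      have "fps_conv_radius (fps_cutoff m (nu_fps a c)) \<ge> 1" unfolding fps_conv_radius_def
        by (intro conv_radius_geI_ex' summable_finite[of "{..<m}"]) auto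
      then show ?thesis using that by (auto intro: less_le_trans[of _ "1::ereal"])
    qed
    have x: "fps_conv_radius (fps_X ^ m :: complex fps) = \<infinity>" by simp
    have r2: "ereal (norm w) < fps_conv_radius (fps_X ^ m * S)"
      using fps_conv_radius_mult[of "fps_X ^ m" S] r x by (auto intro: less_le_trans)
    have "eval_fps (nu_fps a c) w = eval_fps (fps_X ^ m * S + fps_cutoff m (nu_fps a c)) w"
      unfolding S_def by (simp only: fps_shift_cutoff')
    also have "\<dots> = eval_fps (fps_X ^ m * S) w + eval_fps (fps_cutoff m (nu_fps a c)) w"
      using r2 c by (intro eval_fps_add) auto
    also have "eval_fps (fps_X ^ m * S) w = w ^ m * eval_fps S w"
      using r x by (subst eval_fps_mult) auto
    finally show ?thesis by (simp add: cut)
  qed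
  have lim: "((\<lambda>\<zeta>. of_real (exp a) * eval_fps S (1 - exp \<zeta>)) \<longlongrightarrow> of_real (exp a) * eval_fps S (1 - exp 0)) (at 0 within strip)"
  proof (intro tendsto_intros)
    have "isCont (eval_fps S) (1 - exp 0)"
      using rad by (intro continuous_eval_fps) (auto intro: less_le_trans[of _ "1::ereal"])
    moreover have "((\<lambda>\<zeta>. 1 - exp \<zeta>) \<longlongrightarrow> 1 - exp (0::complex)) (at 0 within strip)" by (intro tendsto_intros)
    ultimately show "((\<lambda>\<zeta>. eval_fps S (1 - exp \<zeta>)) \<longlongrightarrow> eval_fps S (1 - exp 0)) (at 0 within strip)"
      by (rule isCont_tendsto_compose)
  qed
  have e1: "eventually (\<lambda>\<zeta>::complex. norm (1 - exp \<zeta>) < 1) (nhds 0)"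
  proof -
    have "open {\<zeta>::complex. norm (1 - exp \<zeta>) < 1}" by (intro open_Collect_less continuous_intros)
    from eventually_nhds_in_open[OF this, of 0] show ?thesis by simp
  qed
  have e2: "eventually (\<lambda>\<zeta>::complex. \<bar>Im \<zeta>\<bar> < pi) (nhds 0)"
  proof -
    have "open {\<zeta>::complex. \<bar>Im \<zeta>\<bar> < pi}" by (intro open_Collect_less continuous_intros)
    from eventually_nhds_in_open[OF this, of 0] show ?thesis by simp
  qed
  have "eventually (\<lambda>\<zeta>. of_real (exp a) * eval_fps S (1 - exp \<zeta>) = strip_rem a c m \<zeta>) (at 0 within strip)"
    using e1 e2 unfolding eventually_at_filter
  proof eventually_elim
    case (elim \<zeta>)
    show ?case
    proof (intro impI)
      assume nz: "\<zeta> \<noteq> 0" and "\<zeta> \<in> strip"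
      then have z: "1 - exp \<zeta> \<noteq> 0" using exp_eq_1_strip by auto
      have "strip_fun a c \<zeta> = of_real (exp a) * ((1 - exp \<zeta>) ^ m * eval_fps S (1 - exp \<zeta>) + (\<Sum>k<m. of_real (nu a c k) * (1 - exp \<zeta>) ^ k))"
        using elim nz by (simp add: strip_fun_near_0 ev)
      then show "of_real (exp a) * eval_fps S (1 - exp \<zeta>) = strip_rem a c m \<zeta>"
        using nz z by (simp add: strip_rem_def algebra_simps sum_distrib_left)
    qed
  qed
  with lim have "(strip_rem a c m \<longlongrightarrow> of_real (exp a) * eval_fps S (1 - exp 0)) (at 0 within strip)"
    by (rule Lim_transform_eventually)
  then show "(strip_rem a c m \<longlongrightarrow> strip_rem a c m z) (at z within strip)"
    by (simp add: z strip_rem_def S_def eval_fps_at_0 nu_fps_def)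
qed (use open_strip in auto)

text \<open>
  The jump of a primitive between the lines \<open>Im \<zeta> = pi\<close> and \<open>Im \<zeta> = - pi\<close> is the integral of
  \<open>f\<close> over a vertical segment of length \<open>2 * pi\<close>; on this segment \<open>f\<close> is uniformly close to \<open>L\<close>.
\<close>

lemma primitive_jump_limit:
  assumes P: "\<And>\<zeta>. \<zeta> \<in> strip \<Longrightarrow> (P has_field_derivative f \<zeta>) (at \<zeta> within strip)"
    and lim: "\<And>e. e > 0 \<Longrightarrow> eventually (\<lambda>v. \<forall>\<eta>. \<bar>\<eta>\<bar> \<le> pi \<longrightarrow> norm (f (Complex v \<eta>) - L) \<le> e) Fl"
  shows "((\<lambda>v. P (Complex v pi) - P (Complex v (- pi))) \<longlongrightarrow> 2 * pi * \<i> * L) Fl"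
proof (rule tendstoI)
  fix e :: real assume e: "e > 0"
  define d where "d = e / (4 * pi)"
  have d: "d > 0" using e by (simp add: d_def)
  show "\<forall>\<^sub>F v in Fl. dist (P (Complex v pi) - P (Complex v (- pi))) (2 * pi * \<i> * L) < e"
    using lim[OF d]
  proof eventually_elim
    case (elim v)
    define S where "S = closed_segment (Complex v (- pi)) (Complex v pi)"
    have S: "Re \<zeta> = v \<and> \<bar>Im \<zeta>\<bar> \<le> pi" if "\<zeta> \<in> S" for \<zeta>
      using that pi_gt_zero unfolding S_def
      by (auto simp: closed_segment_same_Re closed_segment_eq_real_ivl abs_le_iff)
    have "norm ((P (Complex v pi) - L * Complex v pi) - (P (Complex v (- pi)) - L * Complex v (- pi)))
        \<le> d * norm (Complex v pi - Complex v (- pi))"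
    proof (rule field_differentiable_bound[where S = S and f' = "\<lambda>\<zeta>. f \<zeta> - L"])
      show "convex S" by (simp add: S_def)
      fix \<zeta> assume z: "\<zeta> \<in> S"
      have in_strip: "S \<subseteq> strip" 
      proof
        fix w assume "w \<in> S"
        then show "w \<in> strip" using S[of w] pi_gt_zero unfolding mem_Collect_eq by linarith
      qed
      show "((\<lambda>\<zeta>. P \<zeta> - L * \<zeta>) has_field_derivative f \<zeta> - L) (at \<zeta> within S)"
        using z in_strip
        by (auto intro!: derivative_eq_intros has_field_derivative_subset[OF P])
      have "\<zeta> = Complex v (Im \<zeta>)" using S[OF z] by (simp add: complex_eq_iff)
      then show "norm (f \<zeta> - L) \<le> d" using elim S[OF z] by metis
    qed (auto simp: S_def)
    also have "Complex v pi - Complex v (- pi) = 2 * pi * \<i>" by (simp add: complex_eq_iff)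
    also have "d * norm (2 * pi * \<i>) < e"
      using e pi_gt_zero by (simp add: d_def norm_mult)
    also have "(P (Complex v pi) - L * Complex v pi) - (P (Complex v (- pi)) - L * Complex v (- pi))
       = P (Complex v pi) - P (Complex v (- pi)) - 2 * pi * \<i> * L"
      by (simp add: complex_eq_iff)
    finally show ?case by (simp add: dist_norm)
  qed
qed

lemma strip_fun_bound:
  assumes "v \<noteq> 0" "\<bar>\<eta>\<bar> \<le> pi" "a \<ge> 0"
  shows "norm (strip_fun a c (Complex v \<eta>)) \<le> exp ((if v > 0 then a * v else 0) + a * ((\<bar>v\<bar> + pi) / (exp \<bar>v\<bar> - 1)) + c * v)"
proof -
  define \<zeta> where "\<zeta> = Complex v \<eta>"
  have z: "\<zeta> \<noteq> 0" "exp \<zeta> \<noteq> 1" using assms exp_eq_1_strip[of \<zeta>] pi_gt_zero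
    by (auto simp: \<zeta>_def complex_eq_iff)
  have n1: "norm \<zeta> \<le> \<bar>v\<bar> + pi" using cmod_le[of \<zeta>] assms(2) by (simp add: \<zeta>_def)
  have nexp: "norm (exp \<zeta>) = exp v" by (simp add: \<zeta>_def)
  have "Re (exp \<zeta> / exp_quot \<zeta>) \<le> (if v > 0 then v else 0) + (\<bar>v\<bar> + pi) / (exp \<bar>v\<bar> - 1)"
  proof (cases "v > 0")
    case True
    have e: "exp \<zeta> / exp_quot \<zeta> = \<zeta> + \<zeta> / (exp \<zeta> - 1)"
      using z by (simp add: exp_quot_def divide_simps) (simp add: algebra_simps)
    have "exp v - 1 \<le> norm (exp \<zeta> - 1)" using norm_triangle_ineq2[of "exp \<zeta>" 1] nexp by simp
    then have "norm (\<zeta> / (exp \<zeta> - 1)) \<le> (\<bar>v\<bar> + pi) / (exp v - 1)"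
      unfolding norm_divide using n1 True by (intro frac_le) auto
    then have "Re (\<zeta> / (exp \<zeta> - 1)) \<le> (\<bar>v\<bar> + pi) / (exp v - 1)" using complex_Re_le_cmod order_trans by blast
    then show ?thesis using True by (simp add: e) (simp add: \<zeta>_def)
  next
    case False
    then have v: "v < 0" using assms by simp
    have e: "exp \<zeta> / exp_quot \<zeta> = \<zeta> * exp \<zeta> / (exp \<zeta> - 1)" using z by (simp add: exp_quot_def)
    have "1 - exp v \<le> norm (exp \<zeta> - 1)" using norm_triangle_ineq2[of 1 "exp \<zeta>"] nexp by (simp add: norm_minus_commute)
    moreover have "norm (\<zeta> * exp \<zeta>) \<le> (\<bar>v\<bar> + pi) * exp v" unfolding norm_mult nexp using n1 by simp
    ultimately have "norm (exp \<zeta> / exp_quot \<zeta>) \<le> (\<bar>v\<bar> + pi) * exp v / (1 - exp v)"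
      unfolding e norm_divide using v less_trans[OF v pi_gt_zero] by (intro frac_le mult_nonneg_nonneg) auto
    also have "\<dots> = (\<bar>v\<bar> + pi) / (exp \<bar>v\<bar> - 1)"
      using v by (simp add: exp_minus field_simps)
    finally show ?thesis using v complex_Re_le_cmod[of "exp \<zeta> / exp_quot \<zeta>"] by simp
  qed
  then have "a * Re (exp \<zeta> / exp_quot \<zeta>) \<le> a * ((if v > 0 then v else 0) + (\<bar>v\<bar> + pi) / (exp \<bar>v\<bar> - 1))"
    using assms by (intro mult_left_mono) auto
  moreover have "norm (strip_fun a c \<zeta>) = exp (a * Re (exp \<zeta> / exp_quot \<zeta>) + c * v)"
    by (simp add: strip_fun_def \<zeta>_def del: times_divide_eq_right)
  ultimately show ?thesis by (simp add: \<zeta>_def algebra_simps split: if_splits)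
qed

lemma norm_1_minus_exp_ge: "norm (1 - exp (Complex v \<eta>)) \<ge> \<bar>exp v - 1\<bar>"
  using norm_triangle_ineq3[of "exp (Complex v \<eta>)" 1] by (simp add: norm_minus_commute)

lemma strip_rem_left_limit:
  assumes "a \<ge> 0" "c \<ge> 0" "e > 0"
  shows "eventually (\<lambda>v. \<forall>\<eta>. \<bar>\<eta>\<bar> \<le> pi \<longrightarrow> norm (exp (Complex v \<eta>) * strip_rem a c m (Complex v \<eta>) - 0) \<le> e) at_bot"
proof -
  define K where "K = (exp a + (\<Sum>k<m. \<bar>exp a * nu a c k\<bar> * 2 ^ k)) * 2 ^ m"
  have t1: "((\<lambda>v::real. exp v * K) \<longlongrightarrow> 0 * K) at_bot"
    by (intro tendsto_mult exp_at_bot tendsto_const)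
  have ev1: "eventually (\<lambda>v::real. exp v * K < e) at_bot"
    using order_tendstoD(2)[OF t1, of e] assms by simp
  have "((\<lambda>v::real. (\<bar>v\<bar> + pi) / (exp \<bar>v\<bar> - 1)) \<longlongrightarrow> 0) at_bot" by real_asymp
  then have ev2: "eventually (\<lambda>v::real. (\<bar>v\<bar> + pi) / (exp \<bar>v\<bar> - 1) < 1) at_bot"
    by (rule order_tendstoD) auto
  have ev3: "eventually (\<lambda>v::real. exp v < 1/2) at_bot"
    using order_tendstoD(2)[OF exp_at_bot, of "1/2"] by simp
  show ?thesis using ev1 ev2 ev3 eventually_gt_at_bot[of "0::real"]
  proof eventually_elim
    case (elim v)
    show ?case
    proof (intro allI impI)
      fix \<eta> :: real assume eta: "\<bar>\<eta>\<bar> \<le> pi"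
      define \<zeta> where "\<zeta> = Complex v \<eta>"
      define z where "z = 1 - exp \<zeta>"
      have z1: "norm z \<ge> 1/2" using norm_1_minus_exp_ge[of v \<eta>] elim by (simp add: z_def \<zeta>_def)
      have z2: "norm z \<le> 2" unfolding z_def using norm_triangle_ineq4[of 1 "exp \<zeta>"] elim by (simp add: \<zeta>_def)
      have "norm (strip_fun a c \<zeta>) \<le> exp (a * ((\<bar>v\<bar> + pi) / (exp \<bar>v\<bar> - 1)) + c * v)"
        using strip_fun_bound[of v \<eta> a c] elim eta assms by (simp add: \<zeta>_def)
      also have "\<dots> \<le> exp a"
        using mult_left_mono[of "(\<bar>v\<bar> + pi) / (exp \<bar>v\<bar> - 1)" 1 a] mult_nonneg_nonpos[of c v] elim assms by simp
      finally have G: "norm (strip_fun a c \<zeta>) \<le> exp a" .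
      have "norm (\<Sum>k<m. of_real (exp a * nu a c k) * z ^ k) \<le> (\<Sum>k<m. \<bar>exp a * nu a c k\<bar> * 2 ^ k)"
        using z2 by (intro sum_norm_le) (auto simp: norm_mult norm_power abs_mult intro!: mult_left_mono power_mono)
      with G have num: "norm (strip_fun a c \<zeta> - (\<Sum>k<m. of_real (exp a * nu a c k) * z ^ k))
         \<le> exp a + (\<Sum>k<m. \<bar>exp a * nu a c k\<bar> * 2 ^ k)"
        by (intro order_trans[OF norm_triangle_ineq4] add_mono)
      have "norm (strip_rem a c m \<zeta>) = norm (strip_fun a c \<zeta> - (\<Sum>k<m. of_real (exp a * nu a c k) * z ^ k)) / norm z ^ m"
        using elim by (auto simp: strip_rem_def z_def \<zeta>_def complex_eq_iff norm_divide norm_power)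
      also have "\<dots> \<le> (exp a + (\<Sum>k<m. \<bar>exp a * nu a c k\<bar> * 2 ^ k)) / (1/2) ^ m"
        using z1 num by (intro frac_le power_mono add_nonneg_nonneg sum_nonneg) auto
      also have "\<dots> = K" by (simp add: K_def power_divide)
      finally have "norm (exp \<zeta> * strip_rem a c m \<zeta>) \<le> exp v * K"
        unfolding norm_mult by (intro mult_mono) (auto simp: \<zeta>_def)
      then show "norm (exp (Complex v \<eta>) * strip_rem a c m (Complex v \<eta>) - 0) \<le> e"
        using elim by (simp add: \<zeta>_def)
    qed
  qed
qed

text \<open>
  As \<open>Re \<zeta>\<close> grows, \<open>\<bar>z\<bar>\<close> grows like \<open>exp v\<close>. The hypothesis \<open>a + c < n + 1\<close> makes
  \<open>strip_fun / z ^ (n + 1)\<close> vanish in the limit, and of the Taylor polynomial only its top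
  coefficient, with index \<open>n + 1\<close>, survives division by \<open>z ^ (n + 1)\<close>; the remaining factor
  \<open>exp \<zeta> / z\<close> tends to \<open>-1\<close>.
\<close>

lemma strip_rem_right_limit:
  assumes "a \<ge> 0" "c \<ge> 0" "e > 0" "a + c < real (n + 1)"
  shows "eventually (\<lambda>v. \<forall>\<eta>. \<bar>\<eta>\<bar> \<le> pi \<longrightarrow>
    norm (exp (Complex v \<eta>) * strip_rem a c (n + 2) (Complex v \<eta>) - of_real (exp a * nu a c (n + 1))) \<le> e) at_top"
proof -
  define g where "g = exp a * nu a c (n + 1)"
  define \<delta> where "\<delta> = (\<lambda>v::real. 1 / (exp v - 1))"
  define T where "T = (\<Sum>k<n+1. \<bar>exp a * nu a c k\<bar>)"
  define B where "B = (\<lambda>v::real. exp ((a + c) * v + a) * \<delta> v ^ (n + 1) + T * \<delta> v)"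
  have d0: "(\<delta> \<longlongrightarrow> 0) at_top" unfolding \<delta>_def by real_asymp
  have "((\<lambda>v. exp ((a + c) * v + a) * \<delta> v ^ (n + 1)) \<longlongrightarrow> 0) at_top"
  proof (rule Lim_null_comparison)
    define \<epsilon> where "\<epsilon> = real (n + 1) - (a + c)"
    have eps: "\<epsilon> > 0" using assms by (simp add: \<epsilon>_def)
    have "((\<lambda>v::real. exp (- \<epsilon> * v)) \<longlongrightarrow> 0) at_top" using eps by real_asymp
    from tendsto_mult[OF tendsto_const[of "exp a * 2 ^ (n+1)"] this]
    show "((\<lambda>v::real. exp a * 2 ^ (n + 1) * exp (- \<epsilon> * v)) \<longlongrightarrow> 0) at_top" by simp
    have "eventually (\<lambda>v::real. exp v \<ge> 2) at_top"
      using exp_at_top filterlim_at_top by blast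
    then show "\<forall>\<^sub>F v in at_top. norm (exp ((a + c) * v + a) * \<delta> v ^ (n + 1)) \<le> exp a * 2 ^ (n + 1) * exp (- \<epsilon> * v)"
    proof eventually_elim
      case (elim v)
      have "exp v - 1 > 0" using elim by linarith
      then have "\<delta> v \<le> 2 / exp v" using elim unfolding \<delta>_def by (subst frac_le_eq) (auto simp: divide_simps)
      moreover have dp: "\<delta> v \<ge> 0"
      proof -
        have "exp v - 1 \<ge> 0" using elim by linarith
        then show ?thesis unfolding \<delta>_def by (rule divide_nonneg_nonneg[OF zero_le_one])
      qed
      ultimately have "\<delta> v ^ (n+1) \<le> (2 / exp v) ^ (n+1)" by (intro power_mono)
      also have "\<dots> = 2 ^ (n + 1) * exp (- (real (n+1) * v))"
        by (simp only: power_mult_distrib power_inverse exp_of_nat_mult exp_minus divide_inverse)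
      finally have "exp ((a + c) * v + a) * \<delta> v ^ (n + 1) \<le> exp ((a + c) * v + a) * (2 ^ (n + 1) * exp (- (real (n+1) * v)))"
        by (intro mult_left_mono) auto
      also have "\<dots> = exp a * 2 ^ (n+1) * (exp ((a + c) * v) * exp (- (real (n+1) * v)))"
        by (simp add: exp_add)
      also have "exp ((a + c) * v) * exp (- (real (n+1) * v)) = exp (- \<epsilon> * v)"
        unfolding exp_add[symmetric] \<epsilon>_def by (rule arg_cong[of _ _ exp]) (simp add: algebra_simps)
      finally show ?case using dp by simp
    qed
  qed
  from tendsto_add[OF this tendsto_mult[OF tendsto_const[of T] d0]]
  have B0: "(B \<longlongrightarrow> 0) at_top" by (simp add: B_def)
  have "((\<lambda>v. B v + (B v + \<bar>g\<bar>) * \<delta> v) \<longlongrightarrow> 0 + (0 + \<bar>g\<bar>) * 0) at_top"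
    by (intro tendsto_intros B0 d0)
  then have ev1: "eventually (\<lambda>v. B v + (B v + \<bar>g\<bar>) * \<delta> v < e) at_top"
    using order_tendstoD(2)[of _ 0 at_top e] assms by simp
  have ev2: "eventually (\<lambda>v. \<delta> v < 1) at_top" by (rule order_tendstoD[OF d0]) auto
  have "((\<lambda>v::real. (\<bar>v\<bar> + pi) / (exp \<bar>v\<bar> - 1)) \<longlongrightarrow> 0) at_top" by real_asymp
  then have ev3: "eventually (\<lambda>v::real. (\<bar>v\<bar> + pi) / (exp \<bar>v\<bar> - 1) < 1) at_top"
    by (rule order_tendstoD) auto
  show ?thesis using ev1 ev2 ev3 eventually_gt_at_top[of "0::real"]
  proof eventually_elim
    case (elim v)
    show ?case
    proof (intro allI impI)
      fix \<eta> :: real assume eta: "\<bar>\<eta>\<bar> \<le> pi"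
      define \<zeta> where "\<zeta> = Complex v \<eta>"
      define z where "z = 1 - exp \<zeta>"
      have v: "v > 0" by fact
      have "norm z \<ge> exp v - 1" using norm_1_minus_exp_ge[of v \<eta>] v by (simp add: z_def \<zeta>_def)
      then have nz: "z \<noteq> 0" using v by auto
      define u where "u = 1 / z"
      have u: "norm u \<le> \<delta> v" using \<open>norm z \<ge> exp v - 1\<close> v unfolding u_def \<delta>_def norm_divide
        by (simp add: frac_le)
      have d: "0 \<le> \<delta> v" "\<delta> v \<le> 1" using v elim by (auto simp: \<delta>_def)
      have "norm (strip_fun a c \<zeta>) \<le> exp (a * v + a * ((\<bar>v\<bar> + pi) / (exp \<bar>v\<bar> - 1)) + c * v)"
        using strip_fun_bound[of v \<eta> a c] v eta assms by (simp add: \<zeta>_def)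
      also have "\<dots> \<le> exp ((a + c) * v + a)"
        using mult_left_mono[of "(\<bar>v\<bar> + pi) / (exp \<bar>v\<bar> - 1)" 1 a] elim assms by (simp add: algebra_simps)
      finally have G: "norm (strip_fun a c \<zeta>) \<le> exp ((a + c) * v + a)" .
      define X where "X = strip_fun a c \<zeta> * u ^ (n + 1) - (\<Sum>k<n+1. of_real (exp a * nu a c k) * u ^ (n + 1 - k))"
      have "norm X \<le> B v"
        unfolding X_def B_def
      proof (intro order_trans[OF norm_triangle_ineq4] add_mono)
        show "norm (strip_fun a c \<zeta> * u ^ (n + 1)) \<le> exp ((a + c) * v + a) * \<delta> v ^ (n + 1)"
          unfolding norm_mult norm_power using G u by (intro mult_mono power_mono) auto
        show "norm (\<Sum>k<n+1. of_real (exp a * nu a c k) * u ^ (n + 1 - k)) \<le> T * \<delta> v"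
          unfolding T_def sum_distrib_right
        proof (intro sum_norm_le)
          fix k assume "k \<in> {..<n+1}"
          then obtain j where j: "n + 1 - k = Suc j" by (metis Suc_diff_Suc lessThan_iff)
          have "norm u ^ Suc j \<le> \<delta> v ^ Suc j" using u by (intro power_mono) auto
          also have "\<dots> \<le> \<delta> v" using d by (simp add: mult_left_le power_le_one)
          finally have "\<bar>exp a * nu a c k\<bar> * norm u ^ Suc j \<le> \<bar>exp a * nu a c k\<bar> * \<delta> v" by (rule mult_left_mono) simp
          then show "norm (of_real (exp a * nu a c k) * u ^ (n + 1 - k)) \<le> \<bar>exp a * nu a c k\<bar> * \<delta> v"
            unfolding j norm_mult norm_power norm_of_real .
        qed
      qed
      have "exp \<zeta> * strip_rem a c (n + 2) \<zeta> = (u - 1) * (X - of_real g)"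
      proof -
        have zz: "\<zeta> \<noteq> 0" using v by (auto simp: \<zeta>_def complex_eq_iff)
        have pw: "z ^ k * u ^ (n + 1) = u ^ (n + 1 - k)" if "k \<le> n + 1" for k
        proof -
          have "u ^ (n + 1) = u ^ k * u ^ (n + 1 - k)" using that by (simp flip: power_add)
          then show ?thesis using nz by (simp add: u_def power_one_over)
        qed
        have "strip_rem a c (n + 2) \<zeta> = (strip_fun a c \<zeta> - (\<Sum>k<n+2. of_real (exp a * nu a c k) * z ^ k)) * (u ^ (n + 1) * u)"
        proof -
          have "u ^ (n + 1) * u = inverse (z ^ (n + 2))"
            using nz by (simp add: u_def power_one_over field_simps)
          then show ?thesis using zz unfolding strip_rem_def z_def[symmetric] by (simp only: if_False divide_inverse)
        qed
        also have "\<dots> = (strip_fun a c \<zeta> * u ^ (n+1) - (\<Sum>k<n+2. of_real (exp a * nu a c k) * z ^ k * u ^ (n+1))) * u"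
          by (simp only: sum_distrib_right left_diff_distrib mult.assoc)
        also have "(\<Sum>k<n+2. of_real (exp a * nu a c k) * z ^ k * u ^ (n+1))
           = (\<Sum>k<n+2. of_real (exp a * nu a c k) * u ^ (n + 1 - k))"
        proof (intro sum.cong refl)
          fix k assume "k \<in> {..<n+2}"
          then have "k \<le> n + 1" by auto
          from pw[OF this] show "of_real (exp a * nu a c k) * z ^ k * u ^ (n+1) = of_real (exp a * nu a c k) * u ^ (n + 1 - k)"
            by (simp only: mult.assoc)
        qed
        also have "\<dots> = (\<Sum>k<n+1. of_real (exp a * nu a c k) * u ^ (n + 1 - k)) + of_real g"
          by (simp add: g_def del: nu.simps)
        finally have "strip_rem a c (n + 2) \<zeta> = (X - of_real g) * u"
          by (simp add: X_def del: nu.simps)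
        moreover have "exp \<zeta> * u = u - 1" using nz by (simp add: u_def z_def field_simps)
        ultimately show ?thesis by (metis mult.commute mult.left_commute)
      qed
      then have "exp \<zeta> * strip_rem a c (n + 2) \<zeta> - of_real g = u * (X - of_real g) - X"
        by (simp add: algebra_simps)
      also have "norm \<dots> \<le> \<delta> v * (B v + \<bar>g\<bar>) + B v"
        using \<open>norm X \<le> B v\<close> u d
        by (intro order_trans[OF norm_triangle_ineq4] add_mono)
           (auto simp: norm_mult intro!: mult_mono order_trans[OF norm_triangle_ineq4])
      finally show "norm (exp (Complex v \<eta>) * strip_rem a c (n + 2) (Complex v \<eta>) - of_real (exp a * nu a c (n + 1))) \<le> e"
        using elim(1) by (simp add: \<zeta>_def g_def algebra_simps del: nu.simps)
    qed
  qed
qed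

text \<open>
  Schwarz reflection: \<open>strip_fun\<close> takes conjugate values at conjugate points. The points
  \<open>ln (s / (1 - s)) + i * pi\<close> with \<open>0 < s < 1\<close> are those over \<open>y = - s\<close>.
\<close>

lemma strip_fun_upper:
  assumes "0 < s" "s < 1"
  shows "strip_fun a c (Complex (ln (s / (1 - s))) \<eta>) - strip_fun a c (Complex (ln (s / (1 - s))) (- \<eta>)) =
     2 * \<i> * of_real (Im (strip_fun a c (Complex (ln (s / (1 - s))) \<eta>)))"
proof -
  have c: "Complex v (- \<eta>) = cnj (Complex v \<eta>)" for v by (simp add: complex_eq_iff)
  have q: "exp_quot (cnj \<zeta>) = cnj (exp_quot \<zeta>)" for \<zeta> by (simp add: exp_quot_def exp_cnj)
  have "strip_fun a c (cnj \<zeta>) = cnj (strip_fun a c \<zeta>)" for \<zeta>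
    by (simp add: strip_fun_def q exp_cnj)
  then show ?thesis unfolding c by (simp add: complex_eq_iff)
qed

lemma exp_boundary:
  assumes "0 < s" "s < 1" "\<eta> = pi \<or> \<eta> = - pi"
  shows "exp (Complex (ln (s / (1 - s))) \<eta>) = of_real (- s / (1 - s))"
  using assms by (auto simp: complex_eq_iff Re_exp Im_exp)

lemma strip_fun_boundary:
  assumes "0 < s" "s < 1"
  shows "Im (strip_fun a c (Complex (ln (s / (1 - s))) pi)) = pi * w a c s"
proof -
  define v where "v = ln (s / (1 - s))"
  define \<zeta> where "\<zeta> = Complex v pi"
  have e: "exp \<zeta> = of_real (- s / (1 - s))" unfolding \<zeta>_def v_def using assms by (intro exp_boundary) auto
  have nz: "\<zeta> \<noteq> 0" by (simp add: \<zeta>_def complex_eq_iff)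
  have "exp \<zeta> - 1 = of_real (- 1 / (1 - s))" unfolding e using assms by (simp add: complex_eq_iff field_simps)
  then have "exp \<zeta> / exp_quot \<zeta> = of_real s * \<zeta>"
    using nz assms unfolding exp_quot_def e by simp
  then have "strip_fun a c \<zeta> = exp (of_real (a * s + c) * \<zeta>)"
    by (simp add: strip_fun_def algebra_simps)
  then have "Im (strip_fun a c \<zeta>) = exp ((a * s + c) * v) * sin ((a * s + c) * pi)"
    by (simp add: Im_exp \<zeta>_def)
  also have "exp ((a * s + c) * v) = (s / (1 - s)) powr (a * s + c)"
    using assms by (simp add: powr_def v_def)
  finally show ?thesis by (simp add: w_def \<zeta>_def v_def mult.commute)
qed

lemma w_bound:
  assumes "0 < s" "s < 1" "a \<ge> 0" "c \<ge> 0"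
  shows "\<bar>w a c s\<bar> \<le> (1 - s) powr (- (a + c))"
proof -
  have "\<bar>w a c s\<bar> = (1 / pi) * (s / (1 - s)) powr (a * s + c) * \<bar>sin (pi * (a * s + c))\<bar>"
    by (simp add: w_def abs_mult)
  also have "\<dots> \<le> 1 * (s / (1 - s)) powr (a * s + c) * 1"
    using pi_gt3 by (intro mult_mono) (auto simp: divide_simps)
  also have "\<dots> = s powr (a * s + c) * (1 - s) powr (- (a * s + c))"
  proof -
    have "(s / (1 - s)) powr e = s powr e * (1 - s) powr (- e)" for e
    proof -
      have "(s / (1 - s)) powr e = s powr e / (1 - s) powr e" by (rule powr_divide)
      then show ?thesis by (simp only: powr_minus divide_inverse)
    qed
    then show ?thesis by simp
  qed
  also have "\<dots> \<le> 1 * (1 - s) powr (- (a + c))"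
  proof (intro mult_mono)
    show "s powr (a * s + c) \<le> 1" using assms by (intro powr_le1) auto
    have "a * s \<le> a" using assms by (simp add: mult_left_le)
    then have "(1 - s) powr (- (a * s + c)) \<le> (1 - s) powr (- (a + c))"
      using assms by (intro powr_mono') auto
    then show "(1 - s) powr (- (a * s + c)) \<le> (1 - s) powr (- (a + c))" .
  qed auto
  finally show ?thesis by simp
qed

lemma powr_integrable_at_1:
  assumes "p > -1"
  shows "set_integrable lborel {0<..<1} (\<lambda>s::real. (1 - s) powr p)"
proof -
  have "set_integrable lborel (einterval 0 1) (\<lambda>s::real. (1 - s) powr p)"
  proof (rule interval_integral_FTC_nonneg)
    fix x :: real assume x: "0 < ereal x" "ereal x < 1"
    show "((\<lambda>s. - ((1 - s) powr (p + 1) / (p + 1))) has_real_derivative (1 - x) powr p) (at x)"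
    proof -
      have "((\<lambda>s. (1 - s) powr (p + 1)) has_real_derivative ((p + 1) * (1 - x) powr (p + 1 - 1)) * (- 1)) (at x)"
        using x by (intro DERIV_chain2[OF has_real_derivative_powr]) (auto intro!: derivative_eq_intros)
      from DERIV_minus[OF DERIV_cdivide[OF this, of "p + 1"]] show ?thesis using assms by simp
    qed
    show "isCont (\<lambda>s. (1 - s) powr p) x" using x by (intro continuous_intros) auto
  next
    have 1: "((\<lambda>s::real. - ((1 - s) powr (p + 1) / (p + 1))) \<longlongrightarrow> - ((1 - 0) powr (p + 1) / (p + 1))) (at_right 0)"
      using assms by (intro tendsto_intros) auto
    then show "(((\<lambda>s::real. - ((1 - s) powr (p + 1) / (p + 1))) \<circ> real_of_ereal) \<longlongrightarrow> - ((1 - 0) powr (p + 1) / (p + 1))) (at_right 0)"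
      unfolding zero_ereal_def by (simp add: ereal_tendsto_simps)
    have "((\<lambda>s::real. (1 - s) powr (p + 1)) \<longlongrightarrow> 0) (at_left 1)"
    proof (rule tendsto_zero_powrI)
      show "((\<lambda>s::real. 1 - s) \<longlongrightarrow> 0) (at_left 1)" by (auto intro!: tendsto_eq_intros)
      show "\<forall>\<^sub>F s::real in at_left 1. 0 \<le> 1 - s"
        by (auto simp: eventually_at_filter intro!: always_eventually)
    qed (use assms in auto)
    from tendsto_minus[OF tendsto_divide[OF this tendsto_const[of "p + 1"]]]
    have "((\<lambda>s::real. - ((1 - s) powr (p + 1) / (p + 1))) \<longlongrightarrow> 0) (at_left 1)" using assms by simp
    then show "(((\<lambda>s::real. - ((1 - s) powr (p + 1) / (p + 1))) \<circ> real_of_ereal) \<longlongrightarrow> 0) (at_left 1)"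
      unfolding one_ereal_def by (simp add: ereal_tendsto_simps)
  qed auto
  then show ?thesis by (simp add: einterval_eq zero_ereal_def one_ereal_def)
qed

lemma w_continuous_on: "continuous_on {0<..<1} (w a c)"
  unfolding w_def by (intro continuous_intros) auto

lemma w_moment_integrable:
  assumes "a \<ge> 0" "c \<ge> 0" "a + c < real (n + 1)"
  shows "set_integrable lborel {0<..<1} (\<lambda>s. w a c s * (1 - s) ^ n)"
proof (rule set_integrable_bound[OF powr_integrable_at_1[of "real n - (a + c)"]])
  show "set_borel_measurable lborel {0<..<1} (\<lambda>s. w a c s * (1 - s) ^ n)"
    unfolding set_borel_measurable_def
    using borel_measurable_continuous_on_indicator[of "{0<..<1}" "\<lambda>s. w a c s * (1 - s) ^ n"]
    by (simp add: continuous_on_mult[OF w_continuous_on] continuous_intros)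
  show "AE s in lborel. s \<in> {0<..<1} \<longrightarrow> norm (w a c s * (1 - s) ^ n) \<le> norm ((1 - s) powr (real n - (a + c)))"
  proof (intro AE_I2 impI)
    fix s :: real assume s: "s \<in> {0<..<1}"
    have "norm (w a c s * (1 - s) ^ n) \<le> (1 - s) powr (- (a + c)) * (1 - s) ^ n"
      using w_bound[of s a c] s assms by (simp add: abs_mult mult_right_mono)
    also have "\<dots> = (1 - s) powr (real n - (a + c))"
      using s by (simp flip: powr_realpow powr_add) (simp add: algebra_simps)
    finally show "norm (w a c s * (1 - s) ^ n) \<le> norm ((1 - s) powr (real n - (a + c)))" by simp
  qed
qed (use assms in auto)

text \<open>
  Take a primitive of \<open>exp \<zeta> * strip_rem a c (n + 2) \<zeta>\<close> and let \<open>\<Phi>\<close> be its jump between the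
  lines \<open>Im \<zeta> = pi\<close> and \<open>Im \<zeta> = - pi\<close>. On both lines \<open>z = 1 / (1 - s)\<close> is the same real number,
  so the Taylor polynomial cancels in the derivative of the jump along the line, which is
  therefore a multiple of \<open>w a c s * (1 - s) ^ n\<close>. The limits of the jump at the two ends are
  known, and the fundamental theorem of calculus gives the integral.
\<close>

theorem w_moment:
  assumes "a \<ge> 0" "c \<ge> 0" "a + c < real (n + 1)"
  shows "(LINT s:{0<..<1}|lborel. w a c s * (1 - s) ^ n) = - exp a * nu a c (n + 1)"
proof -
  define h where "h = (\<lambda>\<zeta>. exp \<zeta> * strip_rem a c (n + 2) \<zeta>)"
  define g where "g = exp a * nu a c (n + 1)"
  have "h holomorphic_on strip" unfolding h_def
    by (intro holomorphic_intros strip_rem_holomorphic)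
  then obtain P where P: "\<And>\<zeta>. \<zeta> \<in> strip \<Longrightarrow> (P has_field_derivative h \<zeta>) (at \<zeta> within strip)"
    using holomorphic_convex_primitive'[OF convex_strip open_strip] by blast
  define \<Phi> where "\<Phi> = (\<lambda>v. P (Complex v pi) - P (Complex v (- pi)))"
  define L where "L = (\<lambda>s::real. ln (s / (1 - s)))"
  have top: "(\<Phi> \<longlongrightarrow> 2 * pi * \<i> * of_real g) at_top"
    unfolding \<Phi>_def using strip_rem_right_limit[OF assms(1,2) _ assms(3)]
    by (intro primitive_jump_limit[OF P]) (auto simp: h_def g_def simp del: nu.simps)
  have bot: "(\<Phi> \<longlongrightarrow> 2 * pi * \<i> * 0) at_bot"
    unfolding \<Phi>_def using strip_rem_left_limit[OF assms(1,2)]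
    by (intro primitive_jump_limit[OF P]) (auto simp: h_def)
  have PD: "((\<lambda>v. P (Complex v \<eta>)) has_vector_derivative h (Complex v \<eta>)) (at v)" if "\<bar>\<eta>\<bar> < 2 * pi" for v \<eta>
  proof -
    have "((\<lambda>v. of_real v + \<i> * of_real \<eta>) has_vector_derivative 1) (at v)"
      by (auto intro!: derivative_eq_intros)
    moreover have "(P has_field_derivative h (Complex v \<eta>)) (at (of_real v + \<i> * of_real \<eta>))"
    proof -
      have "Complex v \<eta> \<in> strip" using that by simp
      from P[OF this] at_within_open[OF this open_strip]
      have "(P has_field_derivative h (Complex v \<eta>)) (at (Complex v \<eta>))" by simp
      then show ?thesis by (simp only: Complex_eq)
    qed
    ultimately have "(P \<circ> (\<lambda>v. of_real v + \<i> * of_real \<eta>) has_vector_derivative 1 * h (Complex v \<eta>)) (at v)"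
      by (rule field_vector_diff_chain_at)
    then show ?thesis by (simp only: o_def Complex_eq mult_1)
  qed
  have L': "(L has_real_derivative 1 / (s * (1 - s))) (at s)" if "0 < s" "s < 1" for s
  proof -
    have "((\<lambda>s. ln s - ln (1 - s)) has_real_derivative 1 / s - (- 1) / (1 - s)) (at s)"
      using that by (auto intro!: derivative_eq_intros)
    moreover have "1 / s - (- 1) / (1 - s) = 1 / (s * (1 - s))" using that by (simp add: field_simps)
    ultimately have "((\<lambda>s. ln s - ln (1 - s)) has_real_derivative 1 / (s * (1 - s))) (at s)" by simp
    moreover have "eventually (\<lambda>s. s \<in> {0<..<1}) (nhds s)"
      using that by (intro eventually_nhds_in_open) auto
    then have "eventually (\<lambda>s. L s = ln s - ln (1 - s)) (nhds s)"
      by eventually_elim (auto simp: L_def ln_div)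
    ultimately show ?thesis by (subst DERIV_cong_ev[OF refl _ refl]) auto
  qed
  define F where "F = (\<lambda>s. \<Phi> (L s))"
  \<comment> \<open>\<open>h\<close> on the two lines differs only through \<open>strip_fun\<close>; the common polynomial part is \<open>T\<close>.\<close>
  have jump: "(h (Complex (L s) pi) - h (Complex (L s) (- pi))) / of_real (s * (1 - s))
      = - (2 * pi * \<i>) * of_real (w a c s * (1 - s) ^ n)" if s: "0 < s" "s < 1" for s
  proof -
    define x :: complex where "x = of_real (1 - s)"
    define y :: complex where "y = of_real s"
    have x: "x \<noteq> 0" "y \<noteq> 0" "x + y = 1" using s by (auto simp: x_def y_def complex_eq_iff)
    define T where "T = (\<Sum>k<n+2. of_real (exp a * nu a c k) * (1 / x) ^ k)"
    have b: "exp (Complex (L s) \<eta>) = - y / x" if "\<eta> = pi \<or> \<eta> = - pi" for \<eta>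
      using exp_boundary[OF s that] by (simp add: L_def x_def y_def)
    have z: "1 - exp (Complex (L s) \<eta>) = 1 / x" if "\<eta> = pi \<or> \<eta> = - pi" for \<eta>
      using b[OF that] x by (simp add: field_simps)
    have hb: "h (Complex (L s) \<eta>) = - y / x * ((strip_fun a c (Complex (L s) \<eta>) - T) * x ^ (n + 2))"
      if "\<eta> = pi \<or> \<eta> = - pi" for \<eta>
    proof -
      have "Complex (L s) \<eta> \<noteq> 0" using that by (auto simp: complex_eq_iff)
      then have "strip_rem a c (n + 2) (Complex (L s) \<eta>) = (strip_fun a c (Complex (L s) \<eta>) - T) / (1 / x) ^ (n + 2)"
        unfolding strip_rem_def z[OF that] T_def by (simp only: if_False)
      also have "\<dots> = (strip_fun a c (Complex (L s) \<eta>) - T) * x ^ (n + 2)" by (simp add: power_one_over)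
      finally show ?thesis by (simp add: h_def b[OF that])
    qed
    have "h (Complex (L s) pi) - h (Complex (L s) (- pi))
       = - y / x * (strip_fun a c (Complex (L s) pi) - strip_fun a c (Complex (L s) (- pi))) * x ^ (n + 2)"
      by (simp only: hb simp_thms) (simp add: algebra_simps)
    also have "\<dots> = - y / x * (2 * \<i> * of_real (pi * w a c s)) * x ^ (n + 2)"
      using strip_fun_upper[OF s, of a c pi] strip_fun_boundary[OF s, of a c] by (simp add: L_def)
    also have "\<dots> = (- (2 * pi * \<i>) * of_real (w a c s * (1 - s) ^ n)) * of_real (s * (1 - s))"
      using x by (simp add: x_def[symmetric] y_def[symmetric] power_add power2_eq_square field_simps del: of_real_diff)
        (simp add: x_def algebra_simps)
    finally show ?thesis using s by simp
  qed
  have "(LBINT s=0..1. - (2 * pi * \<i>) * of_real (w a c s * (1 - s) ^ n)) = 2 * pi * \<i> * of_real g - 0"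
  proof (rule interval_integral_FTC_integrable)
    fix s :: real assume "0 < ereal s" "ereal s < 1"
    then have s: "0 < s" "s < 1" by auto
    have "((\<lambda>v. \<Phi> v) has_vector_derivative (h (Complex (L s) pi) - h (Complex (L s) (- pi)))) (at (L s))"
      unfolding \<Phi>_def by (intro derivative_intros PD) auto
    with L'[OF s] have "(\<Phi> \<circ> L has_vector_derivative (1 / (s * (1 - s))) *\<^sub>R (h (Complex (L s) pi) - h (Complex (L s) (- pi)))) (at s)"
      unfolding has_real_derivative_iff_has_vector_derivative by (intro vector_diff_chain_at)
    then show "(F has_vector_derivative - (2 * pi * \<i>) * of_real (w a c s * (1 - s) ^ n)) (at s)"
      using jump[OF s] by (simp add: F_def o_def scaleR_conv_of_real)
    have "isCont (w a c) s" using w_continuous_on[of a c] s by (simp add: continuous_on_eq_continuous_at)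
    then show "isCont (\<lambda>s. - (2 * pi * \<i>) * of_real (w a c s * (1 - s) ^ n)) s"
      by (intro continuous_intros)
  next
    have "set_integrable lborel {0<..<1} (\<lambda>s. - (2 * pi * \<i>) * of_real (w a c s * (1 - s) ^ n))"
    proof (intro set_integrable_mult_right)
      show "set_integrable lborel {0<..<1} (\<lambda>s. complex_of_real (w a c s * (1 - s) ^ n))"
        using integrable_of_real[OF w_moment_integrable[OF assms, unfolded set_integrable_def], where 'a = complex]
        by (simp add: set_integrable_def scaleR_conv_of_real)
    qed
    then show "set_integrable lborel (einterval 0 1) (\<lambda>s. - (2 * pi * \<i>) * of_real (w a c s * (1 - s) ^ n))"
      by (simp add: einterval_eq zero_ereal_def one_ereal_def)
  next
    have "filterlim L at_bot (at_right 0)" unfolding L_def by real_asymp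
    from filterlim_compose[OF bot this] show "((F \<circ> real_of_ereal) \<longlongrightarrow> 0) (at_right 0)"
      unfolding zero_ereal_def ereal_tendsto_simps by (simp add: F_def)
    have "filterlim L at_top (at_left 1)" unfolding L_def by real_asymp
    from filterlim_compose[OF top this] show "((F \<circ> real_of_ereal) \<longlongrightarrow> 2 * pi * \<i> * of_real g) (at_left 1)"
      unfolding one_ereal_def ereal_tendsto_simps by (simp add: F_def)
  qed auto
  also have "(LBINT s=0..1. - (2 * pi * \<i>) * of_real (w a c s * (1 - s) ^ n))
    = - (2 * pi * \<i>) * of_real (LINT s:{0<..<1}|lborel. w a c s * (1 - s) ^ n)"
  proof -
    have "(LBINT s=0..1. - (2 * pi * \<i>) * of_real (w a c s * (1 - s) ^ n))
       = (LINT s:{0<..<1}|lborel. - (2 * pi * \<i>) * complex_of_real (w a c s * (1 - s) ^ n))"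
      unfolding interval_lebesgue_integral_def by (simp add: einterval_eq zero_ereal_def one_ereal_def)
    then show ?thesis by (simp only: set_integral_mult_right set_integral_complex_of_real)
  qed
  finally have "pi * (LINT s:{0<..<1}|lborel. w a c s * (1 - s) ^ n) = pi * (- g)"
    by (simp add: complex_eq_iff)
  then show ?thesis unfolding mult_cancel_left g_def by simp
qed

definition dens :: "real \<Rightarrow> real \<Rightarrow> real \<Rightarrow> real" where
  "dens a c t = (\<Sum>n. - nu a c (Suc n) * t ^ n / fact n)"

section \<open>The density as an entire function\<close>

declare nu.simps(2) [simp del]
lemma nu_1: "nu a c (Suc 0) = - (a / 2 + c)"
  by (simp add: cf_def nu.simps)
lemma cf12: "cf a c (Suc 0) = a / 2 + c" "cf a c (Suc (Suc 0)) = a / 3 + c" by (simp_all add: cf_def)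
lemma nu_2: "nu a c (Suc (Suc 0)) = - ((a / 3 + c) - (a / 2 + c)\<^sup>2) / 2"
proof -
  have "(\<Sum>k\<le>Suc 0. cf a c (Suc (Suc 0) - k) * nu a c k) = cf a c (Suc (Suc 0)) + cf a c (Suc 0) * nu a c (Suc 0)" 
    by simp
  then have "nu a c (Suc (Suc 0)) = - (cf a c (Suc (Suc 0)) + cf a c (Suc 0) * nu a c (Suc 0)) / real (Suc (Suc 0))"
    unfolding nu.simps(2)[of a c "Suc 0"] by (simp only:)
  also have "\<dots> = - ((a / 3 + c) - (a / 2 + c)\<^sup>2) / 2"
  proof -
    have "- (A + B * - B) / real (Suc (Suc 0)) = - (A - B * B) / 2" for A B :: real by simp
    then show ?thesis unfolding nu_1 cf12 power2_eq_square .
  qed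
  finally show ?thesis .
qed

lemma dens_summable_abs: "summable (\<lambda>n. \<bar>- nu a c (Suc n) * t ^ n / fact n\<bar>)"
proof (rule summable_comparison_test')
  define M where "M = \<bar>a\<bar> + \<bar>c\<bar> + 1"
  show "summable (\<lambda>n. M * ((M * \<bar>t\<bar>) ^ n / fact n))"
    using summable_exp[of "M * \<bar>t\<bar>"] by (intro summable_mult) (simp add: divide_inverse mult.commute)
  fix n
  have "\<bar>nu a c (Suc n)\<bar> \<le> M ^ Suc n" using nu_le_power[of a c "\<bar>a\<bar> + \<bar>c\<bar>" "Suc n"] by (simp add: M_def)
  then have le: "\<bar>nu a c (Suc n)\<bar> * \<bar>t\<bar> ^ n / fact n \<le> M ^ Suc n * \<bar>t\<bar> ^ n / fact n"
    by (intro divide_right_mono mult_right_mono) auto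
  then show "norm \<bar>- nu a c (Suc n) * t ^ n / fact n\<bar> \<le> M * ((M * \<bar>t\<bar>) ^ n / fact n)"
  proof -
    have "norm \<bar>- nu a c (Suc n) * t ^ n / fact n\<bar> = \<bar>nu a c (Suc n)\<bar> * \<bar>t\<bar> ^ n / fact n"
      by (simp add: abs_mult power_abs)
    moreover have "M ^ Suc n * \<bar>t\<bar> ^ n / fact n = M * ((M * \<bar>t\<bar>) ^ n / fact n)"
      by (simp add: power_mult_distrib)
    moreover note le
    ultimately show ?thesis by linarith
  qed
qed

lemma dens_sums: "(\<lambda>n. - nu a c (Suc n) * t ^ n / fact n) sums dens a c t"
  unfolding dens_def by (rule summable_sums[OF summable_rabs_cancel[OF dens_summable_abs]])

text \<open>
  The exponential in \<open>D_integrand\<close> is expanded and integrated termwise, with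
  \<open>\<bar>w a c s\<bar> * (1 - s) ^ 2\<close> as integrable majorant. The two subtracted terms are the missing
  moments of index 0 and 1, which \<open>q1\<close> and \<open>q1 - q2\<close> restore.
\<close>

lemma D_eq_dens:
  assumes "a \<ge> 0" "c \<ge> 0" "a + c < 3"
  shows "set_integrable lborel {0<..<1} (D_integrand a c t)" "D a c t = dens a c t"
proof -
  define f where "f = (\<lambda>i s. indicator {0<..<1} s * (w a c s * (1 - s) ^ (i + 2)) * (t ^ (i + 2) / fact (i + 2)))"
  have wi: "integrable lborel (\<lambda>s. indicator {0<..<1} s * (w a c s * (1 - s) ^ (i + 2)))" for i
    using w_moment_integrable[of a c "i + 2"] assms by (simp add: set_integrable_def)
  have fi: "integrable lborel (f i)" for i unfolding f_def by (intro integrable_mult_left wi)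
  define W where "W = (LINT s|lborel. \<bar>indicator {0<..<1} s * (w a c s * (1 - s) ^ 2)\<bar>)"
  have nf: "norm (f i s) \<le> \<bar>indicator {0<..<1} s * (w a c s * (1 - s) ^ 2)\<bar> * (\<bar>t\<bar> ^ (i + 2) / fact (i + 2))" for i s
  proof (cases "s \<in> {0<..<1}")
    case True
    then have "(1 - s) ^ (i + 2) \<le> (1 - s) ^ 2" by (intro power_decreasing) auto
    then have "\<bar>w a c s\<bar> * (1 - s) ^ (i + 2) \<le> \<bar>w a c s\<bar> * (1 - s) ^ 2" by (intro mult_left_mono) auto
    then have "\<bar>w a c s\<bar> * (1 - s) ^ (i + 2) * (\<bar>t\<bar> ^ (i + 2) / fact (i + 2)) \<le> \<bar>w a c s\<bar> * (1 - s) ^ 2 * (\<bar>t\<bar> ^ (i + 2) / fact (i + 2))"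
      by (intro mult_right_mono) auto
    then show ?thesis using True by (simp only: f_def) (simp add: abs_mult power_abs)
  qed (simp add: f_def)
  have st: "summable (\<lambda>i. \<bar>t\<bar> ^ (i + 2) / fact (i + 2))"
    using summable_exp[of "\<bar>t\<bar>"] by (subst summable_iff_shift) (simp add: divide_inverse mult.commute)
  have s1: "AE s in lborel. summable (\<lambda>i. norm (f i s))"
  proof (intro AE_I2)
    fix s show "summable (\<lambda>i. norm (f i s))"
      by (rule summable_comparison_test'[OF summable_mult[OF st]]) (use nf in \<open>simp only: real_norm_def abs_idempotent\<close>)
  qed
  have s2: "summable (\<lambda>i. LINT s|lborel. norm (f i s))"
  proof (rule summable_comparison_test'[OF summable_mult[OF st, of W]])
    fix i
    have "(LINT s|lborel. norm (f i s)) \<le> (LINT s|lborel. \<bar>indicator {0<..<1} s * (w a c s * (1 - s) ^ 2)\<bar> * (\<bar>t\<bar> ^ (i + 2) / fact (i + 2)))"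
      using wi[of 0] nf by (intro integral_mono integrable_norm fi integrable_mult_left integrable_abs) (auto simp: numeral_2_eq_2)
    also have "\<dots> = W * (\<bar>t\<bar> ^ (i + 2) / fact (i + 2))" unfolding W_def by simp
    finally show "norm (LINT s|lborel. norm (f i s)) \<le> W * (\<bar>t\<bar> ^ (i + 2) / fact (i + 2))" by simp
  qed
  have sumf: "(\<Sum>i. f i s) = indicator {0<..<1} s *\<^sub>R D_integrand a c t s" for s
  proof -
    define x where "x = (1 - s) * t"
    have "(\<lambda>n. x ^ n / fact n) sums exp x" using exp_converges[of x] by (simp add: divide_inverse mult.commute)
    from sums_split_initial_segment[OF this, of 2]
    have "(\<lambda>i. x ^ (i + 2) / fact (i + 2)) sums (exp x - 1 - x)" by (simp add: numeral_2_eq_2 algebra_simps)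
    from sums_mult[OF this, of "indicator {0<..<1} s * w a c s"]
    have "(\<lambda>i. f i s) sums (indicator {0<..<1} s * w a c s * (exp x - 1 - x))"
    proof -
      have "indicator {0<..<1} s * w a c s * (x ^ (i + 2) / fact (i + 2)) = f i s" for i
        unfolding f_def x_def power_mult_distrib by (simp only: mult.assoc times_divide_eq_right)
      then show "(\<lambda>i. indicator {0<..<1} s * w a c s * (x ^ (i + 2) / fact (i + 2))) sums
          (indicator {0<..<1} s * w a c s * (exp x - 1 - x)) \<Longrightarrow> ?thesis" by simp
    qed
    then show ?thesis by (simp add: sums_iff D_integrand_def x_def)
  qed
  show "set_integrable lborel {0<..<1} (D_integrand a c t)"
    using integrable_suminf[OF fi s1 s2] by (simp add: set_integrable_def sumf)
  have "(\<lambda>i. LINT s|lborel. f i s) sums (LINT s|lborel. (\<Sum>i. f i s))"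
    by (rule sums_integral[OF fi s1 s2])
  also have "(LINT s|lborel. (\<Sum>i. f i s)) = (LINT s:{0<..<1}|lborel. D_integrand a c t s)"
    by (simp add: sumf set_lebesgue_integral_def)
  also have "(\<lambda>i. LINT s|lborel. f i s) = (\<lambda>i. - exp a * nu a c (i + 3) * (t ^ (i + 2) / fact (i + 2)))"
  proof
    fix i
    have "(LINT s|lborel. f i s) = (LINT s:{0<..<1}|lborel. w a c s * (1 - s) ^ (i + 2)) * (t ^ (i + 2) / fact (i + 2))"
      unfolding f_def set_lebesgue_integral_def by simp
    also have "(LINT s:{0<..<1}|lborel. w a c s * (1 - s) ^ (i + 2)) = - exp a * nu a c (i + 2 + 1)"
      using assms by (intro w_moment) auto
    finally show "(LINT s|lborel. f i s) = - exp a * nu a c (i + 3) * (t ^ (i + 2) / fact (i + 2))"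
      by (simp add: numeral_3_eq_3)
  qed
  finally have "(\<lambda>i. - exp a * nu a c (i + 3) * (t ^ (i + 2) / fact (i + 2))) sums (LINT s:{0<..<1}|lborel. D_integrand a c t s)" .
  from sums_mult[OF this, of "exp (- a)"]
  have "(\<lambda>i. - nu a c (Suc (i + 2)) * t ^ (i + 2) / fact (i + 2)) sums (exp (- a) * (LINT s:{0<..<1}|lborel. D_integrand a c t s))"
    by (simp add: exp_minus mult.assoc[symmetric] numeral_3_eq_3)
  moreover have "(\<lambda>i. - nu a c (Suc (i + 2)) * t ^ (i + 2) / fact (i + 2)) sums
      (dens a c t - (\<Sum>i<2. - nu a c (Suc i) * t ^ i / fact i))"
    by (rule sums_split_initial_segment[OF dens_sums])
  ultimately have "exp (- a) * (LINT s:{0<..<1}|lborel. D_integrand a c t s) = dens a c t - (\<Sum>i<2. - nu a c (Suc i) * t ^ i / fact i)"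
    by (rule sums_unique2)
  also have "(\<Sum>i<2. - nu a c (Suc i) * t ^ i / fact i) = q1 a c + (q1 a c - q2 a c) * t"
    unfolding numeral_2_eq_2 sum.lessThan_Suc nu_1 nu_2
    by (simp add: q1_def q2_def power2_eq_square field_simps)
  finally show "D a c t = dens a c t" by (simp add: D_def)
qed


section \<open>Coefficients on the axis c = 0\<close>

lemma nu_rec: "real (Suc n) * nu a c (Suc n) = - (\<Sum>k\<le>n. cf a c (Suc n - k) * nu a c k)"
  by (simp add: nu.simps(2) del: of_nat_Suc)

lemma cf_diff: "cf a c j - cf a c (Suc j) = a / ((real j + 1) * (real j + 2))"
proof -
  have "a / (real j + 1) - a / (real j + 2) = a / ((real j + 1) * (real j + 2))"
    by (simp add: diff_frac_eq) (simp add: algebra_simps)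
  then show ?thesis by (simp add: cf_def add.commute)
qed

text \<open>
  The recursion multiplied by \<open>1 - z\<close>: the coefficients \<open>cf a c j\<close> are replaced by their
  differences, in which \<open>c\<close> no longer appears.
\<close>

lemma nu_diff_rec:
  "real (Suc n) * nu a c (Suc n) = (real n - a / 2 - c) * nu a c n
     + a * (\<Sum>k<n. nu a c k / ((real (n - k) + 1) * (real (n - k) + 2)))"
proof (cases n)
  case 0
  then show ?thesis using nu_rec[of 0 a c] by (simp add: cf_def)
next
  case (Suc m)
  have "real (Suc n) * nu a c (Suc n) = - (\<Sum>k<n. cf a c (Suc n - k) * nu a c k) - cf a c 1 * nu a c n"
    unfolding nu_rec by (simp add: lessThan_Suc_atMost[symmetric])
  moreover have "real n * nu a c n = - (\<Sum>k<n. cf a c (n - k) * nu a c k)"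
    unfolding Suc nu_rec by (simp add: lessThan_Suc_atMost)
  moreover have "(\<Sum>k<n. cf a c (n - k) * nu a c k) - (\<Sum>k<n. cf a c (Suc n - k) * nu a c k)
      = a * (\<Sum>k<n. nu a c k / ((real (n - k) + 1) * (real (n - k) + 2)))"
    unfolding sum_subtractf[symmetric] sum_distrib_left
  proof (intro sum.cong refl)
    fix k assume "k \<in> {..<n}"
    then have "cf a c (Suc n - k) = cf a c (Suc (n - k))" by (simp add: Suc_diff_le)
    then show "cf a c (n - k) * nu a c k - cf a c (Suc n - k) * nu a c k
       = a * (nu a c k / ((real (n - k) + 1) * (real (n - k) + 2)))"
      using cf_diff[of a c "n - k"] by (simp flip: left_diff_distrib)
  qed
  ultimately show ?thesis by (simp add: cf_def algebra_simps)
qed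

definition g :: "real \<Rightarrow> nat \<Rightarrow> real" where "g al n = - nu al 0 n"

lemma g_1: "g al 1 = al / 2" using nu_diff_rec[of 0 al 0] by (simp add: g_def)

lemma g_2: "g al 2 = al / 6 - al\<^sup>2 / 8"
proof -
  have n1: "nu al 0 1 = - al / 2" using g_1[of al] by (simp add: g_def)
  have "2 * nu al 0 2 = (1 - al / 2) * nu al 0 1 + al * (1 / 6)"
    using nu_diff_rec[of 1 al 0] by (simp add: numeral_2_eq_2)
  then show ?thesis unfolding n1 g_def power2_eq_square by (simp add: algebra_simps)
qed

lemma g_3: "g al 3 = al * (al - 2)\<^sup>2 / 48"
proof -
  have n1: "nu al 0 1 = - al / 2" using g_1[of al] by (simp add: g_def)
  have n2: "nu al 0 2 = al\<^sup>2 / 8 - al / 6" using g_2[of al] by (simp add: g_def)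
  have "{..<2} = {0, 1::nat}" by auto
  then have "3 * nu al 0 3 = (2 - al / 2) * nu al 0 2 + al * (1 / 12 + nu al 0 1 / 6)"
    using nu_diff_rec[of 2 al 0] by (simp add: numeral_3_eq_3 numeral_2_eq_2)
  then show ?thesis unfolding n1 n2 g_def power2_eq_square by (simp add: algebra_simps)
qed

lemma g_rec: "n \<ge> 1 \<Longrightarrow> real n * g al n = al / (real n + 1) - (\<Sum>k=1..<n. al / (real (n - k) + 1) * g al k)"
proof -
  assume "n \<ge> 1"
  then obtain m where m: "n = Suc m" by (cases n) auto
  have "real n * g al n = (\<Sum>k\<le>m. cf al 0 (n - k) * nu al 0 k)"
    using nu_rec[of m al 0] by (simp add: g_def m)
  also have "{..m} = insert 0 {1..<n}" using m by auto
  also have "(\<Sum>k\<in>insert 0 {1..<n}. cf al 0 (n - k) * nu al 0 k)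
     = cf al 0 n + (\<Sum>k=1..<n. cf al 0 (n - k) * nu al 0 k)" by (subst sum.insert) auto
  also have "(\<Sum>k=1..<n. cf al 0 (n - k) * nu al 0 k) = - (\<Sum>k=1..<n. al / (real (n - k) + 1) * g al k)"
    unfolding sum_negf[symmetric] by (intro sum.cong refl) (simp add: cf_def g_def add.commute)
  finally show ?thesis by (simp add: cf_def add.commute)
qed

text \<open>
  A variant of Kaluza's argument for logarithmically convex sequences. Subtracting \<open>r\<close> times the
  recursion for \<open>n - 1\<close> from the one for \<open>n\<close> replaces \<open>al / (n - k + 1)\<close> by
  \<open>e k = al / (n - k + 1) - r * al / (n - k)\<close>. The choice \<open>r = (n - 3) / (n - 2)\<close> makes \<open>e k\<close> vanish
  at \<open>k = 3\<close> and nonpositive beyond, so that the terms with \<open>k \<ge> 3\<close> have the right sign by induction.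
  The terms with \<open>k = 1\<close> and the negative coefficient \<open>k = 2\<close> are computed.
\<close>

lemma g_nonneg:
  assumes al: "2 \<le> al" "al \<le> 58/25" and n: "n \<ge> 3"
  shows "g al n \<ge> 0"
  using n
proof (induction n rule: less_induct)
  case (less n)
  show ?case
  proof (cases "n = 3")
    case True then show ?thesis using al by (simp add: g_3)
  next
    case False
    then have n4: "n \<ge> 4" using less.prems by simp
    define N where "N = real n"
    have N: "N \<ge> 4" using n4 by (simp add: N_def)
    define r where "r = (N - 3) / (N - 2)"
    define e where "e = (\<lambda>k::nat. al / (N - real k + 1) - r * (al / (N - real k)))"
    have rec1: "N * g al n = al / (N + 1) - (\<Sum>k=1..<n-1. al / (N - real k + 1) * g al k) - al / 2 * g al (n - 1)"
    proof -
      have i: "{1..<n} = insert (n - 1) {1..<n-1}" using n4 by auto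
      have "real n * g al n = al / (real n + 1) - (\<Sum>k=1..<n. al / (real (n - k) + 1) * g al k)"
        using n4 by (intro g_rec) auto
      also have "(\<Sum>k=1..<n. al / (real (n - k) + 1) * g al k)
          = al / (real (n - (n - 1)) + 1) * g al (n - 1) + (\<Sum>k=1..<n-1. al / (real (n - k) + 1) * g al k)"
        unfolding i by (subst sum.insert) auto
      also have "(\<Sum>k=1..<n-1. al / (real (n - k) + 1) * g al k) = (\<Sum>k=1..<n-1. al / (N - real k + 1) * g al k)"
        by (intro sum.cong refl) (auto simp: N_def of_nat_diff)
      finally show ?thesis using n4 by (simp add: N_def of_nat_diff)
    qed
    have rec2: "(N - 1) * g al (n - 1) = al / N - (\<Sum>k=1..<n-1. al / (N - real k) * g al k)"
      using g_rec[of "n - 1" al] n4 by (simp add: N_def of_nat_diff)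
        (auto intro!: sum.cong simp: of_nat_diff)
    have "N * g al n - r * ((N - 1) * g al (n - 1)) = e 0 - (\<Sum>k=1..<n-1. e k * g al k) - al / 2 * g al (n - 1)"
      unfolding rec1 rec2 e_def
      by (simp add: sum_distrib_left sum_subtractf left_diff_distrib right_diff_distrib mult.assoc)
    also have "(\<Sum>k=1..<n-1. e k * g al k) = e 1 * g al 1 + e 2 * g al 2 + (\<Sum>k=3..<n-1. e k * g al k)"
    proof -
      have i: "{1..<n-1} = insert 1 (insert 2 {3..<n-1})" using n4 by auto
      show ?thesis unfolding i by simp
    qed
    finally have main: "N * g al n = (r * (N - 1) - al / 2) * g al (n - 1) + (e 0 - e 1 * g al 1 - e 2 * g al 2)
       + (\<Sum>k=3..<n-1. - e k * g al k)"
      by (simp add: sum_negf algebra_simps)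
    have e: "e k = al * (3 - real k) / ((N - 2) * (N - real k) * (N - real k + 1))" if "k < n" for k
    proof -
      have "N - real k > 0" using that by (simp add: N_def)
      then show ?thesis using N unfolding e_def r_def by (simp add: divide_simps) (simp add: algebra_simps)
    qed
    have t1: "(\<Sum>k=3..<n-1. - e k * g al k) \<ge> 0"
    proof (intro sum_nonneg mult_nonneg_nonneg)
      fix k assume k: "k \<in> {3..<n-1}"
      then have "k < n" unfolding atLeastLessThan_iff by linarith
      then have "N - real k > 0" by (simp add: N_def)
      moreover have "e k = al * (3 - real k) / ((N - 2) * (N - real k) * (N - real k + 1))" 
      proof (rule e)
        show "k < n" using k unfolding atLeastLessThan_iff by linarith
      qed
      ultimately have "e k \<le> 0" using k al N by (auto intro!: divide_nonpos_pos mult_nonneg_nonpos)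
      then show "- e k \<ge> 0" by simp
      show "g al k \<ge> 0" using k less.IH[of k] by auto
    qed
    have "(N - 3) / (N - 2) * (N - 1) \<ge> 3/2" using N
    proof -
      have "3 * (N - 2) \<le> 2 * ((N - 3) * (N - 1))"
      proof -
        have "0 \<le> (N - 4) * (2 * N - 3)" using N by (intro mult_nonneg_nonneg) auto
        then show ?thesis by (simp add: algebra_simps)
      qed
      then show ?thesis using N by (simp add: divide_simps mult.commute)
    qed
    then have "r * (N - 1) - al / 2 \<ge> 0" using al by (simp add: r_def)
    then have t2: "(r * (N - 1) - al / 2) * g al (n - 1) \<ge> 0"
      using less.IH[of "n - 1"] n4 by (intro mult_nonneg_nonneg) auto
    have t3: "e 0 - e 1 * g al 1 - e 2 * g al 2 \<ge> 0"
    proof -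
      have e0: "e 0 = al * 3 / ((N - 2) * N * (N + 1))" using e[of 0] n4 by simp
      have e1: "e 1 = al * 2 / ((N - 2) * (N - 1) * N)" using e[of 1] n4 by simp
      have e2: "e 2 = al * 1 / ((N - 2) * (N - 2) * (N - 1))" using e[of 2] n4 by simp
      have g2: "g al 2 \<le> - (1/6 + (al - 2) / 3)"
      proof -
        have "(al - 2) * (al - 2) \<ge> 0" by simp
        then have "al * al \<ge> 4 * al - 4" by (simp add: algebra_simps)
        then show ?thesis unfolding g_2 power2_eq_square by (simp add: field_simps)
      qed
      define p where "p = 3 * (N - 1) * (N - 2) - al * (N + 1) * (N - 2) + (1/6 + (al - 2) / 3) * N * (N + 1)"
      have "p \<ge> 0"
      proof -
        \<comment> \<open>Shifting the ranges of \<open>N\<close> and \<open>al\<close> to start at 0 makes every coefficient of \<open>p\<close> positive.\<close>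
        define m where "m = N - 4"
        define u where "u = 58/25 - al"
        have m: "m \<ge> 0" and u: "u \<ge> 0" using N al by (auto simp: m_def u_def)
        have "p = 4/15 + 61/50 * m + 143/150 * (m * m) + u * (10/3 + 4 * m + 2/3 * (m * m))"
          unfolding p_def m_def u_def by (simp add: field_simps)
        then show ?thesis using m u by simp
      qed
      have "e 0 - e 1 * g al 1 - e 2 * g al 2 \<ge> e 0 - e 1 * (al / 2) + e 2 * (1/6 + (al - 2) / 3)"
      proof -
        have "e 2 \<ge> 0" unfolding e2 using N al by simp
        from mult_left_mono[OF g2 this] have "e 2 * g al 2 \<le> - (e 2 * (1/6 + (al - 2) / 3))" by (simp only: mult_minus_right)
        then show ?thesis unfolding g_1 by linarith
      qed
      also have "e 0 - e 1 * (al / 2) + e 2 * (1/6 + (al - 2) / 3) = al * p / ((N - 2) * (N - 2) * (N - 1) * N * (N + 1))"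
      proof -
        have nz: "N - 2 \<noteq> 0" "N - 1 \<noteq> 0" "N \<noteq> 0" "N + 1 \<noteq> 0" using N by auto
        define q where "q = 1/6 + (al - 2) / 3"
        have p: "p = 3 * (N - 1) * (N - 2) - al * (N + 1) * (N - 2) + q * N * (N + 1)" by (simp add: p_def q_def)
        show ?thesis unfolding e0 e1 e2 q_def[symmetric] p using nz
          by (simp add: divide_simps) (simp add: algebra_simps)
      qed
      also have "\<dots> \<ge> 0" using \<open>p \<ge> 0\<close> al N by (intro divide_nonneg_nonneg mult_nonneg_nonneg) auto
      finally show ?thesis .
    qed
    have "N * g al n \<ge> 0" unfolding main using t1 t2 t3 by linarith
    then show ?thesis using N by (simp add: zero_le_mult_iff)
  qed
qed

text \<open>
  All terms of the recursion with \<open>k \<ge> 3\<close> are dropped.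
\<close>

lemma g_upper:
  assumes al: "2 \<le> al" "al \<le> 58/25" and n: "n \<ge> 3"
  shows "real n * g al n \<le> al / (real n + 1) - al\<^sup>2 / (2 * real n) - al * g al 2 / (real n - 1)"
proof -
  have i: "{1..<n} = insert 1 (insert 2 {3..<n})" using n by auto
  have "(\<Sum>k=1..<n. al / (real (n - k) + 1) * g al k) = al / (real (n - 1) + 1) * g al 1
     + al / (real (n - 2) + 1) * g al 2 + (\<Sum>k=3..<n. al / (real (n - k) + 1) * g al k)"
    unfolding i by simp
  moreover have "(\<Sum>k=3..<n. al / (real (n - k) + 1) * g al k) \<ge> 0"
    using al by (intro sum_nonneg mult_nonneg_nonneg g_nonneg) auto
  moreover have "al / (real (n - 1) + 1) * g al 1 = al\<^sup>2 / (2 * real n)"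
    using n by (simp add: g_1[unfolded One_nat_def] power2_eq_square of_nat_diff)
  moreover have "al / (real (n - 2) + 1) * g al 2 = al * g al 2 / (real n - 1)"
    using n by (simp add: of_nat_diff)
  ultimately show ?thesis using g_rec[of n al] n by simp
qed

section \<open>Interpolation between (al, 0) and (0, 1)\<close>

text \<open>
  On the segment of parameters \<open>(al * th, lam)\<close> with \<open>th = 1 - lam\<close>, the coefficients \<open>V n\<close> differ
  from the chord \<open>th * g al n\<close> (plus \<open>lam\<close> when \<open>n = 1\<close>) by \<open>lam * th * Q n\<close>. At the end \<open>th = 0\<close>
  of the segment \<open>Q\<close> has the closed form \<open>Q1\<close>, and \<open>K\<close> measures the deviation from it. The
  weights \<open>s n k\<close> are those of \<open>nu_diff_rec\<close>. The parameter \<open>x\<close> is the amount by which \<open>al / 2\<close>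
  exceeds 1; it is the source of all negative terms below.
\<close>

locale interpolation =
  fixes al lam :: real
  assumes al: "9/4 \<le> al" "al \<le> 58/25" and lam: "0 < lam" "lam < 1"
begin

definition th :: real where "th = 1 - lam"
definition x :: real where "x = al / 2 - 1"
definition V :: "nat \<Rightarrow> real" where "V n = - nu (al * th) lam n"
definition Q :: "nat \<Rightarrow> real" where "Q n = (V n - th * g al n) / (lam * th)"
definition Q1 :: "nat \<Rightarrow> real" where "Q1 n = (1 - 2 * al / (real n + 1)) / (real n * (real n - 1)) - g al n"
definition K :: "nat \<Rightarrow> real" where "K n = (Q n - Q1 n) / th"
definition s :: "nat \<Rightarrow> nat \<Rightarrow> real" where "s n k = 1 / ((real (n - k) + 1) * (real (n - k) + 2))"

lemma th: "0 < th" "th < 1" using lam by (auto simp: th_def)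
lemma x: "1/8 \<le> x" "x \<le> 4/25" using al by (auto simp: x_def)
lemma al_x: "al = 2 + 2 * x" by (simp add: x_def)

lemma V_1: "V 1 = th * (al / 2) + lam"
  using nu_diff_rec[of 0 "al * th" lam] by (simp add: V_def)

lemma V_eq: "V n = th * g al n + lam * th * Q n"
  using th lam by (simp add: Q_def)

lemma Q_eq: "Q n = Q1 n + th * K n"
  using th by (simp add: K_def)

lemma split_sum: "(n::nat) \<ge> 2 \<Longrightarrow> (\<Sum>k<n. f k) = f 0 + f 1 + (\<Sum>k=2..<n. f k :: real)"
proof -
  assume "2 \<le> n"
  then have "{..<n} = insert 0 (insert 1 {2..<n})" by auto
  then show ?thesis by simp
qed

lemma V_rec:
  assumes "n \<ge> 2"
  shows "real (Suc n) * V (Suc n) = (real n - 1 - x * th) * V n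
    + al * th * ((th * (al / 2) + lam) * s n 1 + (\<Sum>k=2..<n. V k * s n k)) - al * th * s n 0"
proof -
  have "real (Suc n) * nu (al * th) lam (Suc n) = (real n - al * th / 2 - lam) * nu (al * th) lam n
     + al * th * (\<Sum>k<n. nu (al * th) lam k * s n k)"
    unfolding nu_diff_rec s_def by simp
  also have "(\<Sum>k<n. nu (al * th) lam k * s n k) = s n 0 - V 1 * s n 1 - (\<Sum>k=2..<n. V k * s n k)"
    using assms by (subst split_sum) (auto simp: V_def sum_negf)
  also have "real n - al * th / 2 - lam = real n - 1 - x * th" by (simp add: x_def th_def algebra_simps)
  finally show ?thesis unfolding V_1 by (simp add: V_def algebra_simps)
qed

lemma g_diff_rec:
  assumes "n \<ge> 2"
  shows "real (Suc n) * g al (Suc n) = (real n - 1 - x) * g al n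
    + al * (al / 2 * s n 1 + (\<Sum>k=2..<n. g al k * s n k)) - al * s n 0"
proof -
  have "real (Suc n) * nu al 0 (Suc n) = (real n - al / 2 - 0) * nu al 0 n
     + al * (\<Sum>k<n. nu al 0 k * s n k)"
    unfolding nu_diff_rec s_def by simp
  also have "(\<Sum>k<n. nu al 0 k * s n k) = s n 0 - g al 1 * s n 1 - (\<Sum>k=2..<n. g al k * s n k)"
    using assms by (subst split_sum) (auto simp: g_def sum_negf)
  also have "real n - al / 2 - 0 = real n - 1 - x" by (simp add: x_def)
  finally show ?thesis unfolding g_1 by (simp add: g_def algebra_simps)
qed

lemma Q1_rec:
  assumes "n \<ge> 2"
  shows "real (Suc n) * Q1 (Suc n) = (real n - 1) * Q1 n + x * g al n
    - al * (al / 2 * s n 1 + (\<Sum>k=2..<n. g al k * s n k)) + al * s n 1"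
proof -
  define N where "N = real n"
  have N: "N \<ge> 2" using assms by (simp add: N_def)
  have s1: "s n 1 = 1 / (N * (N + 1))" and s0: "s n 0 = 1 / ((N + 1) * (N + 2))"
    using assms by (simp_all add: s_def N_def of_nat_diff)
  have a: "(N + 1) * ((1 - 2 * al / (N + 2)) / ((N + 1) * N)) = (N - 1) * ((1 - 2 * al / (N + 1)) / (N * (N - 1)))
      + al * (1 / (N * (N + 1))) - al * (1 / ((N + 1) * (N + 2)))"
    using N by (simp add: divide_simps) (simp add: algebra_simps)
  show ?thesis using g_diff_rec[OF assms] a unfolding s1 s0
    by (simp add: Q1_def N_def[symmetric] algebra_simps)
qed

lemma Q_rec:
  assumes "n \<ge> 2"
  shows "real (Suc n) * Q (Suc n) = (real n - 1 - x * th) * Q n + al * th * (\<Sum>k=2..<n. Q k * s n k) + x * g al n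
    - al * (al / 2 * s n 1 + (\<Sum>k=2..<n. g al k * s n k)) + al * s n 1"
proof -
  define SG where "SG = (\<Sum>k=2..<n. g al k * s n k)"
  define SQ where "SQ = (\<Sum>k=2..<n. Q k * s n k)"
  have SV: "(\<Sum>k=2..<n. V k * s n k) = th * SG + lam * th * SQ"
    unfolding SG_def SQ_def V_eq by (simp add: sum_distrib_left sum.distrib algebra_simps)
  have 1: "real (Suc n) * (th * g al (Suc n) + lam * th * Q (Suc n)) = (real n - 1 - x * th) * (th * g al n + lam * th * Q n)
    + al * th * ((th * (al / 2) + lam) * s n 1 + (th * SG + lam * th * SQ)) - al * th * s n 0"
    using V_rec[OF assms] unfolding SV V_eq[of "Suc n"] V_eq[of n] .
  have 2: "real (Suc n) * g al (Suc n) = (real n - 1 - x) * g al n + al * (al / 2 * s n 1 + SG) - al * s n 0"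
    using g_diff_rec[OF assms] unfolding SG_def .
  have "lam * th * (real (Suc n) * Q (Suc n)) = real (Suc n) * (th * g al (Suc n) + lam * th * Q (Suc n))
     - th * (real (Suc n) * g al (Suc n))" by (simp add: algebra_simps)
  also have "\<dots> = lam * th * ((real n - 1 - x * th) * Q n + al * th * SQ + x * g al n
    - al * (al / 2 * s n 1 + SG) + al * s n 1)"
    unfolding 1 2 by (simp add: th_def add_divide_distrib diff_divide_distrib algebra_simps)
  finally show ?thesis using lam th unfolding SG_def SQ_def by simp
qed

text \<open>
  The inhomogeneous parts of the recursions for \<open>Q\<close> and \<open>Q1\<close> agree, so they cancel here. What
  remains is positive apart from \<open>- x * Q1 n\<close> and the contribution of the negative term \<open>Q 3\<close>.
\<close>

lemma K_rec:
  assumes "n \<ge> 2"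
  shows "real (Suc n) * K (Suc n) = (real n - 1 - x * th) * K n - x * Q1 n + al * (\<Sum>k=2..<n. Q k * s n k)"
proof -
  have "th * (real (Suc n) * K (Suc n)) = real (Suc n) * Q (Suc n) - real (Suc n) * Q1 (Suc n)"
    by (simp add: Q_eq[of "Suc n"] algebra_simps)
  also have "\<dots> = th * ((real n - 1 - x * th) * K n - x * Q1 n + al * (\<Sum>k=2..<n. Q k * s n k))"
    unfolding Q_rec[OF assms] Q1_rec[OF assms] using Q_eq[of n] by (simp add: algebra_simps)
  finally show ?thesis using th by simp
qed

lemma g_2_x: "g al 2 = - 1/6 - 2/3 * x - x\<^sup>2 / 2"
  by (simp add: g_2 x_def power2_eq_square field_simps)

lemma g_3_x: "g al 3 = (1 + x) * x\<^sup>2 / 6"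
  by (simp add: g_3 x_def power2_eq_square field_simps)

lemma Q1_2: "Q1 2 = x\<^sup>2 / 2"
  unfolding Q1_def g_2_x by (simp add: x_def power2_eq_square field_simps)

lemma Q_2: "Q 2 = x\<^sup>2 / 2"
proof -
  have "2 * V 2 = (1 - al * th / 2 - lam) * V 1 - al * th / 6"
    using nu_diff_rec[of 1 "al * th" lam] by (simp add: V_def numeral_2_eq_2)
  then have "2 * V 2 = - (x * th) * (1 + x * th) - al * th / 6"
    unfolding V_1 by (simp add: x_def th_def algebra_simps)
  then have "2 * (V 2 - th * g al 2) = lam * th * x\<^sup>2"
  proof -
    have "- (X * T) * (1 + X * T) - (2 + 2 * X) * T / 6 - 2 * T * (- 1/6 - 2/3 * X - X\<^sup>2 / 2) = (1 - T) * T * X\<^sup>2" for X T :: real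
      by (simp add: power2_eq_square field_simps)
    from this[of x th] have "2 * V 2 - 2 * th * g al 2 = (1 - th) * th * x\<^sup>2"
      unfolding \<open>2 * V 2 = - (x * th) * (1 + x * th) - al * th / 6\<close> g_2_x al_x[symmetric] .
    then show ?thesis by (simp add: th_def algebra_simps)
  qed
  then show ?thesis using lam th by (simp add: Q_def field_simps)
qed

lemma K_2: "K 2 = 0" by (simp add: K_def Q_2 Q1_2)

lemma K_3: "K 3 = - (x ^ 3) / 6"
  using K_rec[of 2] K_2 Q1_2 by (simp add: power2_eq_square power3_eq_cube numeral_3_eq_3)

lemma Q1_3: "Q1 3 = - x / 6 - (1 + x) * x\<^sup>2 / 6"
  unfolding Q1_def g_3_x by (simp add: x_def power2_eq_square field_simps)

end

context interpolation
begin

text \<open>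
  By \<open>g_upper\<close> the product \<open>n * (n - 1) * Q1 n\<close> is at least \<open>A - al\<^sup>2 / (2 * n)\<close>, and \<open>0.701\<close> and
  \<open>2.6912\<close> bound \<open>A\<close> from below and \<open>al\<^sup>2 / 2\<close> from above on the range of \<open>al\<close>.
\<close>

lemma Q1_lower:
  assumes "n \<ge> 3"
  shows "Q1 n \<ge> (0.701 - 2.6912 / real n) / (real n * (real n - 1))"
proof -
  define N where "N = real n"
  have N: "N \<ge> 3" using assms by (simp add: N_def)
  define A where "A = 1 - al + al\<^sup>2 / 2 + al * g al 2"
  have "N * g al n \<le> al / (N + 1) - al\<^sup>2 / (2 * N) - al * g al 2 / (N - 1)"
    unfolding N_def using al assms by (intro g_upper) auto
  then have "(N - 1) * (N * g al n) \<le> (N - 1) * (al / (N + 1) - al\<^sup>2 / (2 * N) - al * g al 2 / (N - 1))"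
    using N by (intro mult_left_mono) auto
  also have "\<dots> = 1 - 2 * al / (N + 1) - A + al\<^sup>2 / (2 * N)"
  proof -
    have "N + 1 \<noteq> 0" "N \<noteq> 0" "N - 1 \<noteq> 0" using N by auto
    then show ?thesis unfolding A_def power2_eq_square by (simp add: divide_simps) (simp add: algebra_simps)
  qed
  finally have "(N - 1) * (N * g al n) \<le> 1 - 2 * al / (N + 1) - A + al\<^sup>2 / (2 * N)" .
  moreover have "A \<ge> 0.701"
  proof -
    have A: "A = 2/3 + x / 3 - x\<^sup>2 / 3 - x ^ 3"
      unfolding A_def g_2 x_def by (simp add: power2_eq_square power3_eq_cube field_simps)
    \<comment> \<open>This linearizes \<open>x\<^sup>2\<close> from above on the interval to which \<open>x\<close> belongs.\<close>
    have 0: "(x - 1/8) * (4/25 - x) \<ge> 0" using x by (intro mult_nonneg_nonneg) auto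
    moreover have "(x - 1/8) * (4/25 - x) = 57/200 * x - 1/50 - x\<^sup>2" by (simp add: power2_eq_square field_simps)
    ultimately have 1: "x\<^sup>2 \<le> 57/200 * x - 1/50" by linarith
    have "x * x\<^sup>2 \<le> x * (57/200 * x - 1/50)" using 1 x by (intro mult_left_mono) auto
    then have "x ^ 3 \<le> 57/200 * x\<^sup>2 - x / 50" by (simp add: power2_eq_square power3_eq_cube algebra_simps)
    then show ?thesis using 1 x unfolding A by simp
  qed
  moreover have "al\<^sup>2 / (2 * N) \<le> 2.6912 / N"
  proof -
    have "al * al \<le> 58/25 * (58/25)" using al by (intro mult_mono) auto
    then have "al\<^sup>2 / 2 \<le> 2.6912" by (simp add: power2_eq_square)
    then have "(al\<^sup>2 / 2) / N \<le> 2.6912 / N" using N by (intro divide_right_mono) auto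
    then show ?thesis by simp
  qed
  ultimately have "0.701 - 2.6912 / N \<le> 1 - 2 * al / (N + 1) - (N * (N - 1)) * g al n"
    by (simp add: algebra_simps)
  then have "(0.701 - 2.6912 / N) / (N * (N - 1)) \<le> (1 - 2 * al / (N + 1) - (N * (N - 1)) * g al n) / (N * (N - 1))"
    using N by (intro divide_right_mono) auto
  also have "\<dots> = Q1 n" using N unfolding Q1_def N_def[symmetric] by (simp add: diff_divide_distrib)
  finally show ?thesis by (simp add: N_def)
qed

lemma Q1_upper:
  assumes "n \<ge> 3"
  shows "Q1 n \<le> (1 - 4.5 / (real n + 1)) / (real n * (real n - 1))"
proof -
  have "g al n \<ge> 0" using al assms by (intro g_nonneg) auto
  moreover have "4.5 / (real n + 1) \<le> 2 * al / (real n + 1)" using al by (intro divide_right_mono) auto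
  then have "(1 - 2 * al / (real n + 1)) / (real n * (real n - 1)) \<le> (1 - 4.5 / (real n + 1)) / (real n * (real n - 1))"
    using assms by (intro divide_right_mono) auto
  ultimately show ?thesis unfolding Q1_def by linarith
qed

lemma Q_lower:
  assumes "n \<ge> 3" "K n \<ge> - k" "k \<ge> 0"
  shows "Q n \<ge> (0.701 - 2.6912 / real n) / (real n * (real n - 1)) - k"
proof -
  have "th * K n \<ge> th * (- k)" using assms th by (intro mult_left_mono) auto
  moreover have "th * k \<le> 1 * k" using assms th by (intro mult_right_mono) auto
  ultimately show ?thesis using Q1_lower[OF assms(1)] unfolding Q_eq[of n] by simp
qed

text \<open>
  One step of \<open>K_rec\<close> with numerical bounds inserted. The minimum covers both signs of \<open>\<sigma>\<close>, since
  \<open>al\<close> is only known to lie between \<open>2.25\<close> and \<open>2.32\<close>.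
\<close>

lemma K_step:
  assumes "n \<ge> 2" "K n \<ge> - k" "k \<ge> 0" "Q1 n \<le> u" "u \<ge> 0" "(\<Sum>k=2..<n. Q k * s n k) \<ge> \<sigma>"
  shows "real (Suc n) * K (Suc n) \<ge> - ((real n - 1) * k) - 0.16 * u + min (2.25 * \<sigma>) (2.32 * \<sigma>)"
proof -
  have xt: "0 \<le> x * th" "x * th \<le> 1" using x th mult_mono[of x 1 th 1] by auto
  have "(real n - 1 - x * th) * (- k) \<le> (real n - 1 - x * th) * K n"
    using assms xt by (intro mult_left_mono) auto
  moreover have "(real n - 1 - x * th) * k \<le> (real n - 1) * k" using assms xt by (intro mult_right_mono) auto
  ultimately have 1: "(real n - 1 - x * th) * K n \<ge> - ((real n - 1) * k)" by simp
  have "x * Q1 n \<le> x * u" using assms x by (intro mult_left_mono) auto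
  also have "\<dots> \<le> 0.16 * u" using assms x by (intro mult_right_mono) auto
  finally have 2: "x * Q1 n \<le> 0.16 * u" .
  have "al * (\<Sum>k=2..<n. Q k * s n k) \<ge> al * \<sigma>" using assms al by (intro mult_left_mono) auto
  moreover have "al * \<sigma> \<ge> min (2.25 * \<sigma>) (2.32 * \<sigma>)"
  proof (cases "\<sigma> \<ge> 0")
    case True
    then have "2.25 * \<sigma> \<le> al * \<sigma>" using al by (intro mult_right_mono) auto
    then show ?thesis by simp
  next
    case False
    then have "2.32 * \<sigma> \<le> al * \<sigma>" using al by (intro mult_right_mono_neg) auto
    then show ?thesis by simp
  qed
  ultimately show ?thesis using K_rec[OF assms(1)] 1 2 by linarith
qed

lemma Q_2_lower: "Q 2 \<ge> 0.0078"
proof -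
  have "1/8 * (1/8) \<le> x * x" using x by (intro mult_mono) auto
  then show ?thesis unfolding Q_2 power2_eq_square by simp
qed

lemma Q_3_lower: "Q 3 \<ge> - 0.0324"
proof -
  have x2: "x\<^sup>2 \<le> 16/625" using x mult_mono[of x "4/25" x "4/25"] by (simp add: power2_eq_square)
  have x3: "x ^ 3 \<le> 64/15625" "x ^ 3 \<ge> 0" using x power_mono[of x "4/25" 3] by (simp_all add: power_divide)
  have "th * x ^ 3 \<le> 1 * x ^ 3" using th x3 by (intro mult_right_mono) auto
  moreover have "Q 3 = - x / 6 - x\<^sup>2 / 6 - x ^ 3 / 6 - th * x ^ 3 / 6"
    unfolding Q_eq[of 3] Q1_3 K_3 by (simp add: power2_eq_square power3_eq_cube field_simps)
  ultimately have "Q 3 \<ge> - (81 / 2500)" using x x2 x3 by linarith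
  then show ?thesis by simp
qed

lemma K_4_nonneg: "K 4 \<ge> 0"
proof -
  have "{2..<3} = {2::nat}" by auto
  then have "4 * K 4 = (2 - x * th) * K 3 - x * Q1 3 + al * (Q 2 * s 3 2)"
    using K_rec[of 3] by simp
  also have "s 3 2 = 1/6" by (simp add: s_def)
  finally have k: "4 * K 4 = - (2 - x * th) * (x ^ 3 / 6) + x * (x / 6 + (1 + x) * x\<^sup>2 / 6) + al * (x\<^sup>2 / 12)"
    unfolding K_3 Q1_3 Q_2 by (simp add: diff_divide_distrib add_divide_distrib algebra_simps)
  have x3: "x ^ 3 \<ge> 0" and x2: "x\<^sup>2 \<ge> 0" using x by auto
  have "(2 - x * th) * (x ^ 3 / 6) \<le> 2 * (x ^ 3 / 6)"
    using x x3 th by (intro mult_right_mono) auto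
  moreover have "x * x\<^sup>2 \<le> 1 * x\<^sup>2" using x by (intro mult_right_mono) auto
  then have "x ^ 3 \<le> x\<^sup>2" by (simp add: power2_eq_square power3_eq_cube)
  moreover have "x * (x / 6 + (1 + x) * x\<^sup>2 / 6) \<ge> x\<^sup>2 / 6"
    using x by (simp add: power2_eq_square distrib_left)
  moreover have "al * (x\<^sup>2 / 12) \<ge> 2 * (x\<^sup>2 / 12)" using al x2 by (intro mult_right_mono) auto
  ultimately show ?thesis using k by linarith
qed

text \<open>
  The recursion is followed numerically until the negative influence of \<open>Q 3\<close> has died out. Each
  bound for \<open>K\<close> comes from \<open>K_step\<close>, and each bound for \<open>Q\<close> from the preceding bound for \<open>K\<close>.
\<close>

lemma Q_4_lower: "Q 4 \<ge> 0.00235" using Q_lower[of 4 0] K_4_nonneg by simp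

lemma K_5_lower: "K 5 \<ge> - 0.0025"
proof -
  have "{2..<4} = {2, 3::nat}" by auto
  then have "(\<Sum>k=2..<4. Q k * s 4 k) \<ge> - 0.00475" using Q_2_lower Q_3_lower by (simp add: s_def)
  from K_step[OF _ _ _ _ _ this, of 0 "(1 - 4.5 / 5) / 12"] show ?thesis
    using K_4_nonneg Q1_upper[of 4] by simp
qed

lemma Q_5_lower: "Q 5 \<ge> 0.005638" using Q_lower[OF _ K_5_lower] by simp

lemma K_6_lower: "K 6 \<ge> - 0.00275"
proof -
  have "{2..<5} = {2, 3, 4::nat}" by auto
  then have "(\<Sum>k=2..<5. Q k * s 5 k) \<ge> - 0.00192"
    using Q_2_lower Q_3_lower Q_4_lower by (simp add: s_def)
  from K_step[OF _ K_5_lower _ _ _ this, of "(1 - 4.5 / 6) / 20"] show ?thesis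
    using Q1_upper[of 5] by simp
qed

lemma Q_6_lower: "Q 6 \<ge> 0.00566" using Q_lower[OF _ K_6_lower] by simp

lemma K_7_lower: "K 7 \<ge> - 0.00232"
proof -
  have "{2..<6} = {2, 3, 4, 5::nat}" by auto
  then have "(\<Sum>k=2..<6. Q k * s 6 k) \<ge> - 0.00023"
    using Q_2_lower Q_3_lower Q_4_lower Q_5_lower by (simp add: s_def)
  from K_step[OF _ K_6_lower _ _ _ this, of "(1 - 4.5 / 7) / 30"] show ?thesis
    using Q1_upper[of 6] by simp
qed

lemma Q_7_lower: "Q 7 \<ge> 0.0052" using Q_lower[OF _ K_7_lower] by simp

lemma K_8_lower: "K 8 \<ge> - 0.00178"
proof -
  have "{2..<7} = {2, 3, 4, 5, 6::nat}" by auto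
  then have "(\<Sum>k=2..<7. Q k * s 7 k) \<ge> 0.00063"
    using Q_2_lower Q_3_lower Q_4_lower Q_5_lower Q_6_lower by (simp add: s_def)
  from K_step[OF _ K_7_lower _ _ _ this, of "(1 - 4.5 / 8) / 42"] show ?thesis
    using Q1_upper[of 7] by simp
qed

lemma Q_8_lower: "Q 8 \<ge> 0.0047" using Q_lower[OF _ K_8_lower] by simp

lemma K_9_lower: "K 9 \<ge> - 0.00128"
proof -
  have "{2..<8} = {2, 3, 4, 5, 6, 7::nat}" by auto
  then have "(\<Sum>k=2..<8. Q k * s 8 k) \<ge> 0.00106"
    using Q_2_lower Q_3_lower Q_4_lower Q_5_lower Q_6_lower Q_7_lower by (simp add: s_def)
  from K_step[OF _ K_8_lower _ _ _ this, of "(1 - 4.5 / 9) / 56"] show ?thesis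
    using Q1_upper[of 8] by simp
qed

lemma Q_9_lower: "Q 9 \<ge> 0.0043" using Q_lower[OF _ K_9_lower] by simp

lemma K_10_lower: "K 10 \<ge> - 0.00087"
proof -
  have "{2..<9} = {2, 3, 4, 5, 6, 7, 8::nat}" by auto
  then have "(\<Sum>k=2..<9. Q k * s 9 k) \<ge> 0.00127"
    using Q_2_lower Q_3_lower Q_4_lower Q_5_lower Q_6_lower Q_7_lower Q_8_lower by (simp add: s_def)
  from K_step[OF _ K_9_lower _ _ _ this, of "(1 - 4.5 / 10) / 72"] show ?thesis
    using Q1_upper[of 9] by simp
qed

lemma K_11_lower: "K 11 \<ge> - 0.0006"
proof -
  have "{2..<10} = {2, 3, 4, 5, 6, 7, 8, 9::nat}" by auto
  then have "(\<Sum>k=2..<10. Q k * s 10 k) \<ge> 0.0012"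
    using Q_2_lower Q_3_lower Q_4_lower Q_5_lower Q_6_lower Q_7_lower Q_8_lower Q_9_lower by (simp add: s_def)
  from K_step[OF _ K_10_lower _ _ _ this, of "(1 - 4.5 / 11) / 90"] show ?thesis
    using Q1_upper[of 10] by simp
qed

text \<open>
  From \<open>n = 12\<close> on the sum in \<open>K_rec\<close> outweighs \<open>x * Q1 n\<close>, so \<open>n * (n - 1) * K n\<close> no longer
  decreases below the level \<open>-0.1\<close> that the initial values respect. In the sum it is enough to keep
  \<open>Q 3\<close>, the only negative term, and the last three terms, whose weights 1/6, 1/12 and 1/20
  do not decay with \<open>n\<close>.
\<close>

lemma K_lower_7:
  assumes "n \<ge> 7"
  shows "K n \<ge> - (0.1 / (real n * (real n - 1)))"
  using assms
proof (induction n rule: less_induct)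
  case (less n)
  consider "n = 7" | "n = 8" | "n = 9" | "n = 10" | "n = 11" | "n \<ge> 12" using less.prems by linarith
  then show ?case
  proof cases
    case 6
    then obtain m where m: "n = Suc m" "m \<ge> 11" by (cases n) auto
    define M where "M = real m"
    have M: "M \<ge> 11" using m by (simp add: M_def)
    have Qk: "Q k \<ge> (0.601 - 2.6912 / (M - 3)) / ((M - 1) * (M - 2))" if k: "m - 3 \<le> k" "k < m" for k
    proof -
      have k7: "k \<ge> 7" using k m by linarith
      have kM: "M - 3 \<le> real k" "real k \<le> M - 1" using k m by (auto simp: M_def of_nat_diff)
      have "K k \<ge> - (0.1 / (real k * (real k - 1)))" using less.IH[of k] k m k7 by simp
      then have "Q k \<ge> (0.701 - 2.6912 / real k) / (real k * (real k - 1)) - 0.1 / (real k * (real k - 1))"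
        using k7 by (intro Q_lower) auto
      also have "(0.701 - 2.6912 / real k) / (real k * (real k - 1)) - 0.1 / (real k * (real k - 1))
        = (0.601 - 2.6912 / real k) / (real k * (real k - 1))" 
        using diff_divide_distrib[of "0.701 - 2.6912 / real k" "0.1" "real k * (real k - 1)"] by simp
      finally have 1: "Q k \<ge> (0.601 - 2.6912 / real k) / (real k * (real k - 1))" .
      have "2.6912 / real k \<le> 2.6912 / (M - 3)" using kM M by (intro divide_left_mono) auto
      moreover have "2.6912 / (M - 3) \<le> 2.6912 / 8" using M by (intro divide_left_mono) auto
      moreover have "real k * (real k - 1) \<le> (M - 1) * (M - 2)" using kM M by (intro mult_mono) auto
      ultimately have "(0.601 - 2.6912 / (M - 3)) / ((M - 1) * (M - 2)) \<le> (0.601 - 2.6912 / real k) / (real k * (real k - 1))"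
        using k7 by (intro frac_le) auto
      with 1 show ?thesis by linarith
    qed
    have Qnn: "Q k \<ge> 0" if k: "k \<in> {2..<m}" "k \<noteq> 3" for k
    proof -
      consider "k = 2" | "k = 4" | "k = 5" | "k = 6" | "k \<ge> 7"
        using k unfolding atLeastLessThan_iff by linarith
      then show ?thesis
      proof cases
        case 5
        have "K k \<ge> - (0.1 / (real k * (real k - 1)))" using less.IH[of k] k m 5 by simp
        then have "Q k \<ge> (0.701 - 2.6912 / real k) / (real k * (real k - 1)) - 0.1 / (real k * (real k - 1))"
          using 5 by (intro Q_lower) auto
        moreover have "2.6912 / real k \<le> 2.6912 / 7" using 5 by (intro divide_left_mono) auto
        then have "0.1 / (real k * (real k - 1)) \<le> (0.701 - 2.6912 / real k) / (real k * (real k - 1))"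
          using 5 by (intro divide_right_mono) auto
        ultimately show ?thesis by linarith
      qed (use Q_2_lower Q_4_lower Q_5_lower Q_6_lower in auto)
    qed
    define q where "q = (0.601 - 2.6912 / (M - 3)) / ((M - 1) * (M - 2))"
    define \<sigma> where "\<sigma> = (- 0.0324 + 0.3 * (0.601 - 2.6912 / (M - 3))) / ((M - 1) * (M - 2))"
    have sum: "(\<Sum>k=2..<m. Q k * s m k) \<ge> \<sigma>"
    proof -
      have "\<sigma> = - 0.0324 / ((M - 1) * (M - 2)) + (1/6 + 1/12 + 1/20) * q"
      proof -
        have "(A + 0.3 * B) / D = A / D + (1/6 + 1/12 + 1/20) * (B / D)" for A B D :: real
          by (simp add: add_divide_distrib)
        then show ?thesis unfolding \<sigma>_def q_def .
      qed
      also have "\<dots> \<le> Q 3 * s m 3 + Q (m-1) * s m (m-1) + Q (m-2) * s m (m-2) + Q (m-3) * s m (m-3)"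
      proof -
        have s3: "s m 3 = 1 / ((M - 1) * (M - 2))" using m by (simp add: s_def M_def of_nat_diff algebra_simps)
        have "s m 3 \<ge> 0" using M unfolding s3 by simp
        from mult_right_mono[OF Q_3_lower this] have "Q 3 * s m 3 \<ge> - 0.0324 / ((M - 1) * (M - 2))" unfolding s3 by simp
        moreover have v: "s m (m-1) = 1/6" "s m (m-2) = 1/12" "s m (m-3) = 1/20" using m by (simp_all add: s_def)
        have q: "Q (m-1) \<ge> q" "Q (m-2) \<ge> q" "Q (m-3) \<ge> q"
          unfolding q_def by (rule Qk; use m in linarith)+
        have "(1/6 + 1/12 + 1/20) * q \<le> Q (m-1) * s m (m-1) + Q (m-2) * s m (m-2) + Q (m-3) * s m (m-3)"
          unfolding v using q by simp
        ultimately show ?thesis by linarith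
      qed
      also have "\<dots> = (\<Sum>k\<in>{3, m-1, m-2, m-3}. Q k * s m k)"
      proof -
        have "3 \<noteq> m - 1" "3 \<noteq> m - 2" "3 \<noteq> m - 3" "m - 1 \<noteq> m - 2" "m - 1 \<noteq> m - 3" "m - 2 \<noteq> m - 3" using m by auto
        then show ?thesis by simp
      qed
      also have "\<dots> \<le> (\<Sum>k=2..<m. Q k * s m k)"
        using m by (intro sum_mono2 mult_nonneg_nonneg Qnn) (auto simp: s_def)
      finally show ?thesis .
    qed
    define u where "u = (1 - 4.5 / (M + 1)) / (M * (M - 1))"
    have u: "Q1 m \<le> u" "u \<ge> 0"
      using Q1_upper[of m] m M by (auto simp: u_def M_def divide_simps)
    have Km: "K m \<ge> - (0.1 / (M * (M - 1)))" using less.IH[of m] m by (simp add: M_def)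
    have key: "2.25 * \<sigma> \<ge> 0.16 * u"
    proof -
      define r where "r = 1 / (M - 3)"
      have "0 < r" "r \<le> 1/8" using M by (auto simp: r_def divide_simps)
      have "4.5 / (M + 1) \<ge> 3 * r" using M by (simp add: r_def divide_simps)
      have "0.16 * u = 0.16 * (1 - 4.5 / (M + 1)) / (M * (M - 1))" by (simp add: u_def)
      also have "\<dots> \<le> 2.25 * (0.1479 - 0.80736 * r) / ((M - 1) * (M - 2))"
      proof (rule frac_le)
        show "0.16 * (1 - 4.5 / (M + 1)) \<le> 2.25 * (0.1479 - 0.80736 * r)"
        proof -
          have "0.16 * (1 - y) \<le> 2.25 * (0.1479 - 0.80736 * r)" if "y \<ge> 3 * r" for y
            using that \<open>r \<le> 1/8\<close> by simp
          then show ?thesis using \<open>4.5 / (M + 1) \<ge> 3 * r\<close> .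
        qed
        show "0 \<le> 2.25 * (0.1479 - 0.80736 * r)" using \<open>r \<le> 1/8\<close> by simp
        show "(M - 1) * (M - 2) \<le> M * (M - 1)" using M by (simp add: algebra_simps)
      qed (use M in auto)
      also have "2.25 * (0.1479 - 0.80736 * r) / ((M - 1) * (M - 2)) = 2.25 * \<sigma>"
      proof -
        have "2.6912 / (M - 3) = 2.6912 * r" by (simp add: r_def)
        moreover have "0.1479 - 0.80736 * r = - 0.0324 + 0.3 * (0.601 - 2.6912 * r)" by (simp add: field_simps)
        ultimately show ?thesis unfolding \<sigma>_def by (simp only: times_divide_eq_right)
      qed
      finally show ?thesis .
    qed
    have "\<sigma> \<ge> 0" using key u by simp
    have "real (Suc m) * K (Suc m) \<ge> - ((M - 1) * (0.1 / (M * (M - 1)))) - 0.16 * u + min (2.25 * \<sigma>) (2.32 * \<sigma>)"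
      unfolding M_def by (rule K_step) (use m u sum Km M in \<open>auto simp: M_def\<close>)
    then have "(M + 1) * K n \<ge> - (0.1 / M)" using key \<open>\<sigma> \<ge> 0\<close> M unfolding m(1) by (simp add: M_def add.commute)
    then have le: "- (0.1 / M) \<le> K n * (M + 1)" by (simp only: mult.commute)
    have "M + 1 > 0" using M by simp
    then have "- (0.1 / M) / (M + 1) \<le> K n" using le by (simp only: pos_divide_le_eq)
    moreover have "real n = M + 1" using m(1) by (simp add: M_def)
    ultimately show ?thesis by (simp add: mult_ac)
  qed (use K_7_lower K_8_lower K_9_lower K_10_lower K_11_lower in simp_all)
qed

end

context interpolation
begin

lemma Q_nonneg: "n \<ge> 4 \<Longrightarrow> Q n \<ge> 0"
proof -
  assume "n \<ge> 4"
  then consider "n = 4" | "n = 5" | "n = 6" | "n \<ge> 7" by linarith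
  then show ?thesis
  proof cases
    case 4
    then have "Q n \<ge> (0.701 - 2.6912 / real n) / (real n * (real n - 1)) - 0.1 / (real n * (real n - 1))"
      by (intro Q_lower K_lower_7) auto
    moreover have "2.6912 / real n \<le> 2.6912 / 7" using 4 by (intro divide_left_mono) auto
    then have "0.1 / (real n * (real n - 1)) \<le> (0.701 - 2.6912 / real n) / (real n * (real n - 1))"
      using 4 by (intro divide_right_mono) auto
    ultimately show ?thesis by linarith
  qed (use Q_4_lower Q_5_lower Q_6_lower in auto)
qed

text \<open>
  The series of coefficients \<open>Q\<close> is nonnegative apart from the term \<open>Q 3 * t\<^sup>2 / 2\<close>, which the term
  with \<open>Q 5\<close> controls.
\<close>

lemma dens_interpolation:
  assumes t: "t \<ge> 0"
  shows "dens (al * th) lam t \<ge> th * dens al 0 t + lam - 8/9 * (lam * th)"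
proof -
  define c where "c = (\<lambda>n. (- nu (al * th) lam (Suc n) * t ^ n / fact n) - th * (- nu al 0 (Suc n) * t ^ n / fact n))"
  have c: "c sums (dens (al * th) lam t - th * dens al 0 t)"
    unfolding c_def by (intro sums_diff sums_mult dens_sums)
  have c0: "c 0 = lam"
  proof -
    have "c 0 = V 1 - th * g al 1" by (simp add: c_def V_def g_def)
    then show ?thesis unfolding V_1 g_1 by simp
  qed
  have cn: "c n = lam * th * Q (Suc n) * t ^ n / fact n" for n
  proof -
    have "c n = (V (Suc n) - th * g al (Suc n)) * t ^ n / fact n"
      by (simp add: c_def V_def g_def diff_divide_distrib algebra_simps)
    then show ?thesis unfolding V_eq[of "Suc n"] by simp
  qed
  have lt: "lam * th > 0" using lam th by simp
  have "(\<Sum>n<5. c n) \<le> suminf c"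
  proof (rule sum_le_suminf)
    show "summable c" using c by (rule sums_summable)
    fix n :: nat assume "n \<in> - {..<5}"
    then have "Q (Suc n) \<ge> 0" by (intro Q_nonneg) auto
    then show "0 \<le> c n" unfolding cn using lam th t by (intro divide_nonneg_nonneg mult_nonneg_nonneg) auto
  qed auto
  also have "suminf c = dens (al * th) lam t - th * dens al 0 t" using c by (simp add: sums_iff)
  finally have 1: "(\<Sum>n<5. c n) \<le> dens (al * th) lam t - th * dens al 0 t" .
  have "{..<5} = {0, 1, 2, 3, 4::nat}" by auto
  then have "(\<Sum>n<5. c n) = c 0 + c 1 + c 2 + c 3 + c 4" by simp
  also have "\<dots> = lam + lam * th * (Q 2 * t + Q 3 * t\<^sup>2 / 2 + Q 4 * t ^ 3 / 6 + Q 5 * t ^ 4 / 24)"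
    unfolding c0 by (simp add: cn fact_numeral numeral_2_eq_2[symmetric] field_simps)
  also have "\<dots> \<ge> lam + lam * th * (- 8/9)"
  proof -
    have "Q 2 * t \<ge> 0" "Q 4 * t ^ 3 / 6 \<ge> 0" using Q_2_lower Q_4_lower t by auto
    moreover have "Q 3 * t\<^sup>2 \<ge> - 0.0324 * t\<^sup>2" using Q_3_lower by (intro mult_right_mono) auto
    moreover have "Q 5 * t ^ 4 \<ge> 0.0048 * t ^ 4" using Q_5_lower t by (intro mult_right_mono) auto
    moreover have "0.0002 * t ^ 4 - 0.0162 * t\<^sup>2 \<ge> - 8/9"
    proof -
      \<comment> \<open>Completing the square; the minimum of the left-hand side of the claim is about \<open>-0.33\<close>.\<close>
      have "(t\<^sup>2 - 81/2)\<^sup>2 \<ge> 0" by simp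
      then have "t ^ 4 - 81 * t\<^sup>2 + 6561/4 \<ge> 0" by (simp add: power2_eq_square power4_eq_xxxx field_simps)
      then show ?thesis by simp
    qed
    ultimately have "Q 2 * t + Q 3 * t\<^sup>2 / 2 + Q 4 * t ^ 3 / 6 + Q 5 * t ^ 4 / 24 \<ge> - 8/9" by simp
    from mult_left_mono[OF this, of "lam * th"] lt show ?thesis by simp
  qed
  finally show ?thesis using 1 by simp
qed

end

section \<open>Laplace transforms\<close>

text \<open>
  Subexponential growth makes all the integrals \<open>lap \<phi> n y\<close> with \<open>y > 0\<close> converge, where
  \<open>lap \<phi> n\<close> is \<open>(-1) ^ n\<close> times the \<open>n\<close>-th derivative of the Laplace transform \<open>lap \<phi> 0\<close>.
\<close>

definition subexp :: "(real \<Rightarrow> real) \<Rightarrow> bool" where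
  "subexp \<phi> \<longleftrightarrow> continuous_on {0..} \<phi> \<and> (\<forall>e>0. \<exists>C. \<forall>t\<ge>0. \<bar>\<phi> t\<bar> \<le> C * exp (e * t))"

definition lap :: "(real \<Rightarrow> real) \<Rightarrow> nat \<Rightarrow> real \<Rightarrow> real" where
  "lap \<phi> n y = (LINT t:{0..}|lborel. t ^ n * exp (- y * t) * \<phi> t)"

lemma
  fixes p :: real
  assumes "p > 0"
  shows power_exp_integrable: "set_integrable lborel {0..} (\<lambda>t. t ^ n * exp (- p * t))"
    and power_exp_integral: "(LINT t:{0..}|lborel. t ^ n * exp (- p * t)) = fact n / p ^ Suc n"
proof -
  interpret prob_space "density lborel (erlang_density n p)" using assms by (rule prob_space_erlang_density)
  have 1: "(\<integral>\<^sup>+ t. ennreal (erlang_density n p t) \<partial>lborel) = ennreal 1"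
    using emeasure_space_1 by (simp add: emeasure_density)
  have "has_bochner_integral lborel (erlang_density n p) 1"
    using assms 1 by (intro has_bochner_integral_nn_integral) auto
  from has_bochner_integral_mult_right[OF this, of "fact n / p ^ Suc n"]
  have "has_bochner_integral lborel (\<lambda>t. fact n / p ^ Suc n * erlang_density n p t) (fact n / p ^ Suc n)" by simp
  moreover have "(\<lambda>t. fact n / p ^ Suc n * erlang_density n p t) = (\<lambda>t. indicator {0..} t *\<^sub>R (t ^ n * exp (- p * t)))"
    using assms by (auto simp: fun_eq_iff erlang_density_def indicator_def)
  ultimately have "has_bochner_integral lborel (\<lambda>t. indicator {0..} t *\<^sub>R (t ^ n * exp (- p * t))) (fact n / p ^ Suc n)" by simp
  then show "set_integrable lborel {0..} (\<lambda>t. t ^ n * exp (- p * t))"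
    and "(LINT t:{0..}|lborel. t ^ n * exp (- p * t)) = fact n / p ^ Suc n"
    unfolding set_integrable_def set_lebesgue_integral_def by (auto simp: has_bochner_integral_iff)
qed

lemma set_borel_measurable_continuous_on:
  fixes f :: "real \<Rightarrow> real"
  assumes "continuous_on {0..} f"
  shows "set_borel_measurable lborel {0..} f"
  unfolding set_borel_measurable_def
  using borel_measurable_continuous_on_indicator[OF _ assms] by simp

lemma lap_integrable:
  assumes "subexp \<phi>" "y > 0"
  shows "set_integrable lborel {0..} (\<lambda>t. t ^ n * exp (- y * t) * \<phi> t)"
proof -
  obtain C where C: "\<And>t. t \<ge> 0 \<Longrightarrow> \<bar>\<phi> t\<bar> \<le> C * exp (y / 2 * t)"
    using assms unfolding subexp_def by (meson half_gt_zero)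
  show ?thesis
  proof (rule set_integrable_bound)
    show "set_integrable lborel {0..} (\<lambda>t. C * (t ^ n * exp (- (y / 2) * t)))"
      using assms by (intro set_integrable_mult_right power_exp_integrable) auto
    show "set_borel_measurable lborel {0..} (\<lambda>t. t ^ n * exp (- y * t) * \<phi> t)"
      using assms by (intro set_borel_measurable_continuous_on continuous_intros) (auto simp: subexp_def)
    show "AE t in lborel. t \<in> {0..} \<longrightarrow> norm (t ^ n * exp (- y * t) * \<phi> t) \<le> norm (C * (t ^ n * exp (- (y / 2) * t)))"
    proof (intro AE_I2 impI)
      fix t :: real assume t: "t \<in> {0..}"
      have "norm (t ^ n * exp (- y * t) * \<phi> t) = t ^ n * exp (- y * t) * \<bar>\<phi> t\<bar>" using t by (simp add: abs_mult)
      also have "\<dots> \<le> t ^ n * exp (- y * t) * (C * exp (y / 2 * t))"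
        using t C by (intro mult_left_mono) auto
      also have "\<dots> = C * (t ^ n * (exp (- y * t) * exp (y / 2 * t)))" by simp
      also have "exp (- y * t) * exp (y / 2 * t) = exp (- (y / 2) * t)"
        unfolding exp_add[symmetric] by (rule arg_cong[of _ _ exp]) (simp add: field_simps)
      finally show "norm (t ^ n * exp (- y * t) * \<phi> t) \<le> norm (C * (t ^ n * exp (- (y / 2) * t)))" by simp
    qed
  qed
qed

lemma exp_remainder_bound: "\<bar>exp u - 1 - u\<bar> \<le> u\<^sup>2 * exp \<bar>u :: real\<bar>"
proof -
  obtain t where t: "\<bar>t\<bar> \<le> \<bar>u\<bar>" "exp u = (\<Sum>m<2. u ^ m / fact m) + exp t / fact 2 * u ^ 2"
    using Maclaurin_exp_le[of u 2] by blast
  have "exp u - 1 - u = exp t / 2 * u\<^sup>2" using t(2) by (simp add: numeral_2_eq_2)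
  moreover have "exp t / 2 * u\<^sup>2 \<le> exp \<bar>u\<bar> * u\<^sup>2"
  proof (intro mult_right_mono)
    have "exp t \<le> exp \<bar>u\<bar>" using t(1) by simp
    then show "exp t / 2 \<le> exp \<bar>u\<bar>" by (smt (verit) exp_gt_zero field_sum_of_halves)
  qed simp
  moreover have "exp t / 2 * u\<^sup>2 \<ge> 0" by simp
  ultimately show ?thesis by (simp only: mult.commute abs_of_nonneg)
qed

lemma has_real_derivative_quadratic_remainder:
  fixes f :: "real \<Rightarrow> real"
  assumes "d > 0" "\<And>k. \<bar>k\<bar> < d \<Longrightarrow> \<bar>f (y + k) - f y - k * f1\<bar> \<le> C * k\<^sup>2"
  shows "(f has_real_derivative f1) (at y)"
  unfolding DERIV_def
proof (rule LIM_zero_cancel, rule Lim_null_comparison)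
  show "((\<lambda>k. C * \<bar>k\<bar>) \<longlongrightarrow> 0) (at (0::real))" by (auto intro!: tendsto_eq_intros)
  show "\<forall>\<^sub>F k in at 0. norm ((f (y + k) - f y) / k - f1) \<le> C * \<bar>k\<bar>"
    unfolding eventually_at
  proof (intro exI[of _ d] conjI ballI impI)
    fix k :: real assume k: "k \<noteq> 0 \<and> dist k 0 < d"
    then have "\<bar>f (y + k) - f y - k * f1\<bar> \<le> C * k\<^sup>2" by (intro assms(2)) (auto simp: dist_real_def)
    then have "\<bar>f (y + k) - f y - k * f1\<bar> / \<bar>k\<bar> \<le> C * k\<^sup>2 / \<bar>k\<bar>" by (intro divide_right_mono) auto
    moreover have "C * k\<^sup>2 / \<bar>k\<bar> = C * \<bar>k\<bar>" using k by (simp add: power2_eq_square) (simp add: abs_if)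
    moreover have "(f (y + k) - f y) / k - f1 = (f (y + k) - f y - k * f1) / k" using k by (simp add: field_simps)
    ultimately show "norm ((f (y + k) - f y) / k - f1) \<le> C * \<bar>k\<bar>" by (simp add: abs_divide)
  qed (use assms in auto)
qed

text \<open>
  Differentiation under the integral sign by a quantitative bound: the second order Taylor
  remainder of \<open>exp (- k * t)\<close> leaves an error of at most \<open>C * k\<^sup>2\<close>.
\<close>

lemma lap_has_derivative:
  assumes \<phi>: "subexp \<phi>" and y: "y > 0"
  shows "(lap \<phi> n has_real_derivative - lap \<phi> (Suc n) y) (at y)"
proof (rule has_real_derivative_quadratic_remainder)
  show "y / 2 > 0" using y by simp
  define C where "C = (LINT t:{0..}|lborel. \<bar>t ^ (n + 2) * exp (- (y / 2) * t) * \<phi> t\<bar>)"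
  fix k :: real assume k: "\<bar>k\<bar> < y / 2"
  have yh: "y + k > 0" using k y by (simp add: abs_if split: if_splits)
  have I: "set_integrable lborel {0..} (\<lambda>t. t ^ n * exp (- (y + k) * t) * \<phi> t - t ^ n * exp (- y * t) * \<phi> t + k * (t ^ Suc n * exp (- y * t) * \<phi> t))"
    using lap_integrable[OF \<phi> yh] lap_integrable[OF \<phi> y]
    by (intro set_integral_add set_integral_diff set_integrable_mult_right)
  have eq: "lap \<phi> n (y + k) - lap \<phi> n y - k * - lap \<phi> (Suc n) y
     = (LINT t:{0..}|lborel. t ^ n * exp (- (y + k) * t) * \<phi> t - t ^ n * exp (- y * t) * \<phi> t + k * (t ^ Suc n * exp (- y * t) * \<phi> t))"
    using set_integral_add(2)[OF set_integral_diff(1)[OF lap_integrable[OF \<phi> yh] lap_integrable[OF \<phi> y]]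
        set_integrable_mult_right[OF lap_integrable[OF \<phi> y]], of n n k "Suc n"]
      set_integral_diff(2)[OF lap_integrable[OF \<phi> yh] lap_integrable[OF \<phi> y], of n n]
    unfolding lap_def by simp
  have "\<bar>LINT t:{0..}|lborel. t ^ n * exp (- (y + k) * t) * \<phi> t - t ^ n * exp (- y * t) * \<phi> t + k * (t ^ Suc n * exp (- y * t) * \<phi> t)\<bar>
    \<le> (LINT t:{0..}|lborel. k\<^sup>2 * \<bar>t ^ (n + 2) * exp (- (y / 2) * t) * \<phi> t\<bar>)"
    unfolding set_lebesgue_integral_def
  proof (rule integral_abs_bound_integral)
    show "integrable lborel (\<lambda>t. indicator {0..} t *\<^sub>R (t ^ n * exp (- (y + k) * t) * \<phi> t - t ^ n * exp (- y * t) * \<phi> t + k * (t ^ Suc n * exp (- y * t) * \<phi> t)))"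
      using I by (simp only: set_integrable_def)
    have "set_integrable lborel {0..} (\<lambda>t. k\<^sup>2 * \<bar>t ^ (n + 2) * exp (- (y / 2) * t) * \<phi> t\<bar>)"
      by (intro set_integrable_mult_right set_integrable_abs lap_integrable[OF \<phi>]) (use y in simp)
    then show "integrable lborel (\<lambda>t. indicator {0..} t *\<^sub>R (k\<^sup>2 * \<bar>t ^ (n + 2) * exp (- (y / 2) * t) * \<phi> t\<bar>))"
      by (simp only: set_integrable_def)
    fix t :: real
    show "\<bar>indicator {0..} t *\<^sub>R (t ^ n * exp (- (y + k) * t) * \<phi> t - t ^ n * exp (- y * t) * \<phi> t + k * (t ^ Suc n * exp (- y * t) * \<phi> t))\<bar>
      \<le> indicator {0..} t *\<^sub>R (k\<^sup>2 * \<bar>t ^ (n + 2) * exp (- (y / 2) * t) * \<phi> t\<bar>)"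
    proof (cases "t \<ge> 0")
      case True
      have e: "exp (- (y + k) * t) = exp (- y * t) * exp (- k * t)"
        unfolding exp_add[symmetric] by (rule arg_cong[of _ _ exp]) (simp add: algebra_simps)
      have "t ^ n * exp (- (y + k) * t) * \<phi> t - t ^ n * exp (- y * t) * \<phi> t + k * (t ^ Suc n * exp (- y * t) * \<phi> t)
        = t ^ n * exp (- y * t) * \<phi> t * (exp (- k * t) - 1 - (- k * t))"
        unfolding e by (simp add: algebra_simps)
      also have "\<bar>\<dots>\<bar> = t ^ n * exp (- y * t) * \<bar>\<phi> t\<bar> * \<bar>exp (- k * t) - 1 - (- k * t)\<bar>"
        using True by (simp add: abs_mult)
      also have "\<dots> \<le> t ^ n * exp (- y * t) * \<bar>\<phi> t\<bar> * ((- k * t)\<^sup>2 * exp \<bar>- k * t\<bar>)"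
        using True by (intro mult_left_mono exp_remainder_bound) auto
      also have "\<dots> \<le> t ^ n * exp (- y * t) * \<bar>\<phi> t\<bar> * ((- k * t)\<^sup>2 * exp (y / 2 * t))"
      proof -
        have "\<bar>k\<bar> * t \<le> y / 2 * t" using True k by (intro mult_right_mono) auto
        then have "exp \<bar>- k * t\<bar> \<le> exp (y / 2 * t)" using True by (simp add: abs_mult)
        then show ?thesis using True by (intro mult_left_mono) auto
      qed
      also have "\<dots> = k\<^sup>2 * (t ^ (n + 2) * (exp (- y * t) * exp (y / 2 * t)) * \<bar>\<phi> t\<bar>)"
        by (simp add: power_mult_distrib power_add power2_eq_square algebra_simps)
      also have "exp (- y * t) * exp (y / 2 * t) = exp (- (y / 2) * t)"
        unfolding exp_add[symmetric] by (rule arg_cong[of _ _ exp]) (simp add: field_simps)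
      finally show ?thesis using True by (simp add: abs_mult)
    qed simp
  qed
  moreover have "(LINT t:{0..}|lborel. k\<^sup>2 * \<bar>t ^ (n + 2) * exp (- (y / 2) * t) * \<phi> t\<bar>) = C * k\<^sup>2"
    unfolding C_def by simp
  ultimately show "\<bar>lap \<phi> n (y + k) - lap \<phi> n y - k * - lap \<phi> (Suc n) y\<bar> \<le> C * k\<^sup>2"
    unfolding eq by linarith
qed

definition ker :: "real \<Rightarrow> real \<Rightarrow> real \<Rightarrow> real" where
  "ker a c t = exp (- t) * dens a c t"

lemma dens_continuous: "continuous_on A (dens a c)"
proof -
  have "isCont (\<lambda>t. \<Sum>n. (- nu a c (Suc n) / fact n) * t ^ n) t" for t
    by (rule isCont_powser_converges_everywhere)
       (use dens_sums[of a c] in \<open>auto simp: sums_iff\<close>)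
  then have "isCont (dens a c) t" for t unfolding dens_def by simp
  then show ?thesis by (simp add: continuous_at_imp_continuous_on)
qed

lemma ker_subexp: "subexp (ker a c)"
  unfolding subexp_def
proof (intro conjI allI impI)
  show "continuous_on {0..} (ker a c)" unfolding ker_def by (intro continuous_intros dens_continuous)
  fix e :: real assume e: "e > 0"
  define \<rho> where "\<rho> = 1 + e"
  obtain C where C: "C > 0" "\<And>n. \<bar>nu a c n\<bar> \<le> C * \<rho> ^ n" using nu_growth[of \<rho> a c] e by (auto simp: \<rho>_def)
  show "\<exists>C. \<forall>t\<ge>0. \<bar>ker a c t\<bar> \<le> C * exp (e * t)"
  proof (intro exI allI impI)
    fix t :: real assume t: "t \<ge> 0"
    have s: "(\<lambda>n. C * \<rho> * ((\<rho> * t) ^ n / fact n)) sums (C * \<rho> * exp (\<rho> * t))"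
      using exp_converges[of "\<rho> * t"] by (intro sums_mult) (simp add: divide_inverse mult.commute)
    have le: "norm (- nu a c (Suc n) * t ^ n / fact n) \<le> C * \<rho> * ((\<rho> * t) ^ n / fact n)" for n
    proof -
      have "norm (- nu a c (Suc n) * t ^ n / fact n) = \<bar>nu a c (Suc n)\<bar> * t ^ n / fact n"
        using t by (simp add: abs_mult)
      also have "\<dots> \<le> C * \<rho> ^ Suc n * t ^ n / fact n"
        using t C(2)[of "Suc n"] by (intro divide_right_mono mult_right_mono) auto
      also have "\<dots> = C * \<rho> * ((\<rho> * t) ^ n / fact n)" by (simp add: power_mult_distrib)
      finally show ?thesis .
    qed
    have "\<bar>dens a c t\<bar> \<le> C * \<rho> * exp (\<rho> * t)"
    proof -
      have "\<bar>dens a c t\<bar> \<le> (\<Sum>n. \<bar>- nu a c (Suc n) * t ^ n / fact n\<bar>)"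
        unfolding dens_def by (intro summable_rabs dens_summable_abs)
      also have "\<dots> \<le> (\<Sum>n. C * \<rho> * ((\<rho> * t) ^ n / fact n))"
        using le by (intro suminf_le dens_summable_abs sums_summable[OF s]) (simp only: real_norm_def)
      also have "\<dots> = C * \<rho> * exp (\<rho> * t)" by (rule sums_unique[OF s, symmetric])
      finally show ?thesis .
    qed
    then have "\<bar>ker a c t\<bar> \<le> exp (- t) * (C * \<rho> * exp (\<rho> * t))"
      unfolding ker_def abs_mult by simp
    also have "\<dots> = C * \<rho> * (exp (- t) * exp (\<rho> * t))" by simp
    also have "exp (- t) * exp (\<rho> * t) = exp (e * t)"
      unfolding exp_add[symmetric] by (rule arg_cong[of _ _ exp]) (simp add: \<rho>_def algebra_simps)
    finally show "\<bar>ker a c t\<bar> \<le> C * \<rho> * exp (e * t)" .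
  qed
qed

text \<open>
  Termwise integration: \<open>t ^ n / fact n * exp (- (1 + y) * t)\<close> has integral \<open>1 / (1 + y) ^ Suc n\<close>, and
  the resulting series is the Taylor series summed in \<open>nu_sums\<close>, without its constant term 1.
\<close>

lemma lap_ker:
  assumes y: "y > 0"
  shows "lap (ker a c) 0 y = 1 - exp (- a) * (1 + 1 / y) powr (a * y - c)"
proof -
  define f where "f = (\<lambda>n t. indicator {0..} t * ((t ^ n * exp (- (1 + y) * t)) * (- nu a c (Suc n) / fact n)))"
  have fi: "integrable lborel (f n)" for n
    using power_exp_integrable[of "1 + y" n] y unfolding f_def set_integrable_def mult.assoc[symmetric]
    by (intro integrable_mult_left) (simp add: mult.assoc)
  have S: "(\<lambda>n. f n t) sums (indicator {0..} t *\<^sub>R (t ^ 0 * exp (- y * t) * ker a c t))" for t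
  proof -
    have "(\<lambda>n. indicator {0..} t * exp (- (1 + y) * t) * (- nu a c (Suc n) * t ^ n / fact n)) sums
       (indicator {0..} t * exp (- (1 + y) * t) * dens a c t)"
      by (intro sums_mult dens_sums)
    moreover have "exp (- (1 + y) * t) = exp (- y * t) * exp (- t)"
      unfolding exp_add[symmetric] by (rule arg_cong[of _ _ exp]) (simp add: algebra_simps)
    ultimately show ?thesis unfolding f_def ker_def by (simp add: mult_ac)
  qed
  have absf: "norm (f n t) = \<bar>nu a c (Suc n)\<bar> / fact n * (indicator {0..} t * (t ^ n * exp (- (1 + y) * t)))" for n t
    by (simp add: f_def abs_mult indicator_def)
  have s1: "AE t in lborel. summable (\<lambda>n. norm (f n t))"
  proof (intro AE_I2)
    fix t :: real
    have "summable (\<lambda>n. indicator {0..} t * exp (- (1 + y) * t) * \<bar>- nu a c (Suc n) * t ^ n / fact n\<bar>)"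
      by (intro summable_mult dens_summable_abs)
    moreover have "norm (f n t) = indicator {0..} t * exp (- (1 + y) * t) * \<bar>- nu a c (Suc n) * t ^ n / fact n\<bar>" for n
      unfolding absf by (cases "t \<ge> 0") (simp_all add: abs_mult)
    ultimately show "summable (\<lambda>n. norm (f n t))" by (simp only:)
  qed
  have r: "\<bar>1 / (1 + y)\<bar> < 1" using y by simp
  have inf: "(LINT t|lborel. norm (f n t)) = \<bar>nu a c (Suc n)\<bar> * (1 / (1 + y)) ^ Suc n" for n
  proof -
    have "(LINT t|lborel. norm (f n t)) = \<bar>nu a c (Suc n)\<bar> / fact n * (LINT t:{0..}|lborel. t ^ n * exp (- (1 + y) * t))"
      unfolding absf set_lebesgue_integral_def by simp
    also have "\<dots> = \<bar>nu a c (Suc n)\<bar> * (1 / (1 + y)) ^ Suc n"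
      using y by (subst power_exp_integral) (auto simp: power_one_over divide_simps)
    finally show ?thesis .
  qed
  have inf2: "(LINT t|lborel. f n t) = - nu a c (Suc n) * (1 / (1 + y)) ^ Suc n" for n
  proof -
    have "(LINT t|lborel. f n t) = (LINT t:{0..}|lborel. t ^ n * exp (- (1 + y) * t)) * (- nu a c (Suc n) / fact n)"
      unfolding f_def set_lebesgue_integral_def mult.assoc[symmetric] by (subst integral_mult_left_zero) (simp add: mult.assoc)
    also have "\<dots> = - nu a c (Suc n) * (1 / (1 + y)) ^ Suc n"
      using y by (subst power_exp_integral) (auto simp: power_one_over divide_simps)
    finally show ?thesis .
  qed
  have "summable (\<lambda>n. norm (nu a c n * (1 / (1 + y)) ^ n))"
  proof -
    obtain \<rho> where \<rho>: "1 < \<rho>" "\<rho> * (1 / (1 + y)) < 1" using y dense[of 1 "1 + y"] by (auto simp: divide_simps)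
    obtain C where C: "C > 0" "\<And>n. \<bar>nu a c n\<bar> \<le> C * \<rho> ^ n" using nu_growth[OF \<rho>(1)] by blast
    show ?thesis
    proof (rule summable_comparison_test')
      show "summable (\<lambda>n. C * (\<rho> * (1 / (1 + y))) ^ n)" using \<rho> y by (intro summable_mult summable_geometric) auto
      show "norm (norm (nu a c n * (1 / (1 + y)) ^ n)) \<le> C * (\<rho> * (1 / (1 + y))) ^ n" for n
        using mult_right_mono[OF C(2)[of n], of "(1 / (1 + y)) ^ n"] y
        by (simp only: abs_mult power_mult_distrib real_norm_def abs_idempotent mult.assoc power_abs) simp
    qed
  qed
  then have s2: "summable (\<lambda>n. LINT t|lborel. norm (f n t))"
    unfolding inf using y by (subst (asm) summable_Suc_iff[symmetric]) (simp add: abs_mult power_abs)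
  have "(\<lambda>n. LINT t|lborel. f n t) sums (LINT t|lborel. (\<Sum>n. f n t))"
    by (rule sums_integral[OF fi s1 s2])
  also have "(LINT t|lborel. (\<Sum>n. f n t)) = lap (ker a c) 0 y"
    unfolding lap_def set_lebesgue_integral_def using S by (simp add: sums_iff)
  finally have 1: "(\<lambda>n. - nu a c (Suc n) * (1 / (1 + y)) ^ Suc n) sums lap (ker a c) 0 y" unfolding inf2 .
  have "(\<lambda>n. nu a c (Suc n) * (1 / (1 + y)) ^ Suc n) sums (exp (- a) * (1 + 1 / y) powr (a * y - c) - 1)"
    using nu_sums[OF y, of a c] by (subst sums_Suc_iff) simp
  from sums_unique2[OF sums_minus[OF this] 1[unfolded minus_mult_left[symmetric]]] show ?thesis by simp
qed

section \<open>Complete monotonicity\<close>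

text \<open>
  Complete monotonicity of finite order in recursive form. The derivative enters as a witness, so
  the closure properties follow by induction on the order, differentiating only once in each step.
\<close>

primrec cm_upto :: "nat \<Rightarrow> (real \<Rightarrow> real) \<Rightarrow> bool" where
  "cm_upto 0 f = (\<forall>x>0. f x \<ge> 0)"
| "cm_upto (Suc n) f = ((\<forall>x>0. f x \<ge> 0) \<and>
     (\<exists>f'. (\<forall>x>0. (f has_real_derivative - f' x) (at x)) \<and> cm_upto n f'))"

lemma cm_upto_nonneg: "cm_upto n f \<Longrightarrow> x > 0 \<Longrightarrow> f x \<ge> 0"
  by (cases n) auto

lemma cm_upto_SucI:
  assumes "\<And>x. x > 0 \<Longrightarrow> f x \<ge> 0" "\<And>x. x > 0 \<Longrightarrow> (f has_real_derivative - f' x) (at x)" "cm_upto n f'"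
  shows "cm_upto (Suc n) f"
  using assms by auto

lemma cm_upto_SucE:
  assumes "cm_upto (Suc n) f"
  obtains f' where "\<forall>x>0. f x \<ge> 0" "\<forall>x>0. (f has_real_derivative - f' x) (at x)" "cm_upto n f'"
  using assms by auto

declare cm_upto.simps(2) [simp del]

lemma cm_upto_Suc_D: "cm_upto (Suc n) f \<Longrightarrow> cm_upto n f"
proof (induction n arbitrary: f)
  case (Suc n)
  from Suc.prems obtain f' where f': "\<forall>x>0. f x \<ge> 0" "\<forall>x>0. (f has_real_derivative - f' x) (at x)" "cm_upto (Suc n) f'"
    by (rule cm_upto_SucE)
  from Suc.IH[OF f'(3)] f' show ?case by (auto intro: cm_upto_SucI)
qed (auto simp: cm_upto.simps(2))

lemma has_derivative_transform_pos:
  assumes "\<forall>x>0. f x = k x" "x > 0" "(f has_real_derivative d) (at x)"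
  shows "(k has_real_derivative d) (at (x::real))"
proof -
  have "eventually (\<lambda>z. f z = k z) (nhds x)"
    using eventually_nhds_in_open[of "{0<..}" x] assms by (auto elim: eventually_mono)
  then show ?thesis using assms(3) by (subst DERIV_cong_ev[OF refl _ refl, symmetric]) auto
qed

lemma cm_upto_cong:
  assumes "\<forall>x>0. f x = k x" "cm_upto n f"
  shows "cm_upto n k"
proof (cases n)
  case (Suc m)
  from assms(2)[unfolded Suc] obtain f' where f': "\<forall>x>0. f x \<ge> 0" "\<forall>x>0. (f has_real_derivative - f' x) (at x)" "cm_upto m f'"
    by (rule cm_upto_SucE)
  show ?thesis unfolding Suc
    by (rule cm_upto_SucI[OF _ has_derivative_transform_pos[OF assms(1)] f'(3)]) (use assms f' in auto)
qed (use assms in auto)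

lemma cm_upto_family:
  assumes "\<And>i x. x > 0 \<Longrightarrow> (G i has_real_derivative - G (Suc i) x) (at x)" "\<And>i x. x > 0 \<Longrightarrow> G i x \<ge> 0"
  shows "cm_upto n (G k)"
proof (induction n arbitrary: k)
  case (Suc n)
  show ?case by (rule cm_upto_SucI[OF assms(2) assms(1) Suc.IH])
qed (use assms in auto)

lemma cm_upto_family_nonneg:
  assumes "\<And>i x. x > 0 \<Longrightarrow> (G i has_real_derivative - G (Suc i) x) (at x)"
    "cm_upto n f" "\<forall>x>0. f x = G 0 x" "y > 0"
  shows "G n y \<ge> 0"
  using assms
proof (induction n arbitrary: f G)
  case (Suc n)
  from Suc.prems(2) obtain f' where f': "\<forall>x>0. (f has_real_derivative - f' x) (at x)" "cm_upto n f'"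
    by (rule cm_upto_SucE)
  have "\<forall>x>0. f' x = G 1 x"
  proof (intro allI impI)
    fix x :: real assume x: "x > 0"
    have "(G 0 has_real_derivative - f' x) (at x)"
      using has_derivative_transform_pos[OF Suc.prems(3) x] f'(1) x by auto
    from DERIV_unique[OF this Suc.prems(1)[OF x]] show "f' x = G 1 x" by simp
  qed
  then show ?case using Suc.IH[of "\<lambda>i. G (Suc i)" f'] Suc.prems f' by simp
qed auto

lemma cm_upto_const: "c \<ge> 0 \<Longrightarrow> cm_upto n (\<lambda>_. c)"
proof (induction n arbitrary: c)
  case (Suc n)
  show ?case by (rule cm_upto_SucI[of _ "\<lambda>_. 0"]) (use Suc in auto)
qed auto

lemma cm_upto_add: "cm_upto n f \<Longrightarrow> cm_upto n k \<Longrightarrow> cm_upto n (\<lambda>x. f x + k x)"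
proof (induction n arbitrary: f k)
  case (Suc n)
  obtain f' where f': "\<forall>x>0. (f has_real_derivative - f' x) (at x)" "cm_upto n f'"
    using Suc.prems(1) by (rule cm_upto_SucE)
  obtain k' where k': "\<forall>x>0. (k has_real_derivative - k' x) (at x)" "cm_upto n k'"
    using Suc.prems(2) by (rule cm_upto_SucE)
  note d = f' k'
  show ?case
  proof (rule cm_upto_SucI[OF _ _ Suc.IH[OF d(2,4)]])
    fix x :: real assume "x > 0"
    then show "((\<lambda>x. f x + k x) has_real_derivative - (f' x + k' x)) (at x)"
      using d by (auto intro!: derivative_eq_intros)
  qed (use cm_upto_nonneg[OF Suc.prems(1)] cm_upto_nonneg[OF Suc.prems(2)] in auto)
qed auto

lemma cm_upto_mult: "cm_upto n f \<Longrightarrow> cm_upto n k \<Longrightarrow> cm_upto n (\<lambda>x. f x * k x)"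
proof (induction n arbitrary: f k)
  case (Suc n)
  obtain f' where f': "\<forall>x>0. (f has_real_derivative - f' x) (at x)" "cm_upto n f'"
    using Suc.prems(1) by (rule cm_upto_SucE)
  obtain k' where k': "\<forall>x>0. (k has_real_derivative - k' x) (at x)" "cm_upto n k'"
    using Suc.prems(2) by (rule cm_upto_SucE)
  note d = f' k'
  have "cm_upto n (\<lambda>x. f' x * k x + f x * k' x)"
    by (rule cm_upto_add[OF Suc.IH[OF f'(2) cm_upto_Suc_D[OF Suc.prems(2)]] Suc.IH[OF cm_upto_Suc_D[OF Suc.prems(1)] k'(2)]])
  then show ?case
  proof (rule cm_upto_SucI[rotated 2])
    fix x :: real assume x: "x > 0"
    have "((\<lambda>x. f x * k x) has_real_derivative (- f' x) * k x + (- k' x) * f x) (at x)"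
      using d x by (intro DERIV_mult) auto
    then show "((\<lambda>x. f x * k x) has_real_derivative - (f' x * k x + f x * k' x)) (at x)"
      by (simp add: algebra_simps)
  qed (use cm_upto_nonneg[OF Suc.prems(1)] cm_upto_nonneg[OF Suc.prems(2)] in auto)
qed auto

lemma cm_upto_scale: "cm_upto n f \<Longrightarrow> k > 0 \<Longrightarrow> cm_upto n (\<lambda>x. f (k * x))"
proof (induction n arbitrary: f)
  case (Suc n)
  obtain f' where d: "\<forall>x>0. (f has_real_derivative - f' x) (at x)" "cm_upto n f'"
    using Suc.prems(1) by (rule cm_upto_SucE)
  have "cm_upto n (\<lambda>x. k * f' (k * x))"
    using Suc.prems by (intro cm_upto_mult cm_upto_const Suc.IH d) auto
  then show ?case
  proof (rule cm_upto_SucI[rotated 2])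
    fix x :: real assume x: "x > 0"
    have "((\<lambda>x. k * x) has_real_derivative k) (at x)" by (auto intro!: derivative_eq_intros)
    moreover have "(f has_real_derivative - f' (k * x)) (at (k * x))" using d x Suc.prems by auto
    ultimately have "((\<lambda>x. f (k * x)) has_real_derivative - f' (k * x) * k) (at x)" by (rule DERIV_chain2[rotated])
    then show "((\<lambda>x. f (k * x)) has_real_derivative - (k * f' (k * x))) (at x)" by (simp add: mult.commute)
  qed (use cm_upto_nonneg[OF Suc.prems(1)] Suc.prems in auto)
qed auto

text \<open>
  A negative power of a positive function \<open>b\<close> with completely monotone derivative has derivative
  \<open>- r * b powr (- r - 1) * b'\<close>; the first factor is again a negative power, which closes the induction.
\<close>

lemma cm_upto_neg_powr:
  assumes "\<And>x. x > 0 \<Longrightarrow> b x > 0" "\<And>x. x > 0 \<Longrightarrow> (b has_real_derivative b' x) (at x)" "\<And>n. cm_upto n b'" "r \<ge> 0"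
  shows "cm_upto n (\<lambda>x. b x powr (- r))"
  using assms(4)
proof (induction n arbitrary: r)
  case (Suc n)
  have "cm_upto n (\<lambda>x. r * (b x powr (- (r + 1)) * b' x))"
    using Suc.prems by (intro cm_upto_mult cm_upto_const Suc.IH assms) auto
  then show ?case
  proof (rule cm_upto_SucI[rotated 2])
    fix x :: real assume x: "x > 0"
    have "((\<lambda>x. b x powr (- r)) has_real_derivative (- r * b x powr (- r - 1)) * b' x) (at x)"
      using assms(1)[OF x] assms(2)[OF x] by (intro DERIV_chain2[OF has_real_derivative_powr]) auto
    then show "((\<lambda>x. b x powr (- r)) has_real_derivative - (r * (b x powr (- (r + 1)) * b' x))) (at x)"
      by (simp add: mult.assoc)
  qed auto
qed auto

lemma cm_upto_deriv_iterates:
  assumes "cm_upto (Suc n) f" "\<forall>x>0. k x = s * f x" "x > 0"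
  shows "(deriv ^^ n) k differentiable (at x) \<and> (\<exists>v\<ge>0. (deriv ^^ n) k x = s * (-1) ^ n * v)"
  using assms
proof (induction n arbitrary: f k s)
  case 0
  obtain f' where "\<forall>x>0. (f has_real_derivative - f' x) (at x)" using 0(1) by (rule cm_upto_SucE)
  then have "(f has_real_derivative - f' x) (at x)" using 0(3) by blast
  from DERIV_cmult[OF this, of s] have "(k has_real_derivative s * (- f' x)) (at x)"
    by (rule has_derivative_transform_pos[rotated 2]) (use 0 in auto)
  then have "k differentiable (at x)" by (auto simp: real_differentiable_def)
  then show ?case using 0 cm_upto_nonneg[OF 0(1,3)] by auto
next
  case (Suc n)
  obtain f' where f': "\<forall>x>0. (f has_real_derivative - f' x) (at x)" "cm_upto (Suc n) f'"
    using Suc.prems(1) by (rule cm_upto_SucE)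
  have "\<forall>x>0. deriv k x = (- s) * f' x"
  proof (intro allI impI)
    fix x :: real assume x: "x > 0"
    have "((\<lambda>x. s * f x) has_real_derivative s * (- f' x)) (at x)" using f' x by (intro DERIV_cmult) auto
    then have "(k has_real_derivative s * (- f' x)) (at x)"
      by (rule has_derivative_transform_pos[rotated 2]) (use Suc.prems x in auto)
    then show "deriv k x = (- s) * f' x" by (simp add: DERIV_imp_deriv)
  qed
  from Suc.IH[OF f'(2) this Suc.prems(3)]
  show ?case by (simp add: funpow_swap1[symmetric] o_def del: funpow.simps add: funpow_Suc_right)
qed

lemma completely_monotone_iff: "completely_monotone f \<longleftrightarrow> (\<forall>n. cm_upto n f)"
proof
  assume cm: "completely_monotone f"
  have "cm_upto n (\<lambda>x. (-1) ^ k * (deriv ^^ k) f x)" for n k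
  proof (rule cm_upto_family[where G = "\<lambda>k x. (-1) ^ k * (deriv ^^ k) f x"])
    fix i and x :: real assume x: "x > 0"
    have "(deriv ^^ i) f differentiable_on {0<..}" using cm by (auto simp: completely_monotone_def smooth_on_pos_def)
    then have "(deriv ^^ i) f differentiable (at x)"
      using x by (simp add: differentiable_on_eq_differentiable_at)
    then have "((deriv ^^ i) f has_real_derivative (deriv ^^ Suc i) f x) (at x)"
      by (auto simp: DERIV_deriv_iff_real_differentiable)
    from DERIV_cmult[OF this, of "(-1) ^ i"]
    show "((\<lambda>x. (-1) ^ i * (deriv ^^ i) f x) has_real_derivative - ((-1) ^ Suc i * (deriv ^^ Suc i) f x)) (at x)"
      by simp
    show "(-1) ^ i * (deriv ^^ i) f x \<ge> 0" using cm x by (simp add: completely_monotone_def)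
  qed
  from this[of _ 0] show "\<forall>n. cm_upto n f" by simp
next
  assume cm: "\<forall>n. cm_upto n f"
  have *: "(deriv ^^ n) f differentiable (at x) \<and> (-1) ^ n * (deriv ^^ n) f x \<ge> 0" if "x > 0" for n x
    using cm_upto_deriv_iterates[of n f f 1 x] cm that
    by (auto simp: power_mult_distrib[symmetric] mult.assoc[symmetric])
  then show "completely_monotone f"
    unfolding completely_monotone_def smooth_on_pos_def differentiable_on_def
    by (auto intro: differentiable_at_withinI)
qed

lemma bernstein_functionI:
  assumes "\<And>x. x > 0 \<Longrightarrow> f x \<ge> 0" "\<And>x. x > 0 \<Longrightarrow> (f has_real_derivative f' x) (at x)" "\<And>n. cm_upto n f'"
  shows "bernstein_function f"
proof -
  have "\<forall>x>0. f' x = deriv f x" using DERIV_imp_deriv[OF assms(2)] by simp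
  then have "cm_upto n (deriv f)" for n using assms(3) by (rule cm_upto_cong)
  then have cm: "completely_monotone (deriv f)" by (simp add: completely_monotone_iff)
  have "(deriv ^^ n) f differentiable_on {0<..}" for n
  proof (cases n)
    case 0
    then show ?thesis
      using assms(2) by (auto simp: differentiable_on_eq_differentiable_at real_differentiable_def)
  next
    case (Suc m)
    then show ?thesis using cm by (simp add: completely_monotone_def smooth_on_pos_def funpow_Suc_right del: funpow.simps)
  qed
  then show ?thesis using assms(1) cm by (simp add: bernstein_function_def smooth_on_pos_def)
qed

lemma bernstein_functionD:
  assumes "bernstein_function f"
  shows "x > 0 \<Longrightarrow> f x \<ge> 0" "x > 0 \<Longrightarrow> (f has_real_derivative deriv f x) (at x)" "cm_upto n (deriv f)"
proof -
  show "x > 0 \<Longrightarrow> f x \<ge> 0" "cm_upto n (deriv f)"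
    using assms by (auto simp: bernstein_function_def completely_monotone_iff)
  assume x: "x > 0"
  have "f differentiable_on {0<..}" using assms by (auto simp: bernstein_function_def smooth_on_pos_def dest: spec[of _ 0])
  then have "f differentiable (at x)" using x by (simp add: differentiable_on_eq_differentiable_at)
  then show "(f has_real_derivative deriv f x) (at x)" by (simp add: DERIV_deriv_iff_real_differentiable)
qed

lemma lap_nonneg: "\<forall>t\<ge>0. \<phi> t \<ge> 0 \<Longrightarrow> lap \<phi> n y \<ge> 0"
  unfolding lap_def set_lebesgue_integral_def
  by (auto intro!: Bochner_Integration.integral_nonneg simp: indicator_def)

lemma cm_upto_lap: "subexp \<phi> \<Longrightarrow> \<forall>t\<ge>0. \<phi> t \<ge> 0 \<Longrightarrow> cm_upto n (lap \<phi> k)"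
  by (rule cm_upto_family) (auto intro: lap_has_derivative lap_nonneg)

lemma exp_gt_tangent: "u \<noteq> 0 \<Longrightarrow> 1 + u < exp (u :: real)"
proof -
  assume u: "u \<noteq> 0"
  obtain t where t: "exp u = (\<Sum>m<2. u ^ m / fact m) + exp t / fact 2 * u ^ 2"
    using Maclaurin_exp_le[of u 2] by blast
  have "exp t / fact 2 * u ^ 2 > 0" using u by simp
  then show ?thesis using t by (simp add: numeral_2_eq_2)
qed

text \<open>
  Nonnegativity of all derivatives of the transform forces \<open>\<phi> \<ge> 0\<close>. Taking \<open>y = n / T\<close>, the
  integrand of \<open>lap \<phi> n y\<close> is a constant multiple of \<open>\<psi> ^ n * \<phi>\<close>, where
  \<open>\<psi> t = t / T * exp (1 - t / T)\<close> has its strict maximum 1 at \<open>T\<close>. If \<open>\<phi> T\<close> were negative, then the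
  part near \<open>T\<close> would contribute at most \<open>- \<eta> * r ^ n * (2 * d)\<close>, the rest at most
  a constant times \<open>q ^ n\<close> with \<open>q < r\<close>, and the integral would be negative for large \<open>n\<close>.
\<close>

lemma lap_inversion:
  assumes \<phi>: "subexp \<phi>" and pos: "\<And>n y. n \<ge> 1 \<Longrightarrow> y > 0 \<Longrightarrow> lap \<phi> n y \<ge> 0" and t: "t \<ge> 0"
  shows "\<phi> t \<ge> 0"
proof -
  have cont: "continuous_on {0..} \<phi>" using \<phi> by (simp add: subexp_def)
  have main: "\<phi> T \<ge> 0" if T: "T > 0" for T
  proof (rule ccontr)
    assume "\<not> \<phi> T \<ge> 0"
    define \<eta> where "\<eta> = - \<phi> T / 2"
    have \<eta>: "\<eta> > 0" "\<phi> T < - \<eta>" using \<open>\<not> \<phi> T \<ge> 0\<close> by (auto simp: \<eta>_def)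
    define \<psi> where "\<psi> = (\<lambda>t::real. t / T * exp (1 - t / T))"
    have \<psi>c: "continuous_on A \<psi>" for A unfolding \<psi>_def using T by (intro continuous_intros) auto
    have \<psi>T: "\<psi> T = 1" using T by (simp add: \<psi>_def)
    have \<psi>0: "\<psi> t \<ge> 0" if "t \<ge> 0" for t using that T by (simp add: \<psi>_def)
    have \<psi>1: "\<psi> t < 1" if "t \<noteq> T" for t
    proof -
      have "t / T - 1 \<noteq> 0" using that T by (simp add: field_simps)
      then have "1 + (t / T - 1) < exp (t / T - 1)" by (rule exp_gt_tangent)
      then have "t / T * exp (1 - t / T) < exp (t / T - 1) * exp (1 - t / T)" by (intro mult_strict_right_mono) auto
      then show ?thesis by (simp add: \<psi>_def exp_add[symmetric])
    qed
    have \<psi>': "(\<psi> has_real_derivative (1 - t / T) / T * exp (1 - t / T)) (at t)" for t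
      unfolding \<psi>_def using T by (auto intro!: derivative_eq_intros simp: field_simps)
    have "isCont \<phi> T" using cont T continuous_on_interior[of "{0..}" \<phi> T] by simp
    then have "\<forall>\<^sub>F t in nhds T. \<phi> t < - \<eta>"
      using \<eta>(2) by (metis continuous_at order_tendstoD(2) tendsto_at_iff_tendsto_nhds)
    then obtain \<delta>0 where \<delta>0: "\<delta>0 > 0" "\<And>t. dist t T < \<delta>0 \<Longrightarrow> \<phi> t < - \<eta>" by (auto simp: eventually_nhds_metric)
    \<comment> \<open>Half the minimum, to stay inside both the neighbourhood of \<open>T\<close> and the half-line.\<close>
    define \<delta> where "\<delta> = min \<delta>0 T / 2"
    have \<delta>: "\<delta> > 0" "\<delta> < T" "\<delta> < \<delta>0" using \<delta>0 T by (auto simp: \<delta>_def)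
    define q where "q = max (\<psi> (T - \<delta>)) (\<psi> (T + \<delta>))"
    have q: "q < 1" "q > 0"
    proof -
      show "q < 1" using \<psi>1[of "T - \<delta>"] \<psi>1[of "T + \<delta>"] \<delta> by (simp add: q_def)
      have "\<psi> (T - \<delta>) > 0" using \<delta> T by (simp add: \<psi>_def)
      then show "q > 0" by (simp add: q_def less_max_iff_disj)
    qed
    have qout: "\<psi> t \<le> q" if "t \<ge> 0" "\<bar>t - T\<bar> \<ge> \<delta>" for t
    proof (cases "t \<le> T")
      case True
      then have "t \<le> T - \<delta>" using that by auto
      then have "\<psi> t \<le> \<psi> (T - \<delta>)"
      proof (rule DERIV_nonneg_imp_nondecreasing)
        fix z assume "t \<le> z" "z \<le> T - \<delta>"
        then have "1 - z / T \<ge> 0" using T \<delta> by simp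
        then show "\<exists>d. (\<psi> has_real_derivative d) (at z) \<and> 0 \<le> d" using \<psi>'[of z] T by (intro exI[of _ "(1 - z / T) / T * exp (1 - z / T)"]) auto
      qed
      then show ?thesis by (simp add: q_def)
    next
      case False
      then have "T + \<delta> \<le> t" using that by auto
      then have "\<psi> t \<le> \<psi> (T + \<delta>)"
      proof (rule DERIV_nonpos_imp_nonincreasing)
        fix z assume "T + \<delta> \<le> z" "z \<le> t"
        then have "1 - z / T \<le> 0" using T \<delta> by simp
        then show "\<exists>d. (\<psi> has_real_derivative d) (at z) \<and> d \<le> 0"
          using \<psi>'[of z] T by (intro exI[of _ "(1 - z / T) / T * exp (1 - z / T)"]) (auto intro!: mult_nonpos_nonneg divide_nonpos_pos)
      qed
      then show ?thesis by (simp add: q_def)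
    qed
    \<comment> \<open>A level strictly between \<open>q\<close> and the maximum 1: near \<open>T\<close>, \<open>\<psi>\<close> exceeds \<open>r\<close>; away from \<open>T\<close> it is at most \<open>q\<close>.\<close>
    define r where "r = (1 + q) / 2"
    have r: "q < r" "r < 1" using q by (auto simp: r_def)
    have "isCont \<psi> T" using \<psi>c[of UNIV] by (simp add: continuous_on_eq_continuous_at)
    then have "\<forall>\<^sub>F t in nhds T. \<psi> t > r"
      using \<psi>T r by (metis continuous_at order_tendstoD(1) tendsto_at_iff_tendsto_nhds)
    then obtain \<delta>1 where \<delta>1: "\<delta>1 > 0" "\<And>t. dist t T < \<delta>1 \<Longrightarrow> \<psi> t > r" by (auto simp: eventually_nhds_metric)
    define d where "d = min \<delta>1 \<delta> / 2"
    have d: "d > 0" "d < \<delta>1" "d < \<delta>" using \<delta> \<delta>1 by (auto simp: d_def)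
    define M where "M = (LINT t:{0..}|lborel. \<psi> t * \<bar>\<phi> t\<bar>)"
    have int: "set_integrable lborel {0..} (\<lambda>t. \<psi> t ^ n * \<phi> t)"
      and val: "(LINT t:{0..}|lborel. \<psi> t ^ n * \<phi> t) = (exp 1 / T) ^ n * lap \<phi> n (real n / T)" if "n \<ge> 1" for n
    proof -
      have eq: "(\<lambda>t. \<psi> t ^ n * \<phi> t) = (\<lambda>t. (exp 1 / T) ^ n * (t ^ n * exp (- (real n / T) * t) * \<phi> t))"
      proof
        fix t
        have "exp (1 - t / T) ^ n = exp 1 ^ n * exp (- (real n / T) * t)"
          by (simp add: exp_of_nat_mult[symmetric] exp_add[symmetric] algebra_simps)
        then show "\<psi> t ^ n * \<phi> t = (exp 1 / T) ^ n * (t ^ n * exp (- (real n / T) * t) * \<phi> t)"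
          by (simp add: \<psi>_def power_mult_distrib power_divide)
      qed
      have "real n / T > 0" using that T by simp
      then show "set_integrable lborel {0..} (\<lambda>t. \<psi> t ^ n * \<phi> t)" unfolding eq
        by (intro set_integrable_mult_right lap_integrable \<phi>)
      show "(LINT t:{0..}|lborel. \<psi> t ^ n * \<phi> t) = (exp 1 / T) ^ n * lap \<phi> n (real n / T)"
        unfolding eq lap_def by simp
    qed
    have ineq: "0 \<le> q ^ n * M - \<eta> * r ^ Suc n * (2 * d)" for n
    proof -
      have i0: "set_integrable lborel {0..} (\<lambda>t. \<psi> t * \<bar>\<phi> t\<bar>)"
      proof -
        have "set_integrable lborel {0..} (\<lambda>t. \<bar>\<psi> t ^ 1 * \<phi> t\<bar>)" by (intro set_integrable_abs int) simp
        then show ?thesis by (rule set_integrable_cong[THEN iffD1, rotated -1]) (auto simp: abs_mult \<psi>0)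
      qed
      have i1: "set_integrable lborel {0..} (\<lambda>t. q ^ n * (\<psi> t * \<bar>\<phi> t\<bar>))" using i0 by (intro set_integrable_mult_right)
      have sub: "{T - d..T + d} \<subseteq> {0..}" using d \<delta> by auto
      have i2: "integrable lborel (\<lambda>t. indicator {T - d..T + d} t * (\<eta> * r ^ Suc n))"
        by (intro integrable_mult_left integrable_real_indicator) (auto simp: emeasure_lborel_Icc_eq)
      have i2': "set_integrable lborel {0..} (\<lambda>t. indicator {T - d..T + d} t * (\<eta> * r ^ Suc n))"
        unfolding set_integrable_def
        by (rule Bochner_Integration.integrable_cong[THEN iffD1, OF refl _ i2]) (use sub in \<open>auto simp: indicator_def\<close>)
      have "0 \<le> (LINT t:{0..}|lborel. \<psi> t ^ Suc n * \<phi> t)"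
        using val[of "Suc n"] pos[of "Suc n" "real (Suc n) / T"] T by simp
      also have "\<dots> \<le> (LINT t:{0..}|lborel. q ^ n * (\<psi> t * \<bar>\<phi> t\<bar>) - indicator {T - d..T + d} t * (\<eta> * r ^ Suc n))"
      proof (rule set_integral_mono)
        show "set_integrable lborel {0..} (\<lambda>t. \<psi> t ^ Suc n * \<phi> t)" by (rule int) simp
        show "set_integrable lborel {0..} (\<lambda>t. q ^ n * (\<psi> t * \<bar>\<phi> t\<bar>) - indicator {T - d..T + d} t * (\<eta> * r ^ Suc n))"
          by (intro set_integral_diff i1 i2')
        fix t :: real assume t: "t \<in> {0..}"
        show "\<psi> t ^ Suc n * \<phi> t \<le> q ^ n * (\<psi> t * \<bar>\<phi> t\<bar>) - indicator {T - d..T + d} t * (\<eta> * r ^ Suc n)"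
        proof (cases "\<bar>t - T\<bar> < \<delta>")
          case True
          then have p: "\<phi> t < - \<eta>" using \<delta>0(2)[of t] \<delta> by (simp add: dist_real_def)
          have "\<psi> t ^ Suc n * \<phi> t \<le> \<psi> t ^ Suc n * (- \<eta>)" using p \<psi>0 t by (intro mult_left_mono) auto
          also have "\<dots> \<le> - indicator {T - d..T + d} t * (\<eta> * r ^ Suc n)"
          proof (cases "t \<in> {T - d..T + d}")
            case True
            then have "\<psi> t > r" using \<delta>1(2)[of t] d by (simp add: dist_real_def abs_if split: if_splits)
            then have "r ^ Suc n \<le> \<psi> t ^ Suc n" using r q by (intro power_mono) auto
            then have "\<eta> * r ^ Suc n \<le> \<eta> * \<psi> t ^ Suc n" using \<eta> by (intro mult_left_mono) auto
            then show ?thesis using True by (simp add: mult.commute)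
          next
            case False
            then show ?thesis using \<eta> \<psi>0[of t] t by (simp add: mult_nonneg_nonneg)
          qed
          finally have "\<psi> t ^ Suc n * \<phi> t \<le> - indicator {T - d..T + d} t * (\<eta> * r ^ Suc n)" .
          moreover have "q ^ n * (\<psi> t * \<bar>\<phi> t\<bar>) \<ge> 0" using q \<psi>0 t by auto
          ultimately show ?thesis by simp
        next
          case False
          then have "\<psi> t \<le> q" using qout t by auto
          then have "\<psi> t ^ n \<le> q ^ n" using \<psi>0 t by (intro power_mono) auto
          have "\<psi> t ^ Suc n * \<phi> t \<le> \<psi> t ^ Suc n * \<bar>\<phi> t\<bar>" using \<psi>0 t by (intro mult_left_mono) auto
          also have "\<dots> = \<psi> t ^ n * (\<psi> t * \<bar>\<phi> t\<bar>)" by simp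
          also have "\<dots> \<le> q ^ n * (\<psi> t * \<bar>\<phi> t\<bar>)" using \<open>\<psi> t ^ n \<le> q ^ n\<close> \<psi>0 t by (intro mult_right_mono) auto
          finally show ?thesis using False d by (auto simp: indicator_def abs_if split: if_splits)
        qed
      qed
      also have "\<dots> = (LINT t:{0..}|lborel. q ^ n * (\<psi> t * \<bar>\<phi> t\<bar>)) - (LINT t:{0..}|lborel. indicator {T - d..T + d} t * (\<eta> * r ^ Suc n))"
        by (intro set_integral_diff i1 i2')
      also have "(LINT t:{0..}|lborel. q ^ n * (\<psi> t * \<bar>\<phi> t\<bar>)) = q ^ n * M" unfolding M_def by simp
      also have "(LINT t:{0..}|lborel. indicator {T - d..T + d} t * (\<eta> * r ^ Suc n)) = (LINT t|lborel. indicator {T - d..T + d} t * (\<eta> * r ^ Suc n))"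
        unfolding set_lebesgue_integral_def
        by (rule Bochner_Integration.integral_cong[OF refl]) (use sub in \<open>auto simp: indicator_def\<close>)
      also have "\<dots> = \<eta> * r ^ Suc n * (2 * d)" using d by simp
      finally show ?thesis .
    qed
    define c where "c = \<eta> * r * (2 * d)"
    have c: "c > 0" using \<eta> r q d by (simp add: c_def)
    have "(r / q) ^ n \<le> M / c" for n
    proof -
      have "r ^ n * c \<le> q ^ n * M" using ineq[of n] by (simp add: c_def algebra_simps)
      then show ?thesis using q c by (simp add: power_divide field_simps)
    qed
    moreover obtain n where "M / c < (r / q) ^ n" using real_arch_pow[of "r / q" "M / c"] r q by auto
    ultimately show False by (meson not_less)
  qed
  show ?thesis
  proof (cases "t > 0")
    case False
    then have t0: "t = 0" using t by simp
    have "(\<phi> \<longlongrightarrow> \<phi> 0) (at_right 0)"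
      using cont by (auto simp: continuous_on_def intro: tendsto_within_subset)
    moreover have "eventually (\<lambda>x. \<phi> x \<ge> 0) (at_right (0::real))"
      unfolding eventually_at_right_field using main by (intro exI[of _ 1]) auto
    ultimately show ?thesis unfolding t0 by (intro tendsto_lowerbound[of \<phi>]) auto
  qed (rule main)
qed

section \<open>Two exponents of opposite kind\<close>

text \<open>
  Exact values of the leading coefficients at \<open>al = 9/4\<close>, and below at \<open>al = 58/25\<close>.
\<close>

lemma g_9_4:
  shows "g (9/4) 1 = (9/8)"
    and "g (9/4) 2 = (-33/128)"
    and "g (9/4) 3 = (3/1024)"
    and "g (9/4) 4 = (297/163840)"
    and "g (9/4) 5 = (2499/1310720)"
    and "g (9/4) 6 = (50973/29360128)"
    and "g (9/4) 7 = (355725/234881024)"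
    and "g (9/4) 8 = (70258501/53687091200)"
    and "g (9/4) 9 = (3405886621/3006477107200)"
proof -
  show c1: "g (9/4) 1 = (9/8)" using g_rec[of 1 "9/4"] by simp
  have "{1..<2} = {1::nat}" by auto
  then show c2: "g (9/4) 2 = (-33/128)" using g_rec[of 2 "9/4"] by (simp add: c1 c1[unfolded One_nat_def])
  have "{1..<3} = {1, 2::nat}" by auto
  then show c3: "g (9/4) 3 = (3/1024)" using g_rec[of 3 "9/4"] by (simp add: c1 c2 c1[unfolded One_nat_def])
  have "{1..<4} = {1, 2, 3::nat}" by auto
  then show c4: "g (9/4) 4 = (297/163840)" using g_rec[of 4 "9/4"] by (simp add: c1 c2 c3 c1[unfolded One_nat_def])
  have "{1..<5} = {1, 2, 3, 4::nat}" by auto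
  then show c5: "g (9/4) 5 = (2499/1310720)" using g_rec[of 5 "9/4"] by (simp add: c1 c2 c3 c4 c1[unfolded One_nat_def])
  have "{1..<6} = {1, 2, 3, 4, 5::nat}" by auto
  then show c6: "g (9/4) 6 = (50973/29360128)" using g_rec[of 6 "9/4"] by (simp add: c1 c2 c3 c4 c5 c1[unfolded One_nat_def])
  have "{1..<7} = {1, 2, 3, 4, 5, 6::nat}" by auto
  then show c7: "g (9/4) 7 = (355725/234881024)" using g_rec[of 7 "9/4"] by (simp add: c1 c2 c3 c4 c5 c6 c1[unfolded One_nat_def])
  have "{1..<8} = {1, 2, 3, 4, 5, 6, 7::nat}" by auto
  then show c8: "g (9/4) 8 = (70258501/53687091200)" using g_rec[of 8 "9/4"] by (simp add: c1 c2 c3 c4 c5 c6 c7 c1[unfolded One_nat_def])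
  have "{1..<9} = {1, 2, 3, 4, 5, 6, 7, 8::nat}" by auto
  then show c9: "g (9/4) 9 = (3405886621/3006477107200)" using g_rec[of 9 "9/4"] by (simp add: c1 c2 c3 c4 c5 c6 c7 c8 c1[unfolded One_nat_def])
qed

lemma g_58_25:
  shows "g (58/25) 1 = (29/25)"
    and "g (58/25) 2 = (-1073/3750)"
    and "g (58/25) 3 = (232/46875)"
    and "g (58/25) 4 = (47357/28125000)"
    and "g (58/25) 5 = (672133/390625000)"
    and "g (58/25) 6 = (17520121277/11074218750000)"
    and "g (58/25) 7 = (96327350939/69213867187500)"
    and "g (58/25) 8 = (28712840774779/23730468750000000)"
    and "g (58/25) 9 = (4369339762300307/4152832031250000000)"
    and "g (58/25) 10 = (31491749850971240851/34260864257812500000000)"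
    and "g (58/25) 11 = (300382363167017284/371754169464111328125)"
proof -
  show c1: "g (58/25) 1 = (29/25)" using g_rec[of 1 "58/25"] by simp
  have "{1..<2} = {1::nat}" by auto
  then show c2: "g (58/25) 2 = (-1073/3750)" using g_rec[of 2 "58/25"] by (simp add: c1 c1[unfolded One_nat_def])
  have "{1..<3} = {1, 2::nat}" by auto
  then show c3: "g (58/25) 3 = (232/46875)" using g_rec[of 3 "58/25"] by (simp add: c1 c2 c1[unfolded One_nat_def])
  have "{1..<4} = {1, 2, 3::nat}" by auto
  then show c4: "g (58/25) 4 = (47357/28125000)" using g_rec[of 4 "58/25"] by (simp add: c1 c2 c3 c1[unfolded One_nat_def])
  have "{1..<5} = {1, 2, 3, 4::nat}" by auto
  then show c5: "g (58/25) 5 = (672133/390625000)" using g_rec[of 5 "58/25"] by (simp add: c1 c2 c3 c4 c1[unfolded One_nat_def])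
  have "{1..<6} = {1, 2, 3, 4, 5::nat}" by auto
  then show c6: "g (58/25) 6 = (17520121277/11074218750000)" using g_rec[of 6 "58/25"] by (simp add: c1 c2 c3 c4 c5 c1[unfolded One_nat_def])
  have "{1..<7} = {1, 2, 3, 4, 5, 6::nat}" by auto
  then show c7: "g (58/25) 7 = (96327350939/69213867187500)" using g_rec[of 7 "58/25"] by (simp add: c1 c2 c3 c4 c5 c6 c1[unfolded One_nat_def])
  have "{1..<8} = {1, 2, 3, 4, 5, 6, 7::nat}" by auto
  then show c8: "g (58/25) 8 = (28712840774779/23730468750000000)" using g_rec[of 8 "58/25"] by (simp add: c1 c2 c3 c4 c5 c6 c7 c1[unfolded One_nat_def])
  have "{1..<9} = {1, 2, 3, 4, 5, 6, 7, 8::nat}" by auto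
  then show c9: "g (58/25) 9 = (4369339762300307/4152832031250000000)" using g_rec[of 9 "58/25"] by (simp add: c1 c2 c3 c4 c5 c6 c7 c8 c1[unfolded One_nat_def])
  have "{1..<10} = {1, 2, 3, 4, 5, 6, 7, 8, 9::nat}" by auto
  then show c10: "g (58/25) 10 = (31491749850971240851/34260864257812500000000)" using g_rec[of 10 "58/25"] by (simp add: c1 c2 c3 c4 c5 c6 c7 c8 c9 c1[unfolded One_nat_def])
  have "{1..<11} = insert 10 {1..<10::nat}" "{1..<10} = {1, 2, 3, 4, 5, 6, 7, 8, 9::nat}" by auto
  then show c11: "g (58/25) 11 = (300382363167017284/371754169464111328125)" using g_rec[of 11 "58/25"] by (simp add: c1 c2 c3 c4 c5 c6 c7 c8 c9 c10 c1[unfolded One_nat_def])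
qed


lemma g_dens_sums: "(\<lambda>n. g al (Suc n) * t ^ n / fact n) sums dens al 0 t"
  using dens_sums[of al 0 t] by (simp add: g_def)

text \<open>
  All coefficients but the second are nonnegative, so the series may be cut off, and every
  power may be replaced by its tangent at \<open>53/10\<close>, a point close to the minimum. The resulting
  linear function is positive on the half-line.
\<close>

lemma dens_9_4_nonneg:
  assumes t: "t \<ge> 0"
  shows "dens (9/4) 0 t \<ge> 0"
proof -
  define c where "c = (\<lambda>n. g (9/4) (Suc n) * t ^ n / fact n)"
  define u where "u = t / (53/10) - 1"
  have u: "u \<ge> -1" "t = 53/10 * (1 + u)" using t by (auto simp: u_def)
  have tangent: "t ^ n \<ge> (53/10) ^ n * (1 + real n * u)" for n
    unfolding u(2) power_mult_distrib by (intro mult_left_mono Bernoulli_inequality u) auto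
  have le: "c n \<ge> g (9/4) (Suc n) * ((53/10) ^ n * (1 + real n * u)) / fact n" if "n \<ge> 2" for n
    unfolding c_def using that by (intro divide_right_mono mult_left_mono tangent g_nonneg) auto
  have "(\<Sum>n<9. c n) \<le> suminf c"
  proof (rule sum_le_suminf)
    show "summable c" unfolding c_def by (rule sums_summable[OF g_dens_sums])
    fix n :: nat assume "n \<in> - {..<9}"
    then have "g (9/4) (Suc n) \<ge> 0" by (intro g_nonneg) auto
    then show "0 \<le> c n" unfolding c_def using t by (intro divide_nonneg_nonneg mult_nonneg_nonneg) auto
  qed auto
  also have "suminf c = dens (9/4) 0 t" unfolding c_def using g_dens_sums[of "9/4" t] by (simp add: sums_iff)
  finally have 1: "(\<Sum>n<9. c n) \<le> dens (9/4) 0 t" .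
  have "{..<9} = {0, 1, 2, 3, 4, 5, 6, 7, 8::nat}" by auto
  then have 2: "(\<Sum>n<9. c n) = c 0 + c 1 + c 2 + c 3 + c 4 + c 5 + c 6 + c 7 + c 8" by simp
  have c01: "c 0 = 9/8" "c 1 = (-33/128) * (53/10 * (1 + u))"
    using g_9_4(1,2) by (simp_all add: c_def u(2) numeral_2_eq_2)
  have l: "c 2 \<ge> 8427/204800 * (1 + 2 * u)"
    "c 3 \<ge> 14738823/327680000 * (1 + 3 * u)"
    "c 4 \<ge> 6572770673/104857600000 * (1 + 4 * u)"
    "c 5 \<ge> 7105559621563/117440512000000 * (1 + 5 * u)"
    "c 6 \<ge> 35041854944949/751619276800000 * (1 + 6 * u)"
    "c 7 \<ge> 82533443792949004337/2705829396480000000000 * (1 + 7 * u)"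
    "c 8 \<ge> 212049446599656416301181/12122115696230400000000000 * (1 + 8 * u)"
    using le[of 2] le[of 3] le[of 4] le[of 5] le[of 6] le[of 7] le[of 8] g_9_4
    by (simp_all add: fact_numeral power_divide)
  define v where "v = 1 + u"
  have v: "v \<ge> 0" "u = v - 1" using u by (auto simp: v_def)
  \<comment> \<open>Coefficients rounded to thousandths, downwards for \<open>v\<close> and upwards for the subtracted constant.\<close>
  have l2: "c 2 \<ge> 82/1000 * v - 42/1000" using l(1) v(1) unfolding v(2) by simp
  have l3: "c 3 \<ge> 134/1000 * v - 90/1000" using l(2) v(1) unfolding v(2) by simp
  have l4: "c 4 \<ge> 250/1000 * v - 189/1000" using l(3) v(1) unfolding v(2) by simp
  have l5: "c 5 \<ge> 302/1000 * v - 243/1000" using l(4) v(1) unfolding v(2) by simp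
  have l6: "c 6 \<ge> 279/1000 * v - 234/1000" using l(5) v(1) unfolding v(2) by simp
  have l7: "c 7 \<ge> 213/1000 * v - 184/1000" using l(6) v(1) unfolding v(2) by simp
  have l8: "c 8 \<ge> 139/1000 * v - 123/1000" using l(7) v(1) unfolding v(2) by simp
  have "c 0 + c 1 \<ge> 1125/1000 - 1367/1000 * v" unfolding c01 using v(1) by (simp add: v_def[symmetric])
  then have "c 0 + c 1 + c 2 + c 3 + c 4 + c 5 + c 6 + c 7 + c 8 \<ge> 0"
    using l2 l3 l4 l5 l6 l7 l8 v(1) by linarith
  then show ?thesis using 1 2 by simp
qed

lemma g_58_25_upper: "n \<ge> 12 \<Longrightarrow> g (58/25) n \<le> 3/10 / 132"
proof -
  assume n: "n \<ge> 12"
  define N where "N = real n"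
  have N: "N \<ge> 12" using n by (simp add: N_def)
  have "N * g (58/25) n \<le> (58/25) / (N + 1) - (58/25)\<^sup>2 / (2 * N) - (58/25) * g (58/25) 2 / (N - 1)"
    unfolding N_def using n by (intro g_upper) auto
  also have "\<dots> \<le> 3/10 / (N - 1)"
  proof -
    have g2: "g (58/25) 2 = - (1073/3750)" using g_58_25(2) by simp
    have nz: "N + 1 \<noteq> 0" "N \<noteq> 0" "N - 1 \<noteq> 0" using N by auto
    have "3/10 / (N - 1) - ((58/25) / (N + 1) - (58/25)\<^sup>2 / (2 * N) - (58/25) * g (58/25) 2 / (N - 1))
        = (691/93750 * (N * N) + 183391/93750 * N - 1682/625) / (N * (N + 1) * (N - 1))"
      unfolding g2 using nz by (simp add: divide_simps power2_eq_square) (simp add: algebra_simps)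
    also have "\<dots> \<ge> 0"
    proof (intro divide_nonneg_nonneg)
      have "N * N \<ge> 0" by simp
      then show "691/93750 * (N * N) + 183391/93750 * N - 1682/625 \<ge> 0" using N by linarith
    qed (use N in auto)
    finally show ?thesis by simp
  qed
  finally have "g (58/25) n \<le> 3/10 / (N - 1) / N" using N by (simp add: field_simps)
  also have "\<dots> = 3/10 / ((N - 1) * N)" by simp
  also have "\<dots> \<le> 3/10 / (11 * 12)" using N by (intro divide_left_mono mult_mono) auto
  finally show ?thesis by simp
qed

text \<open>
  Eleven exact terms give a value below \<open>-0.021\<close>. The remaining coefficients are at most
  \<open>0.3 / 132\<close> by \<open>g_upper\<close>, so their contribution is bounded by a multiple of the tail of \<open>exp 5\<close>.
\<close>

lemma dens_58_25_neg: "dens (58/25) 0 5 < 0"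
proof -
  define c where "c = (\<lambda>n. g (58/25) (Suc n) * 5 ^ n / fact n)"
  define e where "e = (\<lambda>n. 5 ^ n / fact n :: real)"
  have e: "e sums exp 5" unfolding e_def using exp_converges[of "5::real"] by (simp add: divide_inverse mult.commute)
  have c: "c sums dens (58/25) 0 5" unfolding c_def by (rule g_dens_sums)
  have tc: "(\<lambda>n. c (n + 11)) sums (dens (58/25) 0 5 - (\<Sum>n<11. c n))" by (rule sums_split_initial_segment[OF c])
  have te: "(\<lambda>n. 3/10 / 132 * e (n + 11)) sums (3/10 / 132 * (exp 5 - (\<Sum>n<11. e n)))"
    by (intro sums_mult sums_split_initial_segment[OF e])
  have "dens (58/25) 0 5 - (\<Sum>n<11. c n) \<le> 3/10 / 132 * (exp 5 - (\<Sum>n<11. e n))"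
  proof (rule sums_le[OF _ tc te])
    fix n
    have "g (58/25) (Suc (n + 11)) \<le> 3/10 / 132" by (rule g_58_25_upper) simp
    then have "g (58/25) (Suc (n + 11)) * e (n + 11) \<le> 3/10 / 132 * e (n + 11)"
      by (intro mult_right_mono) (simp_all add: e_def)
    then show "c (n + 11) \<le> 3/10 / 132 * e (n + 11)" by (simp add: c_def e_def)
  qed
  moreover have "exp 5 < (149::real)"
  proof -
    have "exp (5::real) = exp 1 ^ 5" by (simp flip: exp_of_nat_mult)
    also have "\<dots> < (272/100) ^ 5" using e_less_272 by (intro power_strict_mono) auto
    also have "\<dots> < 149" by (simp add: power_divide)
    finally show ?thesis .
  qed
  moreover have "{..<11} = insert 10 {..<10::nat}" "{..<10} = {0, 1, 2, 3, 4, 5, 6, 7, 8, 9::nat}" by auto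
  then have "(\<Sum>n<11. c n) < - 0.021 \<and> (\<Sum>n<11. e n) > 146"
    by (simp add: c_def e_def fact_numeral g_58_25 g_58_25(1)[unfolded One_nat_def] g_58_25(2)[unfolded numeral_2_eq_2])
  ultimately show ?thesis by simp
qed

section \<open>Bernstein functions and nonnegative densities\<close>

definition NF :: "real \<Rightarrow> real \<Rightarrow> real \<Rightarrow> real" where
  "NF a c y = exp (- a) * (1 + 1 / y) powr (a * y - c)"

lemma NF_lap: "y > 0 \<Longrightarrow> NF a c y = 1 - lap (ker a c) 0 y"
  by (simp add: lap_ker NF_def)

lemma NF_pos: "y > 0 \<Longrightarrow> NF a c y > 0"
proof -
  assume "y > 0"
  then have "1 + 1 / y > 0" by (simp add: add_pos_pos)
  then show ?thesis by (simp add: NF_def)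
qed

lemma NF_derivative:
  assumes "y > 0"
  shows "(NF a c has_real_derivative lap (ker a c) 1 y) (at y)"
proof -
  have "((\<lambda>y. 1 - lap (ker a c) 0 y) has_real_derivative 0 - (- lap (ker a c) (Suc 0) y)) (at y)"
    by (rule DERIV_diff[OF DERIV_const lap_has_derivative[OF ker_subexp assms]])
  then show ?thesis
    by (rule has_derivative_transform_pos[rotated 2, THEN DERIV_cong]) (use assms in \<open>auto simp: NF_lap\<close>)
qed

lemma NF_powr: "y > 0 \<Longrightarrow> NF (p * a) (p * c) y = NF a c y powr p"
proof -
  assume "y > 0"
  then have "1 + 1 / y > 0" by (simp add: add_pos_pos)
  then have "NF a c y powr p = exp (- a) powr p * (1 + 1 / y) powr ((a * y - c) * p)"
    by (simp add: NF_def powr_mult powr_powr)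
  also have "exp (- a) powr p = exp (- (p * a))" by (simp add: powr_def)
  also have "(a * y - c) * p = p * a * y - p * c" by (simp add: algebra_simps)
  finally show ?thesis by (simp add: NF_def)
qed

lemma ker_nonneg_iff: "ker a c t \<ge> 0 \<longleftrightarrow> dens a c t \<ge> 0"
  by (simp add: ker_def zero_le_mult_iff)

lemma subexp_diff_scaled:
  assumes "subexp \<phi>" "subexp \<psi>"
  shows "subexp (\<lambda>t. \<phi> t - p * \<psi> t)"
  unfolding subexp_def
proof (intro conjI allI impI)
  show "continuous_on {0..} (\<lambda>t. \<phi> t - p * \<psi> t)"
    using assms by (intro continuous_intros) (auto simp: subexp_def)
  fix e :: real assume e: "e > 0"
  obtain A where A: "\<And>t. t \<ge> 0 \<Longrightarrow> \<bar>\<phi> t\<bar> \<le> A * exp (e * t)" using assms(1) e by (meson subexp_def)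
  obtain B where B: "\<And>t. t \<ge> 0 \<Longrightarrow> \<bar>\<psi> t\<bar> \<le> B * exp (e * t)" using assms(2) e by (meson subexp_def)
  show "\<exists>C. \<forall>t\<ge>0. \<bar>\<phi> t - p * \<psi> t\<bar> \<le> C * exp (e * t)"
  proof (intro exI allI impI)
    fix t :: real assume t: "t \<ge> 0"
    have "\<bar>\<phi> t - p * \<psi> t\<bar> \<le> \<bar>\<phi> t\<bar> + \<bar>p\<bar> * \<bar>\<psi> t\<bar>"
      using abs_triangle_ineq4[of "\<phi> t" "p * \<psi> t"] by (simp add: abs_mult)
    also have "\<dots> \<le> A * exp (e * t) + \<bar>p\<bar> * (B * exp (e * t))"
      using A[OF t] B[OF t] by (intro add_mono mult_left_mono) auto
    also have "\<dots> = (A + \<bar>p\<bar> * B) * exp (e * t)" by (simp add: algebra_simps)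
    finally show "\<bar>\<phi> t - p * \<psi> t\<bar> \<le> (A + \<bar>p\<bar> * B) * exp (e * t)" .
  qed
qed

lemma lap_diff_scaled:
  assumes "subexp \<phi>" "subexp \<psi>" "y > 0"
  shows "lap (\<lambda>t. \<phi> t - p * \<psi> t) n y = lap \<phi> n y - p * lap \<psi> n y"
proof -
  have "lap (\<lambda>t. \<phi> t - p * \<psi> t) n y
     = (LINT t:{0..}|lborel. t ^ n * exp (- y * t) * \<phi> t - p * (t ^ n * exp (- y * t) * \<psi> t))"
    unfolding lap_def by (simp add: algebra_simps)
  also have "\<dots> = lap \<phi> n y - p * lap \<psi> n y"
    unfolding lap_def
    by (subst set_integral_diff(2)[OF lap_integrable[OF assms(1,3)] set_integrable_mult_right[OF lap_integrable[OF assms(2,3)]]]) simp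
  finally show ?thesis .
qed

lemma lap_inversion_cm:
  assumes "subexp \<phi>" "\<And>n. cm_upto n f" "\<forall>y>0. f y = lap \<phi> 1 y" "t \<ge> 0"
  shows "\<phi> t \<ge> 0"
proof (rule lap_inversion[OF assms(1) _ assms(4)])
  fix n :: nat and y :: real assume n: "n \<ge> 1" and y: "y > 0"
  then obtain m where m: "n = Suc m" by (cases n) auto
  have "lap \<phi> (Suc m) y \<ge> 0"
    by (rule cm_upto_family_nonneg[where G = "\<lambda>i. lap \<phi> (Suc i)", OF _ assms(2)])
       (use assms y in \<open>auto intro: lap_has_derivative\<close>)
  then show "lap \<phi> n y \<ge> 0" by (simp add: m)
qed

text \<open>
  Let \<open>N = NF a c\<close>, so \<open>0 < N \<le> 1\<close> and \<open>N' = lap (ker a c) 1\<close> is completely monotone. The derivative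
  of \<open>N powr p - p * N\<close> is \<open>p * (N powr (p - 1) - 1) * N'\<close>, a product of completely monotone functions. It
  is also the transform, with \<open>n = 1\<close>, of the difference of the two kernels, to which the inversion applies.
\<close>

theorem dens_power:
  assumes pos: "\<forall>t\<ge>0. dens a c t \<ge> 0" and p: "0 < p" "p \<le> 1" and t: "t \<ge> 0"
  shows "dens (p * a) (p * c) t \<ge> p * dens a c t"
proof -
  let ?N = "NF a c" and ?l = "lap (ker a c)"
  have kpos: "\<forall>t\<ge>0. ker a c t \<ge> 0" using pos by (simp add: ker_nonneg_iff)
  have cml: "cm_upto n (?l k)" for n k by (intro cm_upto_lap ker_subexp kpos)
  have cmN: "cm_upto n (\<lambda>y. ?N y powr (- (1 - p)))" for n
    using p by (intro cm_upto_neg_powr[OF NF_pos NF_derivative cml]) auto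
  have N1: "?N y \<le> 1" if "y > 0" for y using NF_lap[OF that, of a c] lap_nonneg[OF kpos] by simp
  have cmd: "cm_upto n (\<lambda>y. ?N y powr (- (1 - p)) - 1)" for n
  proof -
    have nn: "?N y powr (- (1 - p)) - 1 \<ge> 0" if "y > 0" for y
    proof -
      have "?N y powr (1 - p) \<le> 1" using N1[OF that] NF_pos[OF that, of a c] p by (intro powr_le1) auto
      then have "1 \<le> inverse (?N y powr (1 - p))" using NF_pos[OF that, of a c] by (intro one_le_inverse) auto
      then show ?thesis by (simp only: powr_minus)
    qed
    obtain f' where f': "\<forall>y>0. ((\<lambda>y. ?N y powr (- (1 - p))) has_real_derivative - f' y) (at y)" "cm_upto n f'"
      using cmN[of "Suc n"] by (rule cm_upto_SucE)
    have "cm_upto (Suc n) (\<lambda>y. ?N y powr (- (1 - p)) - 1)"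
    proof (rule cm_upto_SucI[OF nn _ f'(2)])
      fix y :: real assume "y > 0"
      then have "((\<lambda>y. ?N y powr (- (1 - p)) - 1) has_real_derivative - f' y - 0) (at y)"
        using f' by (intro DERIV_diff DERIV_const) auto
      then show "((\<lambda>y. ?N y powr (- (1 - p)) - 1) has_real_derivative - f' y) (at y)" by simp
    qed
    then show ?thesis by (rule cm_upto_Suc_D)
  qed
  define \<phi> where "\<phi> = (\<lambda>t. ker (p * a) (p * c) t - p * ker a c t)"
  have "\<phi> t \<ge> 0"
  proof (rule lap_inversion_cm[OF _ _ _ t])
    show "subexp \<phi>" unfolding \<phi>_def by (intro subexp_diff_scaled ker_subexp)
    show "cm_upto n (\<lambda>y. p * ((?N y powr (- (1 - p)) - 1) * ?l 1 y))" for n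
      using p by (intro cm_upto_mult cm_upto_const cmd cml) auto
    show "\<forall>y>0. p * ((?N y powr (- (1 - p)) - 1) * ?l 1 y) = lap \<phi> 1 y"
    proof (intro allI impI)
      fix y :: real assume y: "y > 0"
      have "((\<lambda>y. ?N y powr p) has_real_derivative (p * ?N y powr (p - 1)) * ?l 1 y) (at y)"
        using NF_pos[OF y, of a c] NF_derivative[OF y] by (intro DERIV_chain2[OF has_real_derivative_powr]) auto
      then have "(NF (p * a) (p * c) has_real_derivative (p * ?N y powr (p - 1)) * ?l 1 y) (at y)"
        by (rule has_derivative_transform_pos[rotated 2]) (use y in \<open>auto simp: NF_powr\<close>)
      from DERIV_unique[OF this NF_derivative[OF y]]
      have "lap (ker (p * a) (p * c)) 1 y = p * ?N y powr (p - 1) * ?l 1 y" by simp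
      then show "p * ((?N y powr (- (1 - p)) - 1) * ?l 1 y) = lap \<phi> 1 y"
        unfolding \<phi>_def by (subst lap_diff_scaled[OF ker_subexp ker_subexp y]) (simp add: algebra_simps)
    qed
  qed
  then have "exp (- t) * (p * dens a c t) \<le> exp (- t) * dens (p * a) (p * c) t"
    by (simp add: \<phi>_def ker_def algebra_simps)
  then show ?thesis by simp
qed

lemma bernstein_scale:
  assumes "bernstein_function f" "k > 0" "\<forall>x>0. f2 x = f (k * x)"
  shows "bernstein_function f2"
proof (rule bernstein_functionI)
  fix x :: real assume x: "x > 0"
  show "f2 x \<ge> 0" using bernstein_functionD(1)[OF assms(1)] assms x by simp
  have "((\<lambda>x. f (k * x)) has_real_derivative deriv f (k * x) * k) (at x)"
    using bernstein_functionD(2)[OF assms(1), of "k * x"] assms(2) x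
    by (intro DERIV_chain2[of f]) (auto intro!: derivative_eq_intros)
  then show "(f2 has_real_derivative deriv f (k * x) * k) (at x)"
    by (rule has_derivative_transform_pos[rotated 2]) (use assms x in auto)
next
  show "cm_upto n (\<lambda>x. deriv f (k * x) * k)" for n
    using assms(2) by (intro cm_upto_mult cm_upto_const cm_upto_scale bernstein_functionD(3)[OF assms(1)]) auto
qed

lemma bernstein_NF:
  assumes "\<forall>t\<ge>0. dens a c t \<ge> 0" "C \<ge> 0"
  shows "bernstein_function (\<lambda>y. C * NF a c y)"
proof (rule bernstein_functionI)
  fix y :: real assume y: "y > 0"
  show "C * NF a c y \<ge> 0" using NF_pos[OF y, of a c] assms by simp
  show "((\<lambda>y. C * NF a c y) has_real_derivative C * lap (ker a c) 1 y) (at y)"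
    by (intro DERIV_cmult NF_derivative y)
next
  show "cm_upto n (\<lambda>y. C * lap (ker a c) 1 y)" for n
    using assms by (intro cm_upto_mult cm_upto_const cm_upto_lap ker_subexp) (auto simp: ker_nonneg_iff)
qed

lemma h_NF: "y > 0 \<Longrightarrow> h \<alpha> y = exp \<alpha> * NF \<alpha> 0 y"
  by (simp add: h_def NF_def exp_minus)

text \<open>
  Both directions read \<open>h\<close> as \<open>exp \<alpha> * NF \<alpha> 0\<close>, whose derivative is a positive multiple of
  \<open>lap (ker \<alpha> 0) 1\<close>.
\<close>

lemma bernstein_h_iff: "bernstein_function (h \<alpha>) \<longleftrightarrow> (\<forall>t\<ge>0. dens \<alpha> 0 t \<ge> 0)"
proof
  assume B: "bernstein_function (h \<alpha>)"
  show "\<forall>t\<ge>0. dens \<alpha> 0 t \<ge> 0"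
  proof (intro allI impI)
    fix t :: real assume t: "t \<ge> 0"
    have "ker \<alpha> 0 t \<ge> 0"
    proof (rule lap_inversion_cm[OF ker_subexp _ _ t])
      show "cm_upto n (\<lambda>y. exp (- \<alpha>) * deriv (h \<alpha>) y)" for n
        by (intro cm_upto_mult cm_upto_const bernstein_functionD(3)[OF B]) auto
      show "\<forall>y>0. exp (- \<alpha>) * deriv (h \<alpha>) y = lap (ker \<alpha> 0) 1 y"
      proof (intro allI impI)
        fix y :: real assume y: "y > 0"
        have "((\<lambda>y. exp \<alpha> * NF \<alpha> 0 y) has_real_derivative exp \<alpha> * lap (ker \<alpha> 0) 1 y) (at y)"
          by (intro DERIV_cmult NF_derivative y)
        then have "(h \<alpha> has_real_derivative exp \<alpha> * lap (ker \<alpha> 0) 1 y) (at y)"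
          by (rule has_derivative_transform_pos[rotated 2]) (use y in \<open>auto simp: h_NF\<close>)
        then show "exp (- \<alpha>) * deriv (h \<alpha>) y = lap (ker \<alpha> 0) 1 y" by (simp add: DERIV_imp_deriv exp_minus)
      qed
    qed
    then show "dens \<alpha> 0 t \<ge> 0" by (simp add: ker_nonneg_iff)
  qed
next
  assume "\<forall>t\<ge>0. dens \<alpha> 0 t \<ge> 0"
  from bernstein_NF[OF this, of "exp \<alpha>"] have "bernstein_function (\<lambda>y. exp \<alpha> * NF \<alpha> 0 y)" by simp
  then show "bernstein_function (h \<alpha>)" by (rule bernstein_scale[of _ 1]) (auto simp: h_NF)
qed

lemma nu_continuous: "continuous_on A (\<lambda>a. nu a 0 n)"
proof (induction n rule: less_induct)
  case (less n)
  show ?case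
  proof (cases n)
    case (Suc m)
    show ?thesis unfolding Suc nu.simps(2) cf_def
      by (intro continuous_intros less) (use Suc in auto)
  qed simp
qed

lemma dens_continuous_parameter: "continuous_on {0..3} (\<lambda>a. dens a 0 t)"
proof -
  have "uniform_limit {0..3} (\<lambda>k a. \<Sum>n<k. - nu a 0 (Suc n) * t ^ n / fact n) (\<lambda>a. \<Sum>n. - nu a 0 (Suc n) * t ^ n / fact n) sequentially"
  proof (rule Weierstrass_m_test)
    show "summable (\<lambda>n. 4 * ((4 * \<bar>t\<bar>) ^ n / fact n))"
      using summable_exp[of "4 * \<bar>t\<bar>"] by (intro summable_mult) (simp add: divide_inverse mult.commute)
    fix n :: nat and a :: real assume a: "a \<in> {0..3}"
    have "\<bar>nu a 0 (Suc n)\<bar> \<le> (3 + 1) ^ Suc n" by (rule nu_le_power) (use a in simp)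
    then have "\<bar>nu a 0 (Suc n)\<bar> \<le> 4 ^ Suc n" by simp
    then have le: "\<bar>nu a 0 (Suc n)\<bar> * \<bar>t\<bar> ^ n / fact n \<le> 4 ^ Suc n * \<bar>t\<bar> ^ n / fact n"
      by (intro divide_right_mono mult_right_mono) auto
    have "norm (- nu a 0 (Suc n) * t ^ n / fact n) = \<bar>nu a 0 (Suc n)\<bar> * \<bar>t\<bar> ^ n / fact n"
      by (simp add: abs_mult power_abs)
    moreover have "4 ^ Suc n * \<bar>t\<bar> ^ n / fact n = 4 * ((4 * \<bar>t\<bar>) ^ n / fact n)"
      by (simp add: power_mult_distrib)
    moreover note le
    ultimately show "norm (- nu a 0 (Suc n) * t ^ n / fact n) \<le> 4 * ((4 * \<bar>t\<bar>) ^ n / fact n)"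
      by linarith
  qed
  then show ?thesis unfolding dens_def
    by (rule uniform_limit_theorem[rotated]) (auto intro!: always_eventually continuous_intros nu_continuous)
qed

definition bernstein_exponents :: "real set" where
  "bernstein_exponents = {\<alpha>. \<alpha> > 0 \<and> bernstein_function (h \<alpha>)}"

lemma bernstein_exponents_eq: "bernstein_exponents = {\<alpha>. \<alpha> > 0 \<and> (\<forall>t\<ge>0. dens \<alpha> 0 t \<ge> 0)}"
  by (simp add: bernstein_exponents_def bernstein_h_iff)

lemma bernstein_exponents_down:
  assumes "\<alpha> \<in> bernstein_exponents" "0 < \<beta>" "\<beta> \<le> \<alpha>"
  shows "\<beta> \<in> bernstein_exponents"
proof -
  have \<alpha>: "\<alpha> > 0" "\<forall>t\<ge>0. dens \<alpha> 0 t \<ge> 0" using assms by (auto simp: bernstein_exponents_eq)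
  have "dens (\<beta> / \<alpha> * \<alpha>) (\<beta> / \<alpha> * 0) t \<ge> \<beta> / \<alpha> * dens \<alpha> 0 t" if "t \<ge> 0" for t
    using \<alpha> assms that by (intro dens_power) auto
  then have 1: "dens \<beta> 0 t \<ge> \<beta> / \<alpha> * dens \<alpha> 0 t" if "t \<ge> 0" for t using that \<alpha>(1) by simp
  have 2: "\<beta> / \<alpha> * dens \<alpha> 0 t \<ge> 0" if "t \<ge> 0" for t using \<alpha> assms that by simp
  have "dens \<beta> 0 t \<ge> 0" if "t \<ge> 0" for t using order_trans[OF 2[OF that] 1[OF that]] .
  then show ?thesis using assms by (simp add: bernstein_exponents_eq)
qed

lemma bernstein_exponents_le: "\<alpha> \<in> bernstein_exponents \<Longrightarrow> \<alpha> \<le> 58/25"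
proof (rule ccontr)
  assume \<alpha>: "\<alpha> \<in> bernstein_exponents" and "\<not> \<alpha> \<le> 58/25"
  then have "58/25 \<in> bernstein_exponents" by (intro bernstein_exponents_down[OF \<alpha>]) auto
  then have "dens (58/25) 0 5 \<ge> 0" by (auto simp: bernstein_exponents_eq)
  with dens_58_25_neg show False by simp
qed

lemma bdd_above_bernstein_exponents: "bdd_above bernstein_exponents"
  using bernstein_exponents_le by (rule bdd_aboveI)

lemma alpha_star_eq: "alpha_star = Sup bernstein_exponents"
  by (simp add: alpha_star_def bernstein_exponents_def)

lemma nine_quarters_mem: "9/4 \<in> bernstein_exponents"
  using dens_9_4_nonneg by (simp add: bernstein_exponents_eq)

lemma alpha_star_bounds: "9/4 \<le> alpha_star" "alpha_star \<le> 58/25"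
proof -
  note mem = nine_quarters_mem
  show "9/4 \<le> alpha_star" unfolding alpha_star_eq by (rule cSup_upper[OF mem bdd_above_bernstein_exponents])
  show "alpha_star \<le> 58/25" unfolding alpha_star_eq
    by (rule cSup_least) (use mem bernstein_exponents_le in auto)
qed

text \<open>
  The supremum is attained: below it \<open>dens\<close> is nonnegative, and \<open>dens\<close> is continuous in the exponent.
\<close>

lemma dens_alpha_star_nonneg:
  assumes t: "t \<ge> 0"
  shows "dens alpha_star 0 t \<ge> 0"
proof -
  have below: "dens \<beta> 0 t \<ge> 0" if b: "0 < \<beta>" "\<beta> < alpha_star" for \<beta>
  proof -
    have ne: "bernstein_exponents \<noteq> {}" using nine_quarters_mem by blast
    obtain \<alpha> where \<alpha>: "\<alpha> \<in> bernstein_exponents" "\<beta> < \<alpha>"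
      using b(2) unfolding alpha_star_eq less_cSup_iff[OF ne bdd_above_bernstein_exponents] by (rule bexE)
    then have "\<beta> \<in> bernstein_exponents" by (intro bernstein_exponents_down[OF \<alpha>(1)]) (use b \<alpha>(2) in auto)
    then show ?thesis using t by (auto simp: bernstein_exponents_eq)
  qed
  have "alpha_star \<in> {0<..<3}" using alpha_star_bounds by auto
  then have "isCont (\<lambda>a. dens a 0 t) alpha_star"
    using dens_continuous_parameter[of t] by (intro continuous_on_interior[of "{0..3}"]) auto
  then have "((\<lambda>a. dens a 0 t) \<longlongrightarrow> dens alpha_star 0 t) (at_left alpha_star)"
    unfolding continuous_at by (rule tendsto_mono[rotated]) (simp add: at_le)
  moreover have "eventually (\<lambda>a. dens a 0 t \<ge> 0) (at_left alpha_star)"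
    unfolding eventually_at_left_field using below alpha_star_bounds by (intro exI[of _ 1]) auto
  ultimately show ?thesis by (rule tendsto_lowerbound) simp
qed

section \<open>The functions F\<close>

lemma F_NF: "a > 0 \<Longrightarrow> x > 0 \<Longrightarrow> F a b x = exp a * NF a (- b) (1 / a * x)"
  by (simp add: F_def NF_def exp_minus)

lemma bernstein_F:
  assumes "a > 0" "\<forall>t\<ge>0. dens a (- b) t \<ge> 0"
  shows "bernstein_function (F a b)"
  using assms by (intro bernstein_scale[OF bernstein_NF[OF assms(2), of "exp a"], of "1 / a"]) (auto simp: F_NF)

lemma F_tendsto_0:
  assumes "a > 0" "b \<le> 0"
  shows "(F a b \<longlongrightarrow> kappa b) (at_right 0)"
proof (cases "b = 0")
  case True
  have "((\<lambda>x. (1 + a / x) powr (x + 0)) \<longlongrightarrow> 1) (at_right 0)" using assms by real_asymp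
  then show ?thesis using True by (simp add: F_def[abs_def] kappa_def)
next
  case False
  define c where "c = - b"
  have c: "c > 0" using False assms by (simp add: c_def)
  have "((\<lambda>x. (1 + a / x) powr (x - c)) \<longlongrightarrow> 0) (at_right 0)" using assms c by real_asymp
  then show ?thesis using False by (simp add: F_def[abs_def] kappa_def c_def)
qed

text \<open>
  For \<open>b < 0\<close> the function is the \<open>\<tau>\<close>-th power of a point of the segment studied above, with
  \<open>lam = - b / \<tau>\<close>. For \<open>b = 0\<close> it is a power of \<open>h alpha_star\<close>, up to scaling of the argument.
\<close>

lemma dens_lower_bound:
  assumes a: "a > 0" and b: "-1 < b" "b \<le> 0" and ab: "a \<le> alpha_star * (1 + b)" and t: "t \<ge> 0"
  shows "dens a (- b) t \<ge> 0"
    and "b < 0 \<Longrightarrow> dens a (- b) t \<ge> (- b) / 9 * (1 - 8 * b / (a / alpha_star - b))"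
proof -
  note A = alpha_star_bounds
  have A0: "alpha_star > 0" using A by simp
  have low: "dens a (- b) t \<ge> (- b) / 9 * (1 - 8 * b / (a / alpha_star - b))" if neg: "b < 0"
  proof -
    define \<tau> where "\<tau> = a / alpha_star - b"
    define lam where "lam = - b / \<tau>"
    have "a / alpha_star > 0" using a A0 by simp
    then have \<tau>: "\<tau> > 0" "- b < \<tau>" using neg by (auto simp: \<tau>_def)
    have "a / alpha_star \<le> 1 + b" using ab A0 by (simp add: divide_simps mult.commute)
    then have \<tau>1: "\<tau> \<le> 1" by (simp add: \<tau>_def)
    have lam: "0 < lam" "lam < 1" using \<tau> neg by (auto simp: lam_def divide_simps)
    interpret interpolation alpha_star lam using A lam by unfold_locales auto
    define m where "m = lam * (1 + 8 * lam) / 9"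
    have inner: "dens (alpha_star * th) lam u \<ge> m" if "u \<ge> 0" for u
    proof -
      have "th * dens alpha_star 0 u \<ge> 0" using th dens_alpha_star_nonneg[OF that] by simp
      moreover have "lam - 8/9 * (lam * th) = m" by (simp add: m_def th_def field_simps)
      ultimately show ?thesis using dens_interpolation[OF that] by linarith
    qed
    have "m \<ge> 0" using lam by (simp add: m_def)
    then have inner0: "\<forall>u\<ge>0. dens (alpha_star * th) lam u \<ge> 0" using inner by (meson order_trans)
    have e2: "\<tau> * lam = - b" using \<tau> by (simp add: lam_def)
    have e1: "\<tau> * (alpha_star * th) = a"
    proof -
      have "\<tau> * th = \<tau> - \<tau> * lam" by (simp add: th_def right_diff_distrib)
      then have "\<tau> * th = \<tau> + b" using e2 by simp
      also have "\<dots> = a / alpha_star" by (simp add: \<tau>_def)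
      finally show ?thesis using A0 by (simp add: mult.left_commute mult.commute)
    qed
    have "(- b) / 9 * (1 - 8 * b / \<tau>) = \<tau> * m"
    proof -
      have "\<tau> * m = (\<tau> * lam) * (1 + 8 * lam) / 9" by (simp add: m_def)
      also have "\<dots> = (- b) / 9 * (1 - 8 * b / \<tau>)" unfolding e2 by (simp add: lam_def)
      finally show ?thesis by simp
    qed
    also have "\<dots> \<le> \<tau> * dens (alpha_star * th) lam t" using inner[OF t] \<tau> by (intro mult_left_mono) auto
    also have "\<dots> \<le> dens (\<tau> * (alpha_star * th)) (\<tau> * lam) t"
      by (rule dens_power[OF inner0 \<tau>(1) \<tau>1 t])
    finally have "(- b) / 9 * (1 - 8 * b / \<tau>) \<le> dens a (- b) t" unfolding e1 e2 .
    then show ?thesis unfolding \<tau>_def .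
  qed
  then show "b < 0 \<Longrightarrow> dens a (- b) t \<ge> (- b) / 9 * (1 - 8 * b / (a / alpha_star - b))" .
  show "dens a (- b) t \<ge> 0"
  proof (cases "b = 0")
    case True
    have mem: "alpha_star \<in> bernstein_exponents" using dens_alpha_star_nonneg A0 by (simp add: bernstein_exponents_eq)
    have "a \<in> bernstein_exponents" by (rule bernstein_exponents_down[OF mem]) (use a ab True in auto)
    then show ?thesis using True t by (auto simp: bernstein_exponents_eq)
  next
    case False
    then have neg: "b < 0" using b by simp
    have "a / alpha_star > 0" using a A0 by simp
    then have "a / alpha_star - b > 0" using neg by simp
    then have "8 * b / (a / alpha_star - b) \<le> 0" using neg by (intro divide_nonpos_pos) auto
    then have "(- b) / 9 * (1 - 8 * b / (a / alpha_star - b)) \<ge> 0" using neg by (intro mult_nonneg_nonneg) auto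
    then show ?thesis using low[OF neg] by linarith
  qed
qed

lemma rho_eq:
  assumes "a > 0" "b \<le> 0" "a + (- b) < 3"
  shows "rho a b t = a * exp a * ker a (- b) (a * t)"
  using D_eq_dens(2)[of a "- b" "a * t"] assms by (simp add: rho_def ker_def exp_diff exp_minus field_simps)

lemma laplace_rho:
  assumes a: "a > 0" "b \<le> 0" "a + (- b) < 3" and x: "x > 0"
  shows "set_integrable lborel {0..} (\<lambda>t. exp (- x * t) * rho a b t)"
    and "(LINT t:{0..}|lborel. exp (- x * t) * rho a b t) = exp a - F a b x"
proof -
  define f where "f = (\<lambda>s. indicator {0..} s *\<^sub>R (s ^ 0 * exp (- (x / a) * s) * ker a (- b) s))"
  have int: "integrable lborel f"
    using lap_integrable[OF ker_subexp, of "x / a" 0 a "- b"] a x by (simp add: f_def set_integrable_def)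
  have eq: "f (0 + a * t) * (a * exp a) = indicator {0..} t *\<^sub>R (exp (- x * t) * rho a b t)" for t
    using a x by (simp add: f_def rho_eq[OF a] indicator_def zero_le_mult_iff)
  have "integrable lborel (\<lambda>t. f (0 + a * t))" using lborel_integrable_real_affine[OF int, of a 0] a by simp
  then have "integrable lborel (\<lambda>t. f (0 + a * t) * (a * exp a))" by (rule integrable_mult_left)
  then show "set_integrable lborel {0..} (\<lambda>t. exp (- x * t) * rho a b t)"
    unfolding eq set_integrable_def .
  have "(LINT t:{0..}|lborel. exp (- x * t) * rho a b t) = (LINT t|lborel. f (0 + a * t) * (a * exp a))"
    unfolding eq set_lebesgue_integral_def ..
  also have "\<dots> = exp a * (a * (LINT t|lborel. f (0 + a * t)))" by simp
  also have "a * (LINT t|lborel. f (0 + a * t)) = (LINT s|lborel. f s)"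
    using lborel_integral_real_affine[of a f 0] a by simp
  also have "(LINT s|lborel. f s) = lap (ker a (- b)) 0 (x / a)" by (simp add: f_def lap_def set_lebesgue_integral_def)
  also have "exp a * lap (ker a (- b)) 0 (x / a) = exp a - F a b x"
  proof -
    have "lap (ker a (- b)) 0 (x / a) = 1 - NF a (- b) (x / a)" using NF_lap[of "x / a" a "- b"] a x by simp
    then show ?thesis using F_NF[of a x b] a x by (simp add: right_diff_distrib)
  qed
  finally show "(LINT t:{0..}|lborel. exp (- x * t) * rho a b t) = exp a - F a b x" .
qed

text \<open>
  The density is nonnegative, so monotone convergence lets \<open>x\<close> decrease to 0 in
  \<open>\<integral> exp (- x * t) * rho a b t dt = exp a - F a b x\<close>, where \<open>F a b x\<close> tends to \<open>kappa b\<close>.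
\<close>

lemma rho_mass:
  assumes a: "a > 0" "b \<le> 0" "a + (- b) < 3" and nn: "\<forall>t\<ge>0. rho a b t \<ge> 0" and c: "continuous_on {0..} (rho a b)"
  shows "set_integrable lborel {0..} (rho a b)"
    and "(LINT t:{0..}|lborel. rho a b t) = exp a - kappa b"
proof -
  define X where "X = (\<lambda>i. 1 / (real i + 1))"
  define f where "f = (\<lambda>i t. indicator {0..} t *\<^sub>R (exp (- X i * t) * rho a b t))"
  define u where "u = (\<lambda>t. indicator {0..} t *\<^sub>R rho a b t)"
  have X: "X i > 0" for i by (simp add: X_def)
  have X0: "X \<longlonglongrightarrow> 0" unfolding X_def by real_asymp
  have i: "integrable lborel (f i)" for i
    using laplace_rho(1)[OF a X] by (simp add: f_def set_integrable_def)
  have m: "AE t in lborel. mono (\<lambda>n. f n t)"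
  proof (intro AE_I2 monoI)
    fix t :: real and i j :: nat assume ij: "i \<le> j"
    have "X j \<le> X i" using ij by (simp add: X_def frac_le)
    then have "exp (- X i * t) * rho a b t \<le> exp (- X j * t) * rho a b t" if "t \<ge> 0"
      using nn that by (intro mult_right_mono) (auto intro: mult_right_mono)
    then show "f i t \<le> f j t" by (simp add: f_def indicator_def)
  qed
  have l: "AE t in lborel. (\<lambda>i. f i t) \<longlonglongrightarrow> u t"
  proof (intro AE_I2)
    fix t
    have "(\<lambda>i. indicator {0..} t *\<^sub>R (exp (- X i * t) * rho a b t)) \<longlonglongrightarrow> indicator {0..} t *\<^sub>R (exp (- 0 * t) * rho a b t)"
      by (intro tendsto_intros X0)
    then show "(\<lambda>i. f i t) \<longlonglongrightarrow> u t" by (simp add: f_def u_def)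
  qed
  have "filterlim X (at_right 0) sequentially"
    using X0 by (simp add: filterlim_at X less_imp_neq[OF X, symmetric])
  from filterlim_compose[OF F_tendsto_0[OF a(1,2)] this]
  have "(\<lambda>i. exp a - F a b (X i)) \<longlonglongrightarrow> exp a - kappa b" by (intro tendsto_intros)
  moreover have "integral\<^sup>L lborel (f i) = exp a - F a b (X i)" for i
    using laplace_rho(2)[OF a X] by (simp add: f_def set_lebesgue_integral_def)
  ultimately have lim: "(\<lambda>i. integral\<^sup>L lborel (f i)) \<longlonglongrightarrow> exp a - kappa b" by simp
  have meas: "u \<in> borel_measurable lborel"
    using set_borel_measurable_continuous_on[OF c] by (simp add: u_def set_borel_measurable_def)
  show "set_integrable lborel {0..} (rho a b)"
    using integrable_monotone_convergence[OF i m l lim meas] by (simp add: u_def set_integrable_def)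
  show "(LINT t:{0..}|lborel. rho a b t) = exp a - kappa b"
    using integral_monotone_convergence[OF i m l lim meas] by (simp add: u_def set_lebesgue_integral_def)
qed

lemma bernstein_exponent_max:
  assumes C: "\<forall>b a :: real. -1 < b \<longrightarrow> b \<le> 0 \<longrightarrow> 0 < a \<longrightarrow> a \<le> C * (1 + b) \<longrightarrow> bernstein_function (F a b)"
  shows "C \<le> alpha_star"
proof (cases "C > 0")
  case True
  then have "bernstein_function (F C 0)" using C by simp
  then have "bernstein_function (h C)"
    by (rule bernstein_scale[OF _ True]) (use True in \<open>auto simp: F_def h_def\<close>)
  then have "C \<in> bernstein_exponents" using True by (simp add: bernstein_exponents_def)
  then show ?thesis unfolding alpha_star_eq by (rule cSup_upper[OF _ bdd_above_bernstein_exponents])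
qed (use alpha_star_bounds in simp)

lemma
  assumes a: "0 < a" and b: "-1 < b" "b \<le> 0" and ab: "a \<le> alpha_star * (1 + b)"
  shows bernstein_F_admissible: "bernstein_function (F a b)"
    and admissible_less_3: "a + (- b) < 3"
    and D_integrand_admissible: "set_integrable lborel {0<..<1} (D_integrand a (- b) t)"
    and rho_continuous: "continuous_on {0..} (rho a b)"
    and rho_nonneg: "t \<ge> 0 \<Longrightarrow> rho a b t \<ge> 0"
    and rho_integrable: "set_integrable lborel {0..} (rho a b)"
    and rho_representation:
      "x > 0 \<Longrightarrow> F a b x = kappa b + (LINT t:{0..}|lborel. (1 - exp (- x * t)) * rho a b t)"
    and rho_total_mass: "(LINT t:{0..}|lborel. rho a b t) = exp a - kappa b"
    and rho_lower_bound: "b < 0 \<Longrightarrow>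
        (let \<tau> = a / alpha_star - b in
           - b < \<tau> \<and> \<tau> \<le> 1
         \<and> (\<forall>t\<ge>0. rho a b t \<ge> (- a * b) / 9 * (1 - 8 * b / \<tau>) * exp (a - a * t)
                 \<and> (- a * b) / 9 * (1 - 8 * b / \<tau>) * exp (a - a * t) > 0))"
proof -
  note A = alpha_star_bounds
  have A0: "alpha_star > 0" using A by simp
  have a3: "a + (- b) < 3"
  proof -
    have "alpha_star * (1 + b) \<le> 58/25 * (1 + b)" using A b by (intro mult_right_mono) auto
    then show ?thesis using ab b by simp
  qed
  note pos = dens_lower_bound(1)[OF a b ab]
  have D: "D a (- b) t = dens a (- b) t" for t using D_eq_dens(2)[of a "- b" t] a b a3 by simp
  have rn: "\<forall>t\<ge>0. rho a b t \<ge> 0" using a pos by (simp add: rho_def D)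
  have rc: "continuous_on {0..} (rho a b)"
  proof -
    have "rho a b = (\<lambda>t. a * exp (a - a * t) * dens a (- b) (a * t))" by (simp add: rho_def D fun_eq_iff)
    moreover have "continuous_on {0..} (\<lambda>t. dens a (- b) (a * t))"
      by (rule continuous_on_compose2[OF dens_continuous[of UNIV]]) (auto intro!: continuous_intros)
    ultimately show ?thesis by (auto intro!: continuous_intros)
  qed
  note mass = rho_mass[OF a b(2) a3 rn rc]
  have rep: "F a b x = kappa b + (LINT t:{0..}|lborel. (1 - exp (- x * t)) * rho a b t)" if x: "x > 0" for x
  proof -
    have "(LINT t:{0..}|lborel. (1 - exp (- x * t)) * rho a b t)
        = (LINT t:{0..}|lborel. rho a b t - exp (- x * t) * rho a b t)" by (simp add: algebra_simps)
    also have "\<dots> = (exp a - kappa b) - (exp a - F a b x)"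
      using set_integral_diff(2)[OF mass(1) laplace_rho(1)[OF a b(2) a3 x]] mass(2) laplace_rho(2)[OF a b(2) a3 x] by simp
    finally show ?thesis by simp
  qed
  have bound: "let \<tau> = a / alpha_star - b in
         - b < \<tau> \<and> \<tau> \<le> 1
       \<and> (\<forall>t\<ge>0. rho a b t \<ge> (- a * b) / 9 * (1 - 8 * b / \<tau>) * exp (a - a * t)
               \<and> (- a * b) / 9 * (1 - 8 * b / \<tau>) * exp (a - a * t) > 0)" if neg: "b < 0"
  proof -
    define \<tau> where "\<tau> = a / alpha_star - b"
    have "a / alpha_star > 0" using a A0 by simp
    then have t1: "- b < \<tau>" by (simp add: \<tau>_def)
    have "a / alpha_star \<le> 1 + b" using ab A0 by (simp add: divide_simps mult.commute)
    then have t2: "\<tau> \<le> 1" by (simp add: \<tau>_def)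
    have fac: "(- b) / 9 * (1 - 8 * b / \<tau>) > 0"
    proof (intro mult_pos_pos)
      have "8 * b / \<tau> < 0" using neg t1 by (intro divide_neg_pos) auto
      then show "1 - 8 * b / \<tau> > 0" by simp
    qed (use neg in simp)
    have eq: "(- a * b) / 9 * (1 - 8 * b / \<tau>) * exp (a - a * t) = a * exp (a - a * t) * ((- b) / 9 * (1 - 8 * b / \<tau>))" for t
      by simp
    have "a * exp (a - a * t) * ((- b) / 9 * (1 - 8 * b / \<tau>)) > 0" for t
      by (rule mult_pos_pos[OF mult_pos_pos[OF a exp_gt_zero] fac])
    moreover have "rho a b t \<ge> a * exp (a - a * t) * ((- b) / 9 * (1 - 8 * b / \<tau>))" if "t \<ge> 0" for t
      unfolding rho_def D \<tau>_def
      using a that by (intro mult_left_mono dens_lower_bound(2)[OF a b ab _ neg]) auto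
    ultimately show ?thesis unfolding Let_def \<tau>_def[symmetric] eq using t1 t2 by simp
  qed
  show "bernstein_function (F a b)" using pos by (intro bernstein_F a) auto
  show "a + (- b) < 3" "continuous_on {0..} (rho a b)" by (fact a3 rc)+
  show "set_integrable lborel {0<..<1} (D_integrand a (- b) t)" using D_eq_dens(1)[of a "- b"] a b a3 by simp
  show "t \<ge> 0 \<Longrightarrow> rho a b t \<ge> 0" using rn by simp
  show "set_integrable lborel {0..} (rho a b)" "(LINT t:{0..}|lborel. rho a b t) = exp a - kappa b" by (fact mass)+
  show "x > 0 \<Longrightarrow> F a b x = kappa b + (LINT t:{0..}|lborel. (1 - exp (- x * t)) * rho a b t)" by (fact rep)
  show "b < 0 \<Longrightarrow>
        (let \<tau> = a / alpha_star - b in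
           - b < \<tau> \<and> \<tau> \<le> 1
         \<and> (\<forall>t\<ge>0. rho a b t \<ge> (- a * b) / 9 * (1 - 8 * b / \<tau>) * exp (a - a * t)
                 \<and> (- a * b) / 9 * (1 - 8 * b / \<tau>) * exp (a - a * t) > 0))" by (fact bound)
qed

theorem theorem11:
  "(\<forall>a b :: real. 0 < a \<longrightarrow> -1 < b \<longrightarrow> b \<le> 0 \<longrightarrow> a \<le> alpha_star * (1 + b) \<longrightarrow>
      bernstein_function (F a b)
    \<and> a + (- b) < 3
    \<and> (\<forall>t\<ge>0. set_integrable lborel {0<..<1} (D_integrand a (- b) t))
    \<and> continuous_on {0..} (rho a b)
    \<and> (\<forall>t\<ge>0. rho a b t \<ge> 0)
    \<and> set_integrable lborel {0..} (rho a b)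
    \<and> (\<forall>x>0. F a b x = kappa b + (LINT t:{0..}|lborel. (1 - exp (- x * t)) * rho a b t))
    \<and> (LINT t:{0..}|lborel. rho a b t) = exp a - kappa b
    \<and> (b < 0 \<longrightarrow>
        (let \<tau> = a / alpha_star - b in
           - b < \<tau> \<and> \<tau> \<le> 1
         \<and> (\<forall>t\<ge>0. rho a b t \<ge> (- a * b) / 9 * (1 - 8 * b / \<tau>) * exp (a - a * t)
                 \<and> (- a * b) / 9 * (1 - 8 * b / \<tau>) * exp (a - a * t) > 0))))
  \<and> (\<forall>b a :: real. -1 < b \<longrightarrow> b \<le> 0 \<longrightarrow> 0 < a \<longrightarrow> a \<le> alpha_star * (1 + b) \<longrightarrow>
        bernstein_function (F a b))
  \<and> (\<forall>C :: real.
        (\<forall>b a :: real. -1 < b \<longrightarrow> b \<le> 0 \<longrightarrow> 0 < a \<longrightarrow> a \<le> C * (1 + b) \<longrightarrow>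
           bernstein_function (F a b))
        \<longrightarrow> C \<le> alpha_star)"
  by (intro conjI allI impI)
     (rule bernstein_F_admissible admissible_less_3 D_integrand_admissible rho_continuous rho_nonneg
       rho_integrable rho_representation rho_total_mass rho_lower_bound bernstein_exponent_max; assumption)+

end
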